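(* Let $1<p<\infty$ and let $X=(X,d,\mu)$ be an unbounded metric measure space such that $\mu$ is globally doubling and supports a global $p$-Poincaré inequality. Let $x_0\in X$ and write $B_r:=B(x_0,r)$. If $X$ is annularly quasiconvex around $x_0$ and $u$ is quasiharmonic on $X$, then there are constants $\beta>0$ and $C>0$ such that whenever $0<r<R$, $$\int_{B_r}g_u^p\,d\mu\le C\Bigl(\frac rR\Bigr)^\beta\int_{B_R}g_u^p\,d\mu.$$
   Context: Throughout, $1<p<\infty$ and $X=(X,d,\mu)$ is a metric space with a positive complete Borel measure $\mu$ such that $0<\mu(B)<\infty$ for all balls $B\subset X$. $X$ need not be complete. Balls are open and come with a prescribed centre and radius $r_B$; $\lambda B$ is the concentric ball with radius $\lambda r_B$. The constant $C$ may depend on $X$, $\mu$, $p$, $x_0$ and the quasiminimizing constant of $u$, but not on $r$ and $R$. Upper gradients. Curves are nonconstant, compact and rectifiable, parameterized by arc length $ds$. A property holds for $p$-almost every curve if for the family $\Gamma$ of curves for which it fails there is a Borel function $0\le\rho\in L^p(X)$ with $\int_\gamma\rho\,ds=\infty$ for all $\gamma\in\Gamma$. A measurable $g:X\to[0,\infty]$ is a $p$-weak upper gradient of $u:X\to[-\infty,\infty]$ if for $p$-almost every curve $\gamma:[0,l_\gamma]\to X$, $|u(\gamma(0))-u(\gamma(l_\gamma))|\le\int_\gamma g\,ds$ (left-hand side $\infty$ if a term is $\pm\infty$). If $u$ has a $p$-weak upper gradient in $L^p_{\rm loc}$, then $g_u$ denotes the minimal one (a.e. smallest). For measurable $u$,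 $\|u\|_{N^{1,p}(X)}^p=\int_X|u|^p\,d\mu+\inf_g\int_Xg^p\,d\mu$, infimum over $p$-weak upper gradients $g$ of $u$, and $N^{1,p}(X)=\{u:\|u\|_{N^{1,p}(X)}<\infty\}$ (functions defined everywhere); $N^{1,p}(E)$ is defined by regarding a measurable set $E$ as a metric measure space in its own right. Doubling and Poincaré. $\mu$ is globally doubling if there is $C>0$ with $\mu(2B)\le C\mu(B)$ for all balls $B$. $\mu$ supports a global $p$-Poincaré inequality if there are $C>0$, $\lambda\ge1$ such that for all balls $B$, all integrable $u$ on $\lambda B$ and all $p$-weak upper gradients $g$ of $u$, $\frac1{\mu(B)}\int_B|u-u_B|\,d\mu\le Cr_B\bigl(\frac1{\mu(\lambda B)}\int_{\lambda B}g^p\,d\mu\bigr)^{1/p}$, where $u_B=\frac1{\mu(B)}\int_Bu\,d\mu$. Quasiharmonic functions on $X$. A function $u$ on $X$ with $u\in N^{1,p}(G)$ for every bounded open $G\subset X$ is a quasiminimizer on $X$ if there is $Q\ge1$ (a quasiminimizing constant) with $\int_{\{\varphi\ne0\}}g_u^p\,d\mu\le Q\int_{\{\varphi\ne0\}}g_{u+\varphi}^p\,d\mu$ for all $\varphi$ in the closure in $N^{1,p}(X)$ of the functions in $N^{1,p}(X)$ vanishing outside some bounded open set (this closure is $N^{1,p}(X)$). A continuous (real-valued) quasiminimizer is called quasiharmonic. Annular quasiconvexity. $X$ is annularly quasiconvex around $x_0$ if there exists $\Lambda\ge2$ such that for every $r>0$, each pair of points $x,y\in B_{2r}\setminus B_r$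 can be connected within $B_{\Lambda r}\setminus B_{r/\Lambda}$ by a curve of length at most $\Lambda d(x,y)$. *)

theory Defs
  imports "HOL-Analysis.Analysis"
begin

section \<open>Metric measure spaces\<close>

text \<open>
  The metric space is the whole type \<open>'a\<close>. A complete Borel measure is one whose \<open>\<sigma>\<close>-algebra is
  the completion of the Borel \<open>\<sigma>\<close>-algebra.
\<close>

definition metric_measure_space :: "'a::metric_space measure \<Rightarrow> bool" where
  "metric_measure_space M \<longleftrightarrow>
     (\<exists>N. sets N = sets borel \<and> M = completion N) \<and>
     (\<forall>x r. 0 < r \<longrightarrow> 0 < emeasure M (ball x r) \<and> emeasure M (ball x r) < \<infinity>)"

definition globally_doubling :: "'a::metric_space measure \<Rightarrow> bool" where
  "globally_doubling M \<longleftrightarrow>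
     (\<exists>C>0. \<forall>x r. 0 < r \<longrightarrow> emeasure M (ball x (2 * r)) \<le> ennreal C * emeasure M (ball x r))"

text \<open>Powers of \<open>[0,\<infinity>]\<close>-valued quantities; only used with exponents \<open>q > 0\<close>.\<close>

definition epow :: "ennreal \<Rightarrow> real \<Rightarrow> ennreal" where
  "epow x q = (if x = \<infinity> then \<infinity> else ennreal (enn2real x powr q))"


section \<open>Curves\<close>

definition curve_length :: "(real \<Rightarrow> 'a::metric_space) \<Rightarrow> real \<Rightarrow> real \<Rightarrow> ennreal" where
  "curve_length \<gamma> a b =
     (SUP ts\<in>{ts. sorted ts \<and> set ts \<subseteq> {a..b}}.
        \<Sum>i<length ts - 1. ennreal (dist (\<gamma> (ts ! i)) (\<gamma> (ts ! Suc i))))"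

text \<open>
  Nonconstant compact rectifiable curves in \<open>E\<close>, given by their arc length parameterization
  on \<open>[0,l]\<close>; nonconstancy amounts to \<open>l > 0\<close>.
\<close>

definition arc_length_curve :: "'a::metric_space set \<Rightarrow> (real \<Rightarrow> 'a) \<Rightarrow> real \<Rightarrow> bool" where
  "arc_length_curve E \<gamma> l \<longleftrightarrow>
     0 < l \<and> continuous_on {0..l} \<gamma> \<and> \<gamma> ` {0..l} \<subseteq> E \<and>
     (\<forall>s t. 0 \<le> s \<and> s \<le> t \<and> t \<le> l \<longrightarrow> curve_length \<gamma> s t = ennreal (t - s))"

definition curve_integral :: "('a \<Rightarrow> ennreal) \<Rightarrow> (real \<Rightarrow> 'a) \<Rightarrow> real \<Rightarrow> ennreal" where
  "curve_integral g \<gamma> l = (\<integral>\<^sup>+ t\<in>{0..l}. g (\<gamma> t) \<partial>lebesgue)"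


section \<open>Upper gradients and Newtonian spaces\<close>

text \<open>
  From here up to and including \<open>N1p\<close> the space is \<open>space M\<close>, with the metric inherited from
  the type: a measurable set \<open>E\<close> regarded as a metric measure space in its own right is
  \<open>restrict_space M E\<close>.
\<close>

definition ae_curve ::
  "real \<Rightarrow> 'a::metric_space measure \<Rightarrow> ((real \<Rightarrow> 'a) \<Rightarrow> real \<Rightarrow> bool) \<Rightarrow> bool" where
  "ae_curve p M P \<longleftrightarrow>
     (\<exists>\<rho>\<in>borel_measurable (restrict_space borel (space M)).
        (\<integral>\<^sup>+ x. epow (\<rho> x) p \<partial>M) < \<infinity> \<and>
        (\<forall>\<gamma> l. arc_length_curve (space M) \<gamma> l \<and> \<not> P \<gamma> l \<longrightarrow> curve_integral \<rho> \<gamma> l = \<infinity>))"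

text \<open>
  In \<^typ>\<open>ereal\<close>, \<open>\<bar>a - b\<bar> = \<infinity>\<close> as soon as \<open>a\<close> or \<open>b\<close> is infinite, which is the convention for the
  left-hand side below. For measurable \<open>g\<close>, the composition \<open>g \<circ> \<gamma>\<close> is Lebesgue measurable for
  \<open>p\<close>-almost every \<open>\<gamma>\<close>, so no measurability condition along \<open>\<gamma>\<close> is needed.
\<close>

definition weak_upper_gradient ::
  "real \<Rightarrow> 'a::metric_space measure \<Rightarrow> ('a \<Rightarrow> ereal) \<Rightarrow> ('a \<Rightarrow> ennreal) \<Rightarrow> bool" where
  "weak_upper_gradient p M u g \<longleftrightarrow>
     g \<in> borel_measurable M \<and>
     ae_curve p M (\<lambda>\<gamma> l. e2ennreal \<bar>u (\<gamma> 0) - u (\<gamma> l)\<bar> \<le> curve_integral g \<gamma> l)"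

definition Lp_loc :: "real \<Rightarrow> 'a::metric_space measure \<Rightarrow> ('a \<Rightarrow> ennreal) \<Rightarrow> bool" where
  "Lp_loc p M g \<longleftrightarrow>
     g \<in> borel_measurable M \<and>
     (\<forall>x\<in>space M. \<exists>r>0. (\<integral>\<^sup>+ y\<in>ball x r. epow (g y) p \<partial>M) < \<infinity>)"

definition is_minimal_wug ::
  "real \<Rightarrow> 'a::metric_space measure \<Rightarrow> ('a \<Rightarrow> ereal) \<Rightarrow> ('a \<Rightarrow> ennreal) \<Rightarrow> bool" where
  "is_minimal_wug p M u g \<longleftrightarrow>
     weak_upper_gradient p M u g \<and> Lp_loc p M g \<and>
     (\<forall>h. weak_upper_gradient p M u h \<and> Lp_loc p M h \<longrightarrow> (AE x in M. g x \<le> h x))"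

text \<open>A representative of \<open>g\<^sub>u\<close>, which is unique up to a.e. equality.\<close>

definition minimal_wug ::
  "real \<Rightarrow> 'a::metric_space measure \<Rightarrow> ('a \<Rightarrow> ereal) \<Rightarrow> 'a \<Rightarrow> ennreal" where
  "minimal_wug p M u = (SOME g. is_minimal_wug p M u g)"

definition N1p_norm :: "real \<Rightarrow> 'a::metric_space measure \<Rightarrow> ('a \<Rightarrow> ereal) \<Rightarrow> ennreal" where
  "N1p_norm p M u =
     epow ((\<integral>\<^sup>+ x. epow (e2ennreal \<bar>u x\<bar>) p \<partial>M) +
           (INF g\<in>{g. weak_upper_gradient p M u g}. \<integral>\<^sup>+ x. epow (g x) p \<partial>M)) (1 / p)"

definition N1p :: "real \<Rightarrow> 'a::metric_space measure \<Rightarrow> ('a \<Rightarrow> ereal) set" where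
  "N1p p M = {u \<in> borel_measurable M. N1p_norm p M u < \<infinity>}"

definition poincare_inequality :: "real \<Rightarrow> 'a::metric_space measure \<Rightarrow> bool" where
  "poincare_inequality p M \<longleftrightarrow>
     (\<exists>C>0. \<exists>\<Lambda>\<ge>1. \<forall>x r. 0 < r \<longrightarrow>
       (let B = ball x r; \<Lambda>B = ball x (\<Lambda> * r) in
        \<forall>u g. u \<in> borel_measurable (restrict_space M \<Lambda>B) \<and>
          (\<integral>\<^sup>+ y\<in>\<Lambda>B. e2ennreal \<bar>u y\<bar> \<partial>M) < \<infinity> \<and>
          weak_upper_gradient p (restrict_space M \<Lambda>B) u g \<longrightarrow>
          (let u\<^sub>B = (LINT y:B|M. real_of_ereal (u y)) / measure M B in
           (\<integral>\<^sup>+ y\<in>B. e2ennreal \<bar>u y - ereal u\<^sub>B\<bar> \<partial>M) / emeasure M B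
             \<le> ennreal (C * r) *
               epow ((\<integral>\<^sup>+ y\<in>\<Lambda>B. epow (g y) p \<partial>M) / emeasure M \<Lambda>B) (1 / p))))"


section \<open>Quasiharmonic functions\<close>

text \<open>
  The closure in \<open>N\<^sup>1\<^sup>,\<^sup>p(X)\<close> of the functions vanishing outside some bounded open set.
  Functions in \<open>N\<^sup>1\<^sup>,\<^sup>p(X)\<close> are infinite only on a set of capacity zero, so the value of
  \<open>\<infinity> - \<infinity>\<close> is irrelevant here and in \<open>u + \<phi>\<close> below.
\<close>

definition test_functions :: "real \<Rightarrow> 'a::metric_space measure \<Rightarrow> ('a \<Rightarrow> ereal) set" where
  "test_functions p M =
     {\<phi> \<in> N1p p M. \<forall>\<epsilon>>0. \<exists>\<psi>\<in>N1p p M.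
        (\<exists>G. open G \<and> bounded G \<and> (\<forall>x. x \<notin> G \<longrightarrow> \<psi> x = 0)) \<and>
        N1p_norm p M (\<lambda>x. \<phi> x - \<psi> x) < ennreal \<epsilon>}"

definition quasiminimizer_with ::
  "real \<Rightarrow> 'a::metric_space measure \<Rightarrow> real \<Rightarrow> ('a \<Rightarrow> ereal) \<Rightarrow> bool" where
  "quasiminimizer_with p M Q u \<longleftrightarrow>
     1 \<le> Q \<and>
     (\<forall>G. open G \<and> bounded G \<longrightarrow> u \<in> N1p p (restrict_space M G)) \<and>
     (\<forall>\<phi>\<in>test_functions p M.
        (\<integral>\<^sup>+ x\<in>{x. \<phi> x \<noteq> 0}. epow (minimal_wug p M u x) p \<partial>M)
          \<le> ennreal Q *
            (\<integral>\<^sup>+ x\<in>{x. \<phi> x \<noteq> 0}. epow (minimal_wug p M (\<lambda>y. u y + \<phi> y) x) p \<partial>M))"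

text \<open>Quasiharmonic with quasiminimizing constant \<open>Q\<close>.\<close>

definition quasiharmonic_with ::
  "real \<Rightarrow> 'a::metric_space measure \<Rightarrow> real \<Rightarrow> ('a \<Rightarrow> real) \<Rightarrow> bool" where
  "quasiharmonic_with p M Q u \<longleftrightarrow>
     continuous_on UNIV u \<and> quasiminimizer_with p M Q (\<lambda>x. ereal (u x))"


section \<open>Annular quasiconvexity\<close>

text \<open>The connecting curve may be constant, as it must be when \<open>x = y\<close>.\<close>

definition annularly_quasiconvex_around :: "'a::metric_space \<Rightarrow> bool" where
  "annularly_quasiconvex_around x0 \<longleftrightarrow>
     (\<exists>\<Lambda>\<ge>2. \<forall>r>0. \<forall>x \<in> ball x0 (2 * r) - ball x0 r. \<forall>y \<in> ball x0 (2 * r) - ball x0 r.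
        \<exists>\<gamma>. path \<gamma> \<and> pathstart \<gamma> = x \<and> pathfinish \<gamma> = y \<and>
            path_image \<gamma> \<subseteq> ball x0 (\<Lambda> * r) - ball x0 (r / \<Lambda>) \<and>
            curve_length \<gamma> 0 1 \<le> ennreal (\<Lambda> * dist x y))"

end

theory Submission
  imports Defs
begin

text \<open>
  Write \<open>I(\<rho>)\<close> for the energy \<open>\<integral> g\<^sub>u\<^sup>p\<close> over the ball of radius \<open>\<rho>\<close> about \<open>x0\<close>. The decay comes from
  Widman's hole filling. Testing quasiminimality with \<open>\<eta> (c - u)\<close>, where \<open>\<eta>\<close> is a cutoff for \<open>B\<^sub>r\<close> in
  \<open>B\<^sub>2\<^sub>r\<close>, replaces \<open>u\<close> by the constant \<open>c\<close> on \<open>B\<^sub>r\<close> and yields (\<open>caccioppoli\<close>)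
  \<open>I(2r) \<le> C \<integral>\<^sub>A (g\<^sub>u\<^sup>p + r\<^sup>-\<^sup>p \<bar>u - c\<bar>\<^sup>p)\<close> on the annulus \<open>A = B\<^sub>2\<^sub>r - B\<^sub>r\<close>. A Poincare inequality on the
  annulus (\<open>annulus_poincare\<close>) absorbs the second term into the energy of a larger annulus, which is
  the difference of two balls about \<open>x0\<close>. Hence \<open>I(\<rho>) \<le> K (I(\<sigma>\<rho>) - I(\<rho>))\<close>, that is,
  \<open>I(\<rho>) \<le> K/(1+K) I(\<sigma>\<rho>)\<close> for all radii (\<open>energy_decay\<close>), and iteration gives a power of \<open>r/R\<close>.

  The Poincare inequality on the annulus is where annular quasiconvexity enters. At a point \<open>x\<close> the
  continuous function \<open>u\<close> is the limit of its averages over the balls \<open>B(x, 2\<^sup>-\<^sup>i s)\<close>. Consecutive averages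
  differ by the Poincare inequality, and since \<open>p > 1\<close> the resulting sum is controlled linearly by
  the mean energies (\<open>telescope\<close>); these can be integrated over \<open>x\<close> by exchanging integrals
  (\<open>integral_ball_average_le\<close>). The averages over balls of the fixed radius \<open>s\<close>, a small multiple
  of \<open>r\<close>, are compared with each other along connecting curves that stay away from \<open>x0\<close>, in a
  bounded number of steps (\<open>chain_along_curve\<close>).

  The remaining work is the theory of the minimal gradient. Along almost every curve, being a weak
  upper gradient means that increments of \<open>u\<close> are bounded by integrals of the gradient over all
  subintervals (\<open>controls\<close>). Gradients can be exchanged for one another along Borel sets
  (\<open>controls_mix\<close>), so countable infima of gradients are gradients and a minimal one exists
  (\<open>ex_minimal_wug\<close>). The rules for gradients that the test function needs, namely vanishing on level
  sets and the product rule, are proved curve by curve as well.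
\<close>


section \<open>Powers in the extended half-line\<close>

lemma epow_top [simp]: "epow top q = top"
  by (simp add: epow_def)

lemma epow_ennreal: "0 \<le> x \<Longrightarrow> epow (ennreal x) q = ennreal (x powr q)"
  by (simp add: epow_def)

lemma epow_zero [simp]: "epow 0 q = 0"
  by (simp add: epow_def)

lemma epow_mono:
  assumes "0 < q" "x \<le> y" shows "epow x q \<le> epow y q"
proof (cases y)
  case (real b)
  moreover obtain a where "x = ennreal a" "0 \<le> a"
    using assms(2) real by (cases x) (auto simp: top_unique)
  ultimately show ?thesis
    using assms by (auto simp: epow_ennreal intro!: ennreal_leI powr_mono2)
qed simp

lemma epow_epow:
  assumes "0 < q" "0 < s" shows "epow (epow x q) s = epow x (q * s)"
  by (cases x) (auto simp: epow_ennreal powr_powr)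

lemma epow_one [simp]: "epow x 1 = x"
  by (cases x) (auto simp: epow_ennreal)

lemma epow_eq_top_iff [simp]: "epow x q = top \<longleftrightarrow> x = top"
  by (cases x) (auto simp: epow_ennreal)

lemma epow_less_top_iff [simp]: "epow x q < top \<longleftrightarrow> x < top"
  by (simp flip: less_top)

lemma epow_eq_zero_iff [simp]: "epow x q = 0 \<longleftrightarrow> x = 0"
  by (cases x) (auto simp: epow_ennreal ennreal_eq_0_iff)

lemma epow_mult: "epow (x * y) q = epow x q * epow y q"
proof (cases "x = 0 \<or> y = 0 \<or> x = top \<or> y = top")
  case True
  then show ?thesis by (auto simp: ennreal_mult_top ennreal_top_mult)
next
  case False
  then obtain a b where "x = ennreal a" "0 \<le> a" "y = ennreal b" "0 \<le> b"
    by (cases x; cases y) auto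
  then show ?thesis
    by (simp add: epow_ennreal powr_mult flip: ennreal_mult)
qed

lemma epow_inverse_le_iff:
  assumes "0 < q" shows "x \<le> epow y (1 / q) \<longleftrightarrow> epow x q \<le> y"
proof
  assume "x \<le> epow y (1 / q)"
  from epow_mono[OF assms this] show "epow x q \<le> y"
    using assms by (simp add: epow_epow)
next
  assume "epow x q \<le> y"
  from epow_mono[of "1 / q", OF _ this] show "x \<le> epow y (1 / q)"
    using assms by (simp add: epow_epow)
qed

lemma epow_add_le:
  assumes "0 < q" shows "epow (x + y) q \<le> ennreal (2 powr q) * (epow x q + epow y q)"
proof -
  have "x + y \<le> ennreal 2 * max x y"
    by (metis add_mono ennreal_numeral max.cobounded1 max.cobounded2 mult_2)
  from epow_mono[OF assms this]
  have "epow (x + y) q \<le> epow (ennreal 2) q * epow (max x y) q"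
    by (simp add: epow_mult)
  also have "\<dots> \<le> ennreal (2 powr q) * (epow x q + epow y q)"
    using epow_ennreal[of 2 q] by (auto simp: max_def intro!: mult_left_mono)
  finally show ?thesis .
qed

text \<open>
  Weights and gradients are combined by suprema instead of sums, since the \<open>p\<close>-th power of a supremum
  is at most the sum of the \<open>p\<close>-th powers.
\<close>

lemma epow_SUP_le:
  fixes a :: "nat \<Rightarrow> ennreal"
  assumes "0 < q" shows "epow (SUP k. a k) q \<le> (\<Sum>k. epow (a k) q)"
proof -
  have "epow (a k) q \<le> (\<Sum>k. epow (a k) q)" for k
    using sum_le_suminf[of "\<lambda>k. epow (a k) q" "{k}"] by simp
  then have "(SUP k. a k) \<le> epow (\<Sum>k. epow (a k) q) (1 / q)"
    by (intro SUP_least) (simp add: epow_inverse_le_iff assms)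
  then show ?thesis
    by (simp add: epow_inverse_le_iff assms)
qed

lemma epow_measurable [measurable (raw)]:
  assumes [measurable]: "f \<in> borel_measurable M" shows "(\<lambda>x. epow (f x) q) \<in> borel_measurable M"
  unfolding epow_def by measurable


section \<open>Functions controlled by a density on an interval\<close>

text \<open>
  For a density \<open>K\<close> with finite integral this says that \<open>f\<close> is absolutely continuous with
  \<open>\<bar>f'\<bar> \<le> K\<close> almost everywhere. The integral form is additive over intervals and passes to limits.
\<close>

definition controls :: "(real \<Rightarrow> real) \<Rightarrow> (real \<Rightarrow> ennreal) \<Rightarrow> real \<Rightarrow> bool" where
  "controls f K l \<longleftrightarrow>
     (\<forall>s t. 0 \<le> s \<and> s \<le> t \<and> t \<le> l \<longrightarrow> ennreal \<bar>f s - f t\<bar> \<le> (\<integral>\<^sup>+ \<tau>\<in>{s..t}. K \<tau> \<partial>lborel))"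

lemma controlsD:
  "controls f K l \<Longrightarrow> 0 \<le> s \<Longrightarrow> s \<le> t \<Longrightarrow> t \<le> l \<Longrightarrow>
    ennreal \<bar>f s - f t\<bar> \<le> (\<integral>\<^sup>+ \<tau>\<in>{s..t}. K \<tau> \<partial>lborel)"
  by (auto simp: controls_def)

lemma ennreal_abs_triangle:
  fixes a b c :: real shows "ennreal \<bar>a - c\<bar> \<le> ennreal \<bar>a - b\<bar> + ennreal \<bar>b - c\<bar>"
  by (simp flip: ennreal_plus)

lemma interval_integral_split:
  fixes K :: "real \<Rightarrow> ennreal"
  assumes [measurable]: "K \<in> borel_measurable borel" and "s \<le> m" "m \<le> t"
  shows "(\<integral>\<^sup>+ \<tau>\<in>{s..t}. K \<tau> \<partial>lborel) =
    (\<integral>\<^sup>+ \<tau>\<in>{s..m}. K \<tau> \<partial>lborel) + (\<integral>\<^sup>+ \<tau>\<in>{m..t}. K \<tau> \<partial>lborel)"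
proof -
  have "(\<integral>\<^sup>+ \<tau>\<in>{s..t}. K \<tau> \<partial>lborel) =
    (\<integral>\<^sup>+ \<tau>. K \<tau> * indicator {s..m} \<tau> + K \<tau> * indicator {m..t} \<tau> \<partial>lborel)"
  proof (rule nn_integral_cong_AE)
    have "AE \<tau> in lborel. \<tau> \<noteq> m"
      by (rule AE_lborel_singleton)
    then show "AE \<tau> in lborel. K \<tau> * indicator {s..t} \<tau> =
      K \<tau> * indicator {s..m} \<tau> + K \<tau> * indicator {m..t} \<tau>"
      by eventually_elim (use assms in \<open>auto split: split_indicator\<close>)
  qed
  also have "\<dots> = (\<integral>\<^sup>+ \<tau>\<in>{s..m}. K \<tau> \<partial>lborel) + (\<integral>\<^sup>+ \<tau>\<in>{m..t}. K \<tau> \<partial>lborel)"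
    by (rule nn_integral_add) measurable
  finally show ?thesis .
qed

text \<open>
  Control need only be checked at small scale, because both sides are additive (respectively
  subadditive) under subdivision of the interval.
\<close>

lemma controls_if_locally:
  assumes [measurable]: "K \<in> borel_measurable borel" and "0 < \<delta>"
    and loc: "\<And>s t. 0 \<le> s \<Longrightarrow> s \<le> t \<Longrightarrow> t \<le> l \<Longrightarrow> t - s < \<delta> \<Longrightarrow>
      ennreal \<bar>f s - f t\<bar> \<le> (\<integral>\<^sup>+ \<tau>\<in>{s..t}. K \<tau> \<partial>lborel)"
  shows "controls f K l"
proof -
  have "ennreal \<bar>f s - f t\<bar> \<le> (\<integral>\<^sup>+ \<tau>\<in>{s..t}. K \<tau> \<partial>lborel)"
    if "0 \<le> s" "s \<le> t" "t \<le> l" "t - s < real n * (\<delta> / 2)" for s t n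
    using that
  proof (induction n arbitrary: s)
    case (Suc n)
    show ?case
    proof (cases "t - s < \<delta>")
      case True
      with Suc.prems show ?thesis by (intro loc) auto
    next
      case False
      define m where "m = s + \<delta> / 2"
      have m: "0 \<le> m" "s \<le> m" "m \<le> t" "m - s < \<delta>" "t - m < real n * (\<delta> / 2)"
        using False Suc.prems \<open>0 < \<delta>\<close> by (auto simp: m_def field_simps)
      have "ennreal \<bar>f s - f t\<bar> \<le> ennreal \<bar>f s - f m\<bar> + ennreal \<bar>f m - f t\<bar>"
        by (rule ennreal_abs_triangle)
      also have "\<dots> \<le> (\<integral>\<^sup>+ \<tau>\<in>{s..m}. K \<tau> \<partial>lborel) + (\<integral>\<^sup>+ \<tau>\<in>{m..t}. K \<tau> \<partial>lborel)"
        using m Suc.prems by (intro add_mono loc Suc.IH) auto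
      also have "\<dots> = (\<integral>\<^sup>+ \<tau>\<in>{s..t}. K \<tau> \<partial>lborel)"
        using m by (intro interval_integral_split[symmetric]) auto
      finally show ?thesis .
    qed
  qed simp
  moreover have "\<exists>n. t - s < real n * (\<delta> / 2)" for s t
    using reals_Archimedean3[of "\<delta> / 2"] \<open>0 < \<delta>\<close> by (meson half_gt_zero)
  ultimately show ?thesis
    unfolding controls_def by blast
qed

text \<open>
  Dominated convergence; along a growing sequence of sets, densities that switch from one function
  to another converge without being monotone.
\<close>

lemma controls_limit:
  fixes K :: "nat \<Rightarrow> real \<Rightarrow> ennreal"
  assumes [measurable]: "\<And>n. K n \<in> borel_measurable borel" "L \<in> borel_measurable borel"
      "W \<in> borel_measurable borel"
    and fin: "(\<integral>\<^sup>+ \<tau>\<in>{0..l}. W \<tau> \<partial>lborel) < \<infinity>"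
    and dom: "\<And>n t. K n t \<le> W t"
    and lim: "\<And>t. (\<lambda>n. K n t) \<longlonglongrightarrow> L t"
    and ctl: "\<And>n. controls f (K n) l"
  shows "controls f L l"
  unfolding controls_def
proof safe
  fix s t assume st: "0 \<le> s" "s \<le> t" "t \<le> l"
  have "(\<lambda>n. (\<integral>\<^sup>+ \<tau>\<in>{s..t}. K n \<tau> \<partial>lborel)) \<longlonglongrightarrow> (\<integral>\<^sup>+ \<tau>\<in>{s..t}. L \<tau> \<partial>lborel)"
  proof (rule nn_integral_dominated_convergence[where w="\<lambda>\<tau>. W \<tau> * indicator {0..l} \<tau>"])
    show "AE x in lborel. K n x * indicator {s..t} x \<le> W x * indicator {0..l} x" for n
      using dom st by (auto split: split_indicator)
    show "AE x in lborel. (\<lambda>n. K n x * indicator {s..t} x) \<longlonglongrightarrow> L x * indicator {s..t} x"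
      using lim by (auto split: split_indicator)
  qed (use fin in auto)
  then show "ennreal \<bar>f s - f t\<bar> \<le> (\<integral>\<^sup>+ \<tau>\<in>{s..t}. L \<tau> \<partial>lborel)"
    by (rule LIMSEQ_le_const) (use controlsD[OF ctl] st in blast)
qed

definition mix :: "real set \<Rightarrow> (real \<Rightarrow> ennreal) \<Rightarrow> (real \<Rightarrow> ennreal) \<Rightarrow> real \<Rightarrow> ennreal" where
  "mix E G H = (\<lambda>t. if t \<in> E then G t else H t)"

lemma mix_measurable [measurable]:
  assumes [measurable]: "E \<in> sets borel" "G \<in> borel_measurable borel" "H \<in> borel_measurable borel"
  shows "mix E G H \<in> borel_measurable borel"
  unfolding mix_def by measurable

lemma controls_mix_interval:
  assumes [measurable]: "G \<in> borel_measurable borel" "H \<in> borel_measurable borel"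
    and G: "controls f G l" and H: "controls f H l"
  shows "controls f (mix {a..b} G H) l"
  unfolding controls_def
proof safe
  fix s t assume st: "0 \<le> s" "s \<le> t" "t \<le> l"
  let ?M = "mix {a..b} G H"
  define a' b' where "a' = max s a" and "b' = min t b"
  show "ennreal \<bar>f s - f t\<bar> \<le> (\<integral>\<^sup>+ \<tau>\<in>{s..t}. ?M \<tau> \<partial>lborel)"
  proof (cases "a' \<le> b'")
    case True
    have ord: "s \<le> a'" "b' \<le> t" by (auto simp: a'_def b'_def)
    have AE_ab: "AE \<tau> in lborel. \<tau> \<noteq> a' \<and> \<tau> \<noteq> b'"
      using AE_lborel_singleton[of a'] AE_lborel_singleton[of b'] by eventually_elim auto
    have 1: "(\<integral>\<^sup>+ \<tau>\<in>{s..a'}. ?M \<tau> \<partial>lborel) = (\<integral>\<^sup>+ \<tau>\<in>{s..a'}. H \<tau> \<partial>lborel)"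
      using AE_ab by (intro nn_integral_cong_AE, eventually_elim)
        (auto simp: mix_def a'_def split: split_indicator)
    have 2: "(\<integral>\<^sup>+ \<tau>\<in>{a'..b'}. ?M \<tau> \<partial>lborel) = (\<integral>\<^sup>+ \<tau>\<in>{a'..b'}. G \<tau> \<partial>lborel)"
      by (intro nn_integral_cong) (auto simp: mix_def a'_def b'_def split: split_indicator)
    have 3: "(\<integral>\<^sup>+ \<tau>\<in>{b'..t}. ?M \<tau> \<partial>lborel) = (\<integral>\<^sup>+ \<tau>\<in>{b'..t}. H \<tau> \<partial>lborel)"
      using AE_ab by (intro nn_integral_cong_AE, eventually_elim)
        (auto simp: mix_def b'_def split: split_indicator)
    have "ennreal \<bar>f s - f t\<bar> \<le> ennreal \<bar>f s - f a'\<bar> + (ennreal \<bar>f a' - f b'\<bar> + ennreal \<bar>f b' - f t\<bar>)"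
      by (simp flip: ennreal_plus)
    also have "\<dots> \<le> (\<integral>\<^sup>+ \<tau>\<in>{s..a'}. ?M \<tau> \<partial>lborel) +
        ((\<integral>\<^sup>+ \<tau>\<in>{a'..b'}. ?M \<tau> \<partial>lborel) + (\<integral>\<^sup>+ \<tau>\<in>{b'..t}. ?M \<tau> \<partial>lborel))"
      unfolding 1 2 3 using st ord True
      by (intro add_mono controlsD[OF G] controlsD[OF H]) auto
    also have "\<dots> = (\<integral>\<^sup>+ \<tau>\<in>{s..t}. ?M \<tau> \<partial>lborel)"
      using ord True
      by (subst interval_integral_split[of _ a' b' t, symmetric], simp_all)
        (subst interval_integral_split[of _ s a' t], simp_all)
    finally show ?thesis .
  next
    case False
    have "(\<integral>\<^sup>+ \<tau>\<in>{s..t}. ?M \<tau> \<partial>lborel) = (\<integral>\<^sup>+ \<tau>\<in>{s..t}. H \<tau> \<partial>lborel)"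
      using False by (intro nn_integral_cong) (auto simp: mix_def a'_def b'_def split: split_indicator)
    with controlsD[OF H st] show ?thesis by simp
  qed
qed

text \<open>
  For fixed \<open>f\<close>, the sets along which controlling densities may be exchanged for one another form
  a \<open>\<sigma>\<close>-algebra that contains all intervals: finite unions are mixed
  one after the other, and countable unions are limits of finite ones.
\<close>

lemma controls_mix:
  assumes E: "E \<in> sets borel"
    and "G \<in> borel_measurable borel" "H \<in> borel_measurable borel"
    and "(\<integral>\<^sup>+ \<tau>\<in>{0..l}. G \<tau> \<partial>lborel) < \<infinity>" "(\<integral>\<^sup>+ \<tau>\<in>{0..l}. H \<tau> \<partial>lborel) < \<infinity>"
    and "controls f G l" "controls f H l"
  shows "controls f (mix E G H) l"
proof -
  define good where "good G \<longleftrightarrow> G \<in> borel_measurable borel \<and>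
    (\<integral>\<^sup>+ \<tau>\<in>{0..l}. G \<tau> \<partial>lborel) < \<infinity> \<and> controls f G l" for G
  define P where "P E \<longleftrightarrow> (\<forall>G H. good G \<and> good H \<longrightarrow> controls f (mix E G H) l)" for E
  have finmix: "(\<integral>\<^sup>+ \<tau>\<in>{0..l}. (G \<tau> + H \<tau>) \<partial>lborel) < \<infinity>" if "good G" "good H" for G H
    using that unfolding good_def by (subst nn_set_integral_add) auto
  have goodmix: "good (mix E G H)" if "good G" "good H" "E \<in> sets borel" "P E" for E G H
  proof -
    have "(\<integral>\<^sup>+ \<tau>\<in>{0..l}. mix E G H \<tau> \<partial>lborel) \<le> (\<integral>\<^sup>+ \<tau>\<in>{0..l}. (G \<tau> + H \<tau>) \<partial>lborel)"
      by (intro nn_integral_mono mult_right_mono) (auto simp: mix_def)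
    with that finmix[OF that(1,2)] show ?thesis
      by (auto simp: good_def P_def)
  qed
  have borel_eq: "sets borel = sigma_sets UNIV (range (\<lambda>(a, b). {a..b::real}))"
    by (subst borel_eq_atLeastAtMost) (auto intro!: sets_measure_of)
  have "E \<in> sigma_sets UNIV (range (\<lambda>(a, b). {a..b::real}))"
    using E borel_eq by simp
  then have "P E"
  proof induction
    case (Basic E)
    then show ?case by (auto simp: P_def good_def intro!: controls_mix_interval)
  next
    case Empty
    then show ?case by (auto simp: P_def mix_def good_def)
  next
    case (Compl E)
    have "mix (UNIV - E) G H = mix E H G" for G H by (auto simp: mix_def)
    with Compl show ?case by (auto simp: P_def)
  next
    case (Union A)
    have A: "A i \<in> sets borel" for i using Union.hyps borel_eq by simp
    define B where "B n = (\<Union>i<n. A i)" for n :: nat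
    have B: "B n \<in> sets borel" for n unfolding B_def using A by auto
    have PB: "P (B n)" for n
    proof (induction n)
      case 0 then show ?case by (auto simp: B_def P_def mix_def good_def)
    next
      case (Suc n)
      have "mix (B (Suc n)) G H = mix (A n) G (mix (B n) G H)" for G H
        by (auto simp: mix_def B_def less_Suc_eq fun_eq_iff)
      with goodmix[OF _ _ B Suc] Union.IH[of n] show ?case
        by (auto simp: P_def)
    qed
    show ?case unfolding P_def
    proof safe
      fix G H assume gd: "good G" "good H"
      then have [measurable]: "G \<in> borel_measurable borel" "H \<in> borel_measurable borel"
        by (auto simp: good_def)
      note B[measurable] A[measurable]
      show "controls f (mix (\<Union> (range A)) G H) l"
      proof (rule controls_limit[where K="\<lambda>n. mix (B n) G H" and W="\<lambda>t. G t + H t"])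
        show "(\<lambda>n. mix (B n) G H t) \<longlonglongrightarrow> mix (\<Union> (range A)) G H t" for t
        proof (cases "t \<in> \<Union> (range A)")
          case True
          then obtain i where "t \<in> A i" by auto
          then have "mix (B n) G H t = G t" if "Suc i \<le> n" for n
            using that by (auto simp: mix_def B_def)
          then have "eventually (\<lambda>n. mix (B n) G H t = G t) sequentially"
            unfolding eventually_sequentially by blast
          then show ?thesis using True by (simp add: mix_def tendsto_eventually)
        next
          case False
          then show ?thesis by (auto simp: mix_def B_def)
        qed
        show "controls f (mix (B n) G H) l" for n using PB gd by (auto simp: P_def)
      qed (use finmix[OF gd] in \<open>auto simp: mix_def\<close>)
    qed
  qed
  then show ?thesis using assms by (auto simp: P_def good_def)
qed

text \<open>
  The minimum of two controlling densities arises by mixing them along the set where one is below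
  the other; an infinite infimum is a limit of finite minima.
\<close>

lemma controls_INF:
  fixes G :: "nat \<Rightarrow> real \<Rightarrow> ennreal"
  assumes [measurable]: "\<And>i. G i \<in> borel_measurable borel"
    and fin: "\<And>i. (\<integral>\<^sup>+ \<tau>\<in>{0..l}. G i \<tau> \<partial>lborel) < \<infinity>"
    and ctl: "\<And>i. controls f (G i) l"
  shows "controls f (\<lambda>t. INF i. G i t) l"
proof -
  define K where "K n t = (INF i\<in>{..n}. G i t)" for n t
  have K_Suc: "K (Suc n) t = min (G (Suc n) t) (K n t)" for n t
    by (simp add: K_def atMost_Suc INF_insert inf_min)
  have [measurable]: "K n \<in> borel_measurable borel" for n
    unfolding K_def by measurable
  have K0: "K n t \<le> G 0 t" for n t
    by (auto simp: K_def intro: INF_lower)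
  have "controls f (K n) l" for n
  proof (induction n)
    case 0
    then show ?case using ctl[of 0] by (simp add: K_def)
  next
    case (Suc n)
    let ?E = "{t \<in> space borel. G (Suc n) t \<le> K n t}"
    have "(\<integral>\<^sup>+ \<tau>\<in>{0..l}. K n \<tau> \<partial>lborel) \<le> (\<integral>\<^sup>+ \<tau>\<in>{0..l}. G 0 \<tau> \<partial>lborel)"
      by (intro nn_integral_mono mult_right_mono K0) auto
    with fin[of 0] have "(\<integral>\<^sup>+ \<tau>\<in>{0..l}. K n \<tau> \<partial>lborel) < \<infinity>" by (rule order_le_less_trans[rotated])
    then have "controls f (mix ?E (G (Suc n)) (K n)) l"
      by (intro controls_mix Suc fin ctl) measurable
    also have "mix ?E (G (Suc n)) (K n) = K (Suc n)"
      by (auto simp: mix_def K_Suc fun_eq_iff min_def)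
    finally show ?case .
  qed
  moreover have "(\<lambda>n. K n t) \<longlonglongrightarrow> (INF i. G i t)" for t
  proof -
    have "decseq (\<lambda>n. K n t)" by (rule decseq_SucI) (simp add: K_Suc)
    moreover have "(INF n. K n t) = (INF i. G i t)"
    proof (rule antisym)
      have "K i t \<le> G i t" for i unfolding K_def by (rule INF_lower) auto
      then show "(INF n. K n t) \<le> (INF i. G i t)"
        by (intro INF_mono) auto
      show "(INF i. G i t) \<le> (INF n. K n t)"
        unfolding K_def by (intro INF_greatest INF_lower) auto
    qed
    ultimately show ?thesis using LIMSEQ_INF by metis
  qed
  ultimately show ?thesis
    using controls_limit[where K=K and W="G 0" and f=f and l=l and L="\<lambda>t. INF i. G i t"] fin[of 0] K0
    by simp
qed

text \<open>
  Between the first and the last visit to a level \<open>c\<close>, a continuous function has no net change,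
  so that nothing is lost by setting the density to zero on the whole level set.
\<close>

lemma controls_off_level_set:
  assumes [measurable]: "K \<in> borel_measurable borel"
    and cont: "continuous_on {0..l} f" and ctl: "controls f K l"
  shows "controls f (\<lambda>t. if f t = c then 0 else K t) l"
  unfolding controls_def
proof safe
  fix s t assume st: "0 \<le> s" "s \<le> t" "t \<le> l"
  define Z where "Z = {\<tau>\<in>{s..t}. f \<tau> = c}"
  let ?K = "\<lambda>t. if f t = c then 0 else K t"
  have "continuous_on {s..t} f" using cont st by (auto intro: continuous_on_subset)
  then have "closed Z" unfolding Z_def
    by (intro continuous_closed_preimage_constant) auto
  moreover have "bounded Z" unfolding Z_def by (rule bounded_subset[of "{s..t}"]) auto
  ultimately have cpt: "compact Z" by (simp add: compact_eq_bounded_closed)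
  show "ennreal \<bar>f s - f t\<bar> \<le> (\<integral>\<^sup>+ \<tau>\<in>{s..t}. ?K \<tau> \<partial>lborel)"
  proof (cases "Z = {}")
    case True
    then have "(\<integral>\<^sup>+ \<tau>\<in>{s..t}. ?K \<tau> \<partial>lborel) = (\<integral>\<^sup>+ \<tau>\<in>{s..t}. K \<tau> \<partial>lborel)"
      by (intro nn_integral_cong) (auto simp: Z_def split: split_indicator)
    with controlsD[OF ctl st] show ?thesis by simp
  next
    case False
    obtain a where a: "a \<in> Z" "\<And>x. x \<in> Z \<Longrightarrow> a \<le> x"
      using compact_attains_inf[OF cpt False] by auto
    obtain b where b: "b \<in> Z" "\<And>x. x \<in> Z \<Longrightarrow> x \<le> b"
      using compact_attains_sup[OF cpt False] by auto
    have ab: "s \<le> a" "a \<le> b" "b \<le> t" "f a = c" "f b = c"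
      using a b by (auto simp: Z_def)
    have "ennreal \<bar>f s - f t\<bar> \<le> ennreal \<bar>f s - f a\<bar> + ennreal \<bar>f b - f t\<bar>"
      using ab by (simp flip: ennreal_plus)
    also have "\<dots> \<le> (\<integral>\<^sup>+ \<tau>\<in>{s..a}. K \<tau> \<partial>lborel) + (\<integral>\<^sup>+ \<tau>\<in>{b..t}. K \<tau> \<partial>lborel)"
      using ab st by (intro add_mono controlsD[OF ctl]) auto
    also have "\<dots> = (\<integral>\<^sup>+ \<tau>. K \<tau> * indicator {s..a} \<tau> + K \<tau> * indicator {b..t} \<tau> \<partial>lborel)"
      by (rule nn_integral_add[symmetric]) measurable
    also have "\<dots> \<le> (\<integral>\<^sup>+ \<tau>\<in>{s..t}. ?K \<tau> \<partial>lborel)"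
    proof (rule nn_integral_mono_AE)
      have "AE \<tau> in lborel. \<tau> \<noteq> a" "AE \<tau> in lborel. \<tau> \<noteq> b" by (rule AE_lborel_singleton)+
      then show "AE \<tau> in lborel. K \<tau> * indicator {s..a} \<tau> + K \<tau> * indicator {b..t} \<tau> \<le>
          ?K \<tau> * indicator {s..t} \<tau>"
      proof eventually_elim
        case (elim \<tau>)
        have "\<tau> \<notin> Z" if "\<tau> < a \<or> b < \<tau>" using that a b by force
        then show ?case using elim ab st
          by (auto simp: Z_def split: split_indicator)
      qed
    qed
    finally show ?thesis .
  qed
qed

text \<open>
  Product rule. Over a short interval \<open>\<bar>\<Delta>(eF)\<bar> \<le> \<bar>e\<bar>\<bar>\<Delta>F\<bar> + \<bar>F\<bar>\<bar>\<Delta>e\<bar>\<close>, and by uniform continuity the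
  value of \<open>\<bar>F\<bar>\<close> at an endpoint may be replaced by its mean up to an arbitrarily small error.
\<close>

lemma controls_product:
  assumes [measurable]: "G \<in> borel_measurable borel" "F \<in> borel_measurable borel"
    and cont: "continuous_on {0..l} F" and F: "controls F G l"
    and e: "\<And>t. 0 \<le> e t \<and> e t \<le> 1"
    and lip: "\<And>s t. 0 \<le> s \<Longrightarrow> s \<le> t \<Longrightarrow> t \<le> l \<Longrightarrow> \<bar>e s - e t\<bar> \<le> L * (t - s)" and L: "0 \<le> L"
  shows "controls (\<lambda>t. e t * F t) (\<lambda>t. G t + ennreal (L * \<bar>F t\<bar>)) l"
proof -
  have ctl: "controls (\<lambda>t. e t * F t) (\<lambda>t. G t + ennreal (L * (\<bar>F t\<bar> + \<epsilon>))) l" if "0 < \<epsilon>" for \<epsilon>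
  proof -
    have "uniformly_continuous_on {0..l} F"
      using cont by (intro compact_uniformly_continuous) auto
    then obtain \<delta> where \<delta>: "0 < \<delta>"
      "\<And>x y. x \<in> {0..l} \<Longrightarrow> y \<in> {0..l} \<Longrightarrow> dist y x < \<delta> \<Longrightarrow> dist (F y) (F x) < \<epsilon>"
      using \<open>0 < \<epsilon>\<close> unfolding uniformly_continuous_on_def by blast
    show ?thesis
    proof (rule controls_if_locally[OF _ \<delta>(1)])
      fix s t assume st: "0 \<le> s" "s \<le> t" "t \<le> l" "t - s < \<delta>"
      have "\<bar>e s * F s - e t * F t\<bar> = \<bar>e s * (F s - F t) + (e s - e t) * F t\<bar>"
        by (simp add: algebra_simps)
      also have "\<dots> \<le> \<bar>e s\<bar> * \<bar>F s - F t\<bar> + \<bar>e s - e t\<bar> * \<bar>F t\<bar>"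
        by (rule order_trans[OF abs_triangle_ineq]) (simp add: abs_mult)
      also have "\<dots> \<le> 1 * \<bar>F s - F t\<bar> + (L * (t - s)) * \<bar>F t\<bar>"
        using e[of s] lip[of s t] st by (intro add_mono mult_right_mono) auto
      finally have "ennreal \<bar>e s * F s - e t * F t\<bar> \<le>
          ennreal \<bar>F s - F t\<bar> + ennreal (L * \<bar>F t\<bar> * (t - s))"
        using st L by (simp add: mult_ac flip: ennreal_plus)
      also have "ennreal (L * \<bar>F t\<bar> * (t - s)) = (\<integral>\<^sup>+ \<tau>\<in>{s..t}. ennreal (L * \<bar>F t\<bar>) \<partial>lborel)"
        using st L by (simp add: nn_integral_cmult_indicator ennreal_mult)
      also have "\<dots> \<le> (\<integral>\<^sup>+ \<tau>\<in>{s..t}. ennreal (L * (\<bar>F \<tau>\<bar> + \<epsilon>)) \<partial>lborel)"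
      proof (intro nn_integral_mono)
        fix \<tau>
        have "\<bar>F t\<bar> \<le> \<bar>F \<tau>\<bar> + \<epsilon>" if "\<tau> \<in> {s..t}"
          using \<delta>(2)[of \<tau> t] that st by (auto simp: dist_real_def)
        then show "ennreal (L * \<bar>F t\<bar>) * indicator {s..t} \<tau> \<le>
            ennreal (L * (\<bar>F \<tau>\<bar> + \<epsilon>)) * indicator {s..t} \<tau>"
          using L by (auto intro!: ennreal_leI mult_left_mono split: split_indicator)
      qed
      also have "ennreal \<bar>F s - F t\<bar> \<le> (\<integral>\<^sup>+ \<tau>\<in>{s..t}. G \<tau> \<partial>lborel)"
        using controlsD[OF F] st by auto
      also have "(\<integral>\<^sup>+ \<tau>\<in>{s..t}. G \<tau> \<partial>lborel) + (\<integral>\<^sup>+ \<tau>\<in>{s..t}. ennreal (L * (\<bar>F \<tau>\<bar> + \<epsilon>)) \<partial>lborel) =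
          (\<integral>\<^sup>+ \<tau>\<in>{s..t}. (G \<tau> + ennreal (L * (\<bar>F \<tau>\<bar> + \<epsilon>))) \<partial>lborel)"
        by (rule nn_set_integral_add[symmetric]) auto
      finally show "ennreal \<bar>e s * F s - e t * F t\<bar> \<le>
          (\<integral>\<^sup>+ \<tau>\<in>{s..t}. (G \<tau> + ennreal (L * (\<bar>F \<tau>\<bar> + \<epsilon>))) \<partial>lborel)"
        by (simp add: add_mono)
    qed measurable
  qed
  show ?thesis unfolding controls_def
  proof safe
    fix s t assume st: "0 \<le> s" "s \<le> t" "t \<le> l"
    show "ennreal \<bar>e s * F s - e t * F t\<bar> \<le>
        (\<integral>\<^sup>+ \<tau>\<in>{s..t}. (G \<tau> + ennreal (L * \<bar>F \<tau>\<bar>)) \<partial>lborel)" (is "?a \<le> ?I")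
    proof (rule ennreal_le_epsilon)
      fix \<epsilon> :: real assume "0 < \<epsilon>"
      define \<eta> where "\<eta> = \<epsilon> / (L * (t - s) + 1)"
      have Lts: "0 \<le> L * (t - s)" using L st by auto
      have "0 < \<eta>" using \<open>0 < \<epsilon>\<close> Lts by (auto simp: \<eta>_def)
      have "?a \<le> (\<integral>\<^sup>+ \<tau>\<in>{s..t}. (G \<tau> + ennreal (L * (\<bar>F \<tau>\<bar> + \<eta>))) \<partial>lborel)"
        using controlsD[OF ctl[OF \<open>0 < \<eta>\<close>]] st by auto
      also have "\<dots> = (\<integral>\<^sup>+ \<tau>\<in>{s..t}. ((G \<tau> + ennreal (L * \<bar>F \<tau>\<bar>)) + ennreal (L * \<eta>)) \<partial>lborel)"
        using L \<open>0 < \<eta>\<close> by (simp add: distrib_left add.assoc)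
      also have "\<dots> = ?I + (\<integral>\<^sup>+ \<tau>\<in>{s..t}. ennreal (L * \<eta>) \<partial>lborel)"
        by (rule nn_set_integral_add) auto
      also have "(\<integral>\<^sup>+ \<tau>\<in>{s..t}. ennreal (L * \<eta>) \<partial>lborel) = ennreal (L * \<eta> * (t - s))"
        using st L \<open>0 < \<eta>\<close> by (simp add: nn_integral_cmult_indicator ennreal_mult)
      also have "\<dots> \<le> ennreal \<epsilon>"
        using \<open>0 < \<epsilon>\<close> Lts by (intro ennreal_leI) (auto simp: \<eta>_def field_simps)
      finally show "?a \<le> ?I + ennreal \<epsilon>" by (simp add: add_left_mono)
    qed
  qed
qed


section \<open>Arc length parameterized curves\<close>

lemma arc_length_curveD:
  assumes "arc_length_curve E \<gamma> l"
  shows "0 < l" "continuous_on {0..l} \<gamma>" "\<gamma> ` {0..l} \<subseteq> E"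
    "0 \<le> s \<Longrightarrow> s \<le> t \<Longrightarrow> t \<le> l \<Longrightarrow> curve_length \<gamma> s t = ennreal (t - s)"
  using assms unfolding arc_length_curve_def by blast+

lemma arc_length_curve_lipschitz:
  assumes "arc_length_curve E \<gamma> l" "0 \<le> s" "s \<le> t" "t \<le> l"
  shows "dist (\<gamma> s) (\<gamma> t) \<le> t - s"
proof -
  have "ennreal (dist (\<gamma> s) (\<gamma> t)) \<le> curve_length \<gamma> s t"
    unfolding curve_length_def using assms
    by (intro SUP_upper2[of "[s, t]"]) auto
  also have "\<dots> = ennreal (t - s)"
    by (rule arc_length_curveD) fact+
  finally show ?thesis using assms by simp
qed

lemma curve_length_shift_le: "curve_length (\<lambda>\<tau>. \<gamma> (c + \<tau>)) a b \<le> curve_length \<gamma> (c + a) (c + b)"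
  unfolding curve_length_def
proof (rule SUP_least)
  fix ts :: "real list" assume ts: "ts \<in> {ts. sorted ts \<and> set ts \<subseteq> {a..b}}"
  let ?us = "map ((+) c) ts"
  have "sorted ?us" using ts by (auto simp: sorted_iff_nth_mono)
  moreover have "set ?us \<subseteq> {c + a..c + b}" using ts by auto
  ultimately show "(\<Sum>i<length ts - 1. ennreal (dist (\<gamma> (c + ts ! i)) (\<gamma> (c + ts ! Suc i))))
    \<le> (SUP ts\<in>{ts. sorted ts \<and> set ts \<subseteq> {c + a..c + b}}.
        \<Sum>i<length ts - 1. ennreal (dist (\<gamma> (ts ! i)) (\<gamma> (ts ! Suc i))))"
    by (intro SUP_upper2[of ?us]) auto
qed

text \<open>
  The inequality for the shift by \<open>-c\<close> of the shifted curve is the converse inequality.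
\<close>

lemma curve_length_shift: "curve_length (\<lambda>\<tau>. \<gamma> (c + \<tau>)) a b = curve_length \<gamma> (c + a) (c + b)"
  using curve_length_shift_le[of \<gamma> c a b]
    curve_length_shift_le[of "\<lambda>\<tau>. \<gamma> (c + \<tau>)" "- c" "c + a" "c + b"] by simp

lemma arc_length_subcurve:
  assumes "arc_length_curve E \<gamma> l" "0 \<le> s" "s < t" "t \<le> l" "\<gamma> ` {s..t} \<subseteq> F"
  shows "arc_length_curve F (\<lambda>\<tau>. \<gamma> (s + \<tau>)) (t - s)"
  unfolding arc_length_curve_def
proof safe
  show "0 < t - s" using assms by simp
  show "continuous_on {0..t - s} (\<lambda>\<tau>. \<gamma> (s + \<tau>))"
    by (rule continuous_on_compose2[OF arc_length_curveD(2)[OF assms(1)]])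
      (use assms(2-4) in \<open>auto intro!: continuous_intros\<close>)
  show "\<gamma> (s + \<tau>) \<in> F" if "\<tau> \<in> {0..t - s}" for \<tau>
    using assms(5) that by auto
  show "curve_length (\<lambda>\<tau>. \<gamma> (s + \<tau>)) a b = ennreal (b - a)"
    if "0 \<le> a" "a \<le> b" "b \<le> t - s" for a b
    unfolding curve_length_shift
    using arc_length_curveD(4)[OF assms(1), of "s + a" "s + b"] assms(2-4) that by simp
qed

text \<open>
  A curve is only given on \<open>[0,l]\<close>. Its constant extension is continuous on the whole line, so that
  composition with a Borel function is Borel there.
\<close>

definition clamped :: "(real \<Rightarrow> 'a) \<Rightarrow> real \<Rightarrow> real \<Rightarrow> 'a" where
  "clamped \<gamma> l t = \<gamma> (max 0 (min l t))"

lemma clamped_eq [simp]: "0 \<le> t \<Longrightarrow> t \<le> l \<Longrightarrow> clamped \<gamma> l t = \<gamma> t"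
  by (simp add: clamped_def)

lemma continuous_clamped:
  assumes "arc_length_curve E \<gamma> l" shows "continuous_on UNIV (clamped \<gamma> l)"
  unfolding clamped_def
  by (rule continuous_on_compose2[OF arc_length_curveD(2)[OF assms]])
    (use arc_length_curveD(1)[OF assms] in \<open>auto intro!: continuous_intros\<close>)

lemma borel_along_curve:
  assumes "arc_length_curve E \<gamma> l" "g \<in> borel_measurable borel"
  shows "(\<lambda>t. g (clamped \<gamma> l t)) \<in> borel_measurable borel"
  using borel_measurable_continuous_onI[OF continuous_clamped[OF assms(1)]] assms(2)
  by (rule measurable_compose)

lemma curve_integral_lborel:
  "curve_integral g \<gamma> l = (\<integral>\<^sup>+ t\<in>{0..l}. g (\<gamma> t) \<partial>lborel)"
  unfolding curve_integral_def by (rule nn_integral_completion)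

lemma curve_integral_clamped:
  "curve_integral g \<gamma> l = (\<integral>\<^sup>+ t\<in>{0..l}. g (clamped \<gamma> l t) \<partial>lborel)"
  unfolding curve_integral_lborel by (intro nn_integral_cong) (auto split: split_indicator)

lemma curve_integral_subcurve:
  assumes "arc_length_curve E \<gamma> l" "g \<in> borel_measurable borel" "0 \<le> s" "s \<le> t" "t \<le> l"
  shows "curve_integral g (\<lambda>\<tau>. \<gamma> (s + \<tau>)) (t - s) = (\<integral>\<^sup>+ \<tau>\<in>{s..t}. g (clamped \<gamma> l \<tau>) \<partial>lborel)"
proof -
  note [measurable] = borel_along_curve[OF assms(1,2)]
  have "(\<integral>\<^sup>+ \<tau>\<in>{s..t}. g (clamped \<gamma> l \<tau>) \<partial>lborel) =
      (\<integral>\<^sup>+ \<tau>. g (clamped \<gamma> l (s + \<tau>)) * indicator {s..t} (s + \<tau>) \<partial>lborel)"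
    by (subst nn_integral_real_affine[of _ 1 s]) auto
  also have "\<dots> = curve_integral g (\<lambda>\<tau>. \<gamma> (s + \<tau>)) (t - s)"
    unfolding curve_integral_lborel using assms
    by (intro nn_integral_cong) (auto split: split_indicator)
  finally show ?thesis by simp
qed

lemma curve_integral_subcurve_le:
  assumes "arc_length_curve E \<gamma> l" "g \<in> borel_measurable borel" "0 \<le> s" "s \<le> t" "t \<le> l"
  shows "curve_integral g (\<lambda>\<tau>. \<gamma> (s + \<tau>)) (t - s) \<le> curve_integral g \<gamma> l"
  unfolding curve_integral_subcurve[OF assms] curve_integral_clamped[of _ _ l]
  using assms by (intro nn_integral_mono) (auto split: split_indicator)

definition controlled_along :: "('a \<Rightarrow> real) \<Rightarrow> ('a \<Rightarrow> ennreal) \<Rightarrow> (real \<Rightarrow> 'a) \<Rightarrow> real \<Rightarrow> bool" where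
  "controlled_along u g \<gamma> l \<longleftrightarrow> controls (\<lambda>t. u (\<gamma> t)) (\<lambda>t. g (clamped \<gamma> l t)) l"


section \<open>Exceptional families of curves\<close>

locale metric_measure =
  fixes M :: "'a::metric_space measure" and p :: real
  assumes p: "1 < p" and mms: "metric_measure_space M"
begin

lemma space_M [simp]: "space M = UNIV"
  using mms by (auto simp: metric_measure_space_def sets_eq_imp_space_eq[of _ borel])

lemma borel_imp_sets [measurable_dest]: "A \<in> sets borel \<Longrightarrow> A \<in> sets M"
  using mms by (auto simp: metric_measure_space_def)

lemma borel_imp_measurable: "f \<in> measurable borel N \<Longrightarrow> f \<in> measurable M N"
  unfolding measurable_def by (auto dest: borel_imp_sets)

lemma open_sets [measurable]: "open A \<Longrightarrow> A \<in> sets M"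
  by (simp add: borel_imp_sets)

lemma ball_pos: "0 < r \<Longrightarrow> 0 < emeasure M (ball x r)"
  using mms by (auto simp: metric_measure_space_def)

lemma ball_finite: "emeasure M (ball x r) < \<infinity>"
  using mms by (cases "0 < r") (auto simp: metric_measure_space_def ball_empty not_less)

text \<open>
  The majorant is infinite on a Borel null set that contains all points of disagreement. Because it
  lies above \<open>h\<close> everywhere, its integrals along all curves are at least those of \<open>h\<close>, so it inherits
  the property of being a weak upper gradient.
\<close>

lemma ex_borel_majorant:
  fixes h :: "'a \<Rightarrow> ennreal"
  assumes "h \<in> borel_measurable M"
  obtains h' where "h' \<in> borel_measurable borel" "\<And>x. h x \<le> h' x" "AE x in M. h x = h' x"
proof -
  obtain N where N: "sets N = sets borel" "M = completion N"
    using mms by (auto simp: metric_measure_space_def)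
  have sp: "space N = UNIV" using N by (simp add: sets_eq_imp_space_eq[of N borel])
  obtain k where k: "k \<in> borel_measurable N" "AE x in N. h x = k x"
    using completion_ex_borel_measurable[of h N] assms[unfolded N(2)] by blast
  then obtain Z where Z: "Z \<in> null_sets N" "{x \<in> space N. h x \<noteq> k x} \<subseteq> Z"
    unfolding eventually_ae_filter by auto
  define h' where "h' x = (if x \<in> Z then top else k x)" for x
  have meas: "borel_measurable N = borel_measurable borel" using N(1) by (rule measurable_cong_sets) simp
  have "Z \<in> sets N" using Z by auto
  then have "h' \<in> borel_measurable N" using k(1) unfolding h'_def by measurable
  moreover have "h x \<le> h' x" for x
    using Z(2) subsetD[of _ Z x] by (cases "x \<in> Z") (force simp: h'_def sp)+
  moreover have "AE x in N. h x = h' x"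
    using k(2) AE_not_in[OF Z(1)] by eventually_elim (auto simp: h'_def)
  then have "AE x in M. h x = h' x" unfolding N by (rule AE_completion)
  ultimately show ?thesis using that meas by metis
qed

text \<open>
  Countably many exceptional families are exceptional for the common weight
  \<open>sup \<epsilon>\<^sub>i \<rho>\<^sub>i\<close>, where the \<open>\<epsilon>\<^sub>i\<close> make the \<open>p\<close>-th powers of the norms summable.
\<close>

lemma ex_common_weight:
  fixes \<rho> :: "nat \<Rightarrow> 'a \<Rightarrow> ennreal"
  assumes [measurable]: "\<And>i. \<rho> i \<in> borel_measurable borel"
    and fin: "\<And>i. (\<integral>\<^sup>+ x. epow (\<rho> i x) p \<partial>M) < \<infinity>"
  obtains \<rho>' \<epsilon> where "\<rho>' \<in> borel_measurable borel" "(\<integral>\<^sup>+ x. epow (\<rho>' x) p \<partial>M) < \<infinity>"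
    "\<And>i. 0 < \<epsilon> i" "\<And>i x. ennreal (\<epsilon> i) * \<rho> i x \<le> \<rho>' x"
proof -
  define I where "I i = enn2real (\<integral>\<^sup>+ x. epow (\<rho> i x) p \<partial>M)" for i
  have I: "(\<integral>\<^sup>+ x. epow (\<rho> i x) p \<partial>M) = ennreal (I i)" "0 \<le> I i" for i
    using fin[of i] by (auto simp: I_def)
  define \<epsilon> where "\<epsilon> i = ((1/2) ^ i / (1 + I i)) powr (1 / p)" for i
  define \<rho>' where "\<rho>' x = (SUP i. ennreal (\<epsilon> i) * \<rho> i x)" for x
  have \<rho>M[measurable]: "\<rho> i \<in> borel_measurable M" for i by (rule borel_imp_measurable) measurable
  have "(\<integral>\<^sup>+ x. epow (\<rho>' x) p \<partial>M) \<le> (\<integral>\<^sup>+ x. (\<Sum>i. epow (ennreal (\<epsilon> i) * \<rho> i x) p) \<partial>M)"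
    unfolding \<rho>'_def using p by (intro nn_integral_mono epow_SUP_le) auto
  also have "\<dots> = (\<Sum>i. \<integral>\<^sup>+ x. epow (ennreal (\<epsilon> i) * \<rho> i x) p \<partial>M)"
    by (rule nn_integral_suminf) measurable
  also have "\<dots> \<le> (\<Sum>i. ennreal ((1/2) ^ i))"
  proof (rule suminf_le)
    fix i
    have "epow (ennreal (\<epsilon> i)) p = ennreal ((1/2) ^ i / (1 + I i))"
      using p I(2)[of i] by (simp add: epow_ennreal \<epsilon>_def powr_powr)
    then have "(\<integral>\<^sup>+ x. epow (ennreal (\<epsilon> i) * \<rho> i x) p \<partial>M) = ennreal ((1/2) ^ i / (1 + I i)) * ennreal (I i)"
      by (simp add: epow_mult nn_integral_cmult I(1))
    also have "\<dots> = ennreal ((1/2) ^ i / (1 + I i) * I i)"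
      using I(2)[of i] by (simp flip: ennreal_mult)
    also have "\<dots> \<le> ennreal ((1/2) ^ i)"
    proof (rule ennreal_leI)
      have "(1/2) ^ i / (1 + I i) * I i = (1/2) ^ i * (I i / (1 + I i))" by simp
      also have "\<dots> \<le> (1/2) ^ i * 1" using I(2)[of i] by (intro mult_left_mono) auto
      finally show "(1/2) ^ i / (1 + I i) * I i \<le> (1/2) ^ i" by simp
    qed
    finally show "(\<integral>\<^sup>+ x. epow (ennreal (\<epsilon> i) * \<rho> i x) p \<partial>M) \<le> ennreal ((1/2) ^ i)" .
  qed auto
  also have "\<dots> = ennreal (\<Sum>i. (1/2) ^ i)"
    by (rule suminf_ennreal2) (auto intro: summable_geometric)
  finally have fin': "(\<integral>\<^sup>+ x. epow (\<rho>' x) p \<partial>M) < \<infinity>"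
    using order_le_less_trans by fastforce
  have "0 < \<epsilon> i" for i using I(2)[of i] by (auto simp: \<epsilon>_def)
  moreover have "\<rho>' \<in> borel_measurable borel" unfolding \<rho>'_def by measurable
  moreover have "ennreal (\<epsilon> i) * \<rho> i x \<le> \<rho>' x" for i x unfolding \<rho>'_def by (rule SUP_upper) auto
  ultimately show ?thesis using that fin' by blast
qed

lemma curve_integral_weight_infinite:
  assumes "arc_length_curve E \<gamma> l" "\<rho> \<in> borel_measurable borel"
    "0 < \<epsilon>" "\<And>x. ennreal \<epsilon> * \<rho> x \<le> \<rho>' x" "curve_integral \<rho> \<gamma> l = \<infinity>"
  shows "curve_integral \<rho>' \<gamma> l = \<infinity>"
proof -
  note [measurable] = borel_along_curve[OF assms(1,2)]
  have "ennreal \<epsilon> * curve_integral \<rho> \<gamma> l =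
      (\<integral>\<^sup>+ t\<in>{0..l}. (ennreal \<epsilon> * \<rho> (clamped \<gamma> l t)) \<partial>lborel)"
    unfolding curve_integral_clamped by (subst nn_integral_cmult[symmetric]) (auto simp: mult.assoc)
  also have "\<dots> \<le> curve_integral \<rho>' \<gamma> l"
    unfolding curve_integral_clamped using assms(4)
    by (intro nn_integral_mono) (auto split: split_indicator)
  finally show ?thesis
    using assms(3,5) by (auto simp: ennreal_mult_top top_unique)
qed

lemma ae_curve_iff:
  "ae_curve p M P \<longleftrightarrow> (\<exists>\<rho>\<in>borel_measurable borel. (\<integral>\<^sup>+ x. epow (\<rho> x) p \<partial>M) < \<infinity> \<and>
     (\<forall>\<gamma> l. arc_length_curve UNIV \<gamma> l \<and> \<not> P \<gamma> l \<longrightarrow> curve_integral \<rho> \<gamma> l = \<infinity>))"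
proof -
  have "borel_measurable (restrict_space borel UNIV) = (borel_measurable borel :: ('a \<Rightarrow> ennreal) set)"
    by (rule measurable_cong_sets) (auto simp: sets_restrict_space)
  then show ?thesis by (simp add: ae_curve_def)
qed

lemma ae_curve_mono:
  assumes "ae_curve p M P" "\<And>\<gamma> l. arc_length_curve UNIV \<gamma> l \<Longrightarrow> P \<gamma> l \<Longrightarrow> P' \<gamma> l"
  shows "ae_curve p M P'"
  using assms unfolding ae_curve_iff by blast

lemma ae_curve_all:
  fixes P :: "nat \<Rightarrow> (real \<Rightarrow> 'a) \<Rightarrow> real \<Rightarrow> bool"
  assumes "\<And>i. ae_curve p M (P i)"
  shows "ae_curve p M (\<lambda>\<gamma> l. \<forall>i. P i \<gamma> l)"
proof -
  have "\<exists>\<rho>. \<rho> \<in> borel_measurable borel \<and> (\<integral>\<^sup>+ x. epow (\<rho> x) p \<partial>M) < \<infinity> \<and>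
     (\<forall>\<gamma> l. arc_length_curve UNIV \<gamma> l \<and> \<not> P i \<gamma> l \<longrightarrow> curve_integral \<rho> \<gamma> l = \<infinity>)" for i
    using assms[of i] unfolding ae_curve_iff by blast
  then obtain \<rho> where \<rho>: "\<And>i. \<rho> i \<in> borel_measurable borel"
    "\<And>i. (\<integral>\<^sup>+ x. epow (\<rho> i x) p \<partial>M) < \<infinity>"
    "\<And>i \<gamma> l. arc_length_curve UNIV \<gamma> l \<Longrightarrow> \<not> P i \<gamma> l \<Longrightarrow> curve_integral (\<rho> i) \<gamma> l = \<infinity>"
    by metis
  obtain \<rho>' \<epsilon> where \<rho>': "\<rho>' \<in> borel_measurable borel" "(\<integral>\<^sup>+ x. epow (\<rho>' x) p \<partial>M) < \<infinity>"
    "\<And>i. 0 < \<epsilon> i" "\<And>i x. ennreal (\<epsilon> i) * \<rho> i x \<le> \<rho>' x"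
    using ex_common_weight[of \<rho>] \<rho>(1,2) by metis
  show ?thesis unfolding ae_curve_iff
  proof (intro bexI conjI allI impI)
    fix \<gamma> l assume asm: "arc_length_curve UNIV \<gamma> l \<and> \<not> (\<forall>i. P i \<gamma> l)"
    then obtain i where i: "\<not> P i \<gamma> l" by blast
    with \<rho>(3)[of \<gamma> l i] asm have "curve_integral (\<rho> i) \<gamma> l = \<infinity>" by blast
    then show "curve_integral \<rho>' \<gamma> l = \<infinity>"
      using curve_integral_weight_infinite[OF _ \<rho>(1)[of i] \<rho>'(3)[of i] \<rho>'(4)] asm by blast
  qed (use \<rho>' in auto)
qed

lemma ae_curve_conj:
  assumes "ae_curve p M P" "ae_curve p M P'"
  shows "ae_curve p M (\<lambda>\<gamma> l. P \<gamma> l \<and> P' \<gamma> l)"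
proof -
  have "ae_curve p M (if i = 0 then P else P')" for i :: nat using assms by simp
  from ae_curve_all[of "\<lambda>i. if i = 0 then P else P'", OF this] show ?thesis
    by (rule ae_curve_mono) (metis zero_neq_one)
qed

text \<open>
  A weight with infinite integral along a subcurve has infinite integral along the whole curve.
\<close>

lemma ae_curve_subcurves:
  assumes "ae_curve p M P"
  shows "ae_curve p M (\<lambda>\<gamma> l. \<forall>s t. 0 \<le> s \<and> s < t \<and> t \<le> l \<longrightarrow> P (\<lambda>\<tau>. \<gamma> (s + \<tau>)) (t - s))"
proof -
  obtain \<rho> where \<rho>: "\<rho> \<in> borel_measurable borel" "(\<integral>\<^sup>+ x. epow (\<rho> x) p \<partial>M) < \<infinity>"
     "\<And>\<gamma> l. arc_length_curve UNIV \<gamma> l \<Longrightarrow> \<not> P \<gamma> l \<Longrightarrow> curve_integral \<rho> \<gamma> l = \<infinity>"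
    using assms unfolding ae_curve_iff by blast
  show ?thesis unfolding ae_curve_iff
  proof (intro bexI[of _ \<rho>] conjI allI impI)
    fix \<gamma> l assume "arc_length_curve UNIV \<gamma> l \<and>
       \<not> (\<forall>s t. 0 \<le> s \<and> s < t \<and> t \<le> l \<longrightarrow> P (\<lambda>\<tau>. \<gamma> (s + \<tau>)) (t - s))"
    then obtain s t where arc: "arc_length_curve UNIV \<gamma> l" and st: "0 \<le> s" "s < t" "t \<le> l"
      and nP: "\<not> P (\<lambda>\<tau>. \<gamma> (s + \<tau>)) (t - s)" by blast
    have "arc_length_curve UNIV (\<lambda>\<tau>. \<gamma> (s + \<tau>)) (t - s)"
      using arc_length_subcurve[OF arc st] by simp
    from \<rho>(3)[OF this nP] have "curve_integral \<rho> (\<lambda>\<tau>. \<gamma> (s + \<tau>)) (t - s) = \<infinity>" .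
    with curve_integral_subcurve_le[OF arc \<rho>(1), of s t] st
    show "curve_integral \<rho> \<gamma> l = \<infinity>" by (auto simp: top_unique)
  qed (use \<rho> in auto)
qed

lemma e2ennreal_ereal_diff: "e2ennreal \<bar>ereal a - ereal b\<bar> = ennreal \<bar>a - b\<bar>"
  by (simp add: e2ennreal_ereal)

text \<open>
  The definition compares the endpoints of a curve only. Applied to all subcurves it gives control
  at all intermediate pairs of points, which is what gradients are used for below.
\<close>

lemma wug_iff_controlled:
  assumes g: "g \<in> borel_measurable borel"
  shows "weak_upper_gradient p M (\<lambda>x. ereal (u x)) g \<longleftrightarrow> ae_curve p M (controlled_along u g)"
proof
  assume "weak_upper_gradient p M (\<lambda>x. ereal (u x)) g"
  then have "ae_curve p M (\<lambda>\<gamma> l. ennreal \<bar>u (\<gamma> 0) - u (\<gamma> l)\<bar> \<le> curve_integral g \<gamma> l)"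
    unfolding weak_upper_gradient_def e2ennreal_ereal_diff by blast
  from ae_curve_subcurves[OF this] show "ae_curve p M (controlled_along u g)"
  proof (rule ae_curve_mono)
    fix \<gamma> l assume arc: "arc_length_curve UNIV \<gamma> l" and *: "\<forall>s t. 0 \<le> s \<and> s < t \<and> t \<le> l \<longrightarrow>
      ennreal \<bar>u (\<gamma> (s + 0)) - u (\<gamma> (s + (t - s)))\<bar> \<le> curve_integral g (\<lambda>\<tau>. \<gamma> (s + \<tau>)) (t - s)"
    show "controlled_along u g \<gamma> l" unfolding controlled_along_def controls_def
    proof safe
      fix s t assume st: "0 \<le> s" "s \<le> t" "t \<le> l"
      show "ennreal \<bar>u (\<gamma> s) - u (\<gamma> t)\<bar> \<le> (\<integral>\<^sup>+ \<tau>\<in>{s..t}. g (clamped \<gamma> l \<tau>) \<partial>lborel)"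
      proof (cases "s = t")
        case False
        with *[rule_format, of s t] st show ?thesis
          unfolding curve_integral_subcurve[OF arc g st] by simp
      qed simp
    qed
  qed
next
  assume "ae_curve p M (controlled_along u g)"
  then have "ae_curve p M (\<lambda>\<gamma> l. e2ennreal \<bar>ereal (u (\<gamma> 0)) - ereal (u (\<gamma> l))\<bar> \<le> curve_integral g \<gamma> l)"
    by (rule ae_curve_mono) (auto simp: e2ennreal_ereal_diff controlled_along_def curve_integral_clamped
      dest: arc_length_curveD(1) intro!: controlsD[where l=l for l])
  with g show "weak_upper_gradient p M (\<lambda>x. ereal (u x)) g"
    unfolding weak_upper_gradient_def by (auto intro: borel_imp_measurable)
qed

lemma wug_mono:
  assumes "weak_upper_gradient p M u g" "h \<in> borel_measurable M" "\<And>x. g x \<le> h x"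
  shows "weak_upper_gradient p M u h"
proof -
  have "curve_integral g \<gamma> l \<le> curve_integral h \<gamma> l" for \<gamma> l
    unfolding curve_integral_lborel using assms(3) by (intro nn_integral_mono mult_right_mono) auto
  with assms show ?thesis
    unfolding weak_upper_gradient_def by (auto elim!: ae_curve_mono intro: order_trans)
qed


section \<open>Separability and local integrability\<close>

text \<open>
  An \<open>e\<close>-separated set is countable, because the disjoint balls of radius \<open>e/2\<close> about its
  points have positive measure while large balls have finite measure.
\<close>

lemma countable_separated:
  assumes "0 < e" and sep: "pairwise (\<lambda>x y. e \<le> dist x y) (S :: 'a set)"
  shows "countable S"
proof -
  fix x0 :: 'a
  define T where "T n k = {s \<in> S. s \<in> ball x0 (real n) \<and> 1 / real (Suc k) < measure M (ball s (e/2))}" for n k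
  have "finite (T n k)" for n k
  proof (rule ccontr)
    assume inf: "infinite (T n k)"
    define m where "m = measure M (ball x0 (real n + e))"
    obtain N where N: "m * real (Suc k) < real N" using reals_Archimedean2 by blast
    obtain F where F: "finite F" "card F = N" "F \<subseteq> T n k"
      using infinite_arbitrarily_large[OF inf] by blast
    have fm: "ball s r \<in> fmeasurable M" for s r
      using ball_finite by (auto intro: fmeasurableI)
    have disj: "disjoint_family_on (\<lambda>s. ball s (e/2)) F"
    proof (unfold disjoint_family_on_def, safe)
      fix a b z assume ab: "a \<in> F" "b \<in> F" "a \<noteq> b" "z \<in> ball a (e/2)" "z \<in> ball b (e/2)"
      then have "e \<le> dist a b" using sep F(3) unfolding pairwise_def T_def by blast
      moreover have "dist a b < e" using ab dist_triangle[of a b z] by (auto simp: dist_commute)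
      ultimately show "z \<in> {}" by auto
    qed
    have "real N * (1 / real (Suc k)) = (\<Sum>s\<in>F. 1 / real (Suc k))" using F by simp
    also have "\<dots> \<le> (\<Sum>s\<in>F. measure M (ball s (e/2)))"
      using F by (intro sum_mono) (auto simp: T_def)
    also have "\<dots> = measure M (\<Union>s\<in>F. ball s (e/2))"
      using F fm disj by (intro measure_UNION'[symmetric]) (auto simp: disjoint_family_on_def pairwise_def disjnt_def)
    also have "\<dots> \<le> m" unfolding m_def
    proof (rule measure_mono_fmeasurable)
      show "(\<Union>s\<in>F. ball s (e/2)) \<subseteq> ball x0 (real n + e)"
      proof safe
        fix s z assume "s \<in> F" "z \<in> ball s (e/2)"
        with F(3) show "z \<in> ball x0 (real n + e)"
          using dist_triangle[of x0 z s] \<open>0 < e\<close> by (auto simp: T_def)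
      qed
    qed (use fm in \<open>auto intro!: open_sets open_UN\<close>)
    finally show False using N by (simp add: field_simps)
  qed
  moreover have "S \<subseteq> (\<Union>n k. T n k)"
  proof
    fix s assume "s \<in> S"
    obtain n where n: "dist x0 s < real n" using reals_Archimedean2 by blast
    have "0 < measure M (ball s (e/2))"
      using ball_pos[of "e/2" s] ball_finite[of s "e/2"] \<open>0 < e\<close> by (simp add: measure_def enn2real_positive_iff)
    then obtain k where "1 / real (Suc k) < measure M (ball s (e/2))"
      using nat_approx_posE by blast
    with n \<open>s \<in> S\<close> show "s \<in> (\<Union>n k. T n k)" by (auto simp: T_def)
  qed
  ultimately show ?thesis
    by (meson countable_UN countable_finite countable_subset countableI_type)
qed

lemma ex_countable_dense:
  obtains D :: "'a set" where "countable D" "\<And>x e. 0 < e \<Longrightarrow> \<exists>d\<in>D. dist x d < e"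
proof -
  have "\<exists>S :: 'a set. countable S \<and> (\<forall>x. \<exists>d\<in>S. dist x d < e)" if "0 < e" for e :: real
  proof -
    define A where "A = {S :: 'a set. pairwise (\<lambda>x y. e \<le> dist x y) S}"
    have "\<exists>S\<in>A. \<forall>X\<in>A. S \<subseteq> X \<longrightarrow> X = S"
    proof (rule subset_Zorn)
      fix C assume C: "subset.chain A C"
      then have "pairwise (\<lambda>x y. e \<le> dist x y) (\<Union>C)"
        by (intro pairwise_chain_Union) (auto simp: A_def subset_chain_def chain_subset_def)
      then show "\<exists>U\<in>A. \<forall>X\<in>C. X \<subseteq> U" by (auto simp: A_def)
    qed
    then obtain S where S: "S \<in> A" "\<And>X. X \<in> A \<Longrightarrow> S \<subseteq> X \<Longrightarrow> X = S" by blast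
    have "\<exists>d\<in>S. dist x d < e" for x :: 'a
    proof (rule ccontr)
      assume "\<not> ?thesis"
      then have far: "\<And>d. d \<in> S \<Longrightarrow> e \<le> dist x d" by force
      then have "insert x S \<in> A" using S(1) by (auto simp: A_def pairwise_insert dist_commute)
      then have "x \<in> S" using S(2) by blast
      with far[of x] that show False by auto
    qed
    with countable_separated[OF that, of S] S(1) show ?thesis by (auto simp: A_def)
  qed
  then have "\<exists>S :: 'a set. countable S \<and> (\<forall>x. \<exists>d\<in>S. dist x d < 1 / real (Suc n))" for n
    by (meson divide_pos_pos of_nat_0_less_iff zero_less_one zero_less_Suc)
  then obtain S :: "nat \<Rightarrow> 'a set" where S: "\<And>n. countable (S n)" "\<And>n x. \<exists>d\<in>S n. dist x d < 1 / real (Suc n)"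
    by metis
  show ?thesis
  proof (rule that[of "\<Union>n. S n"])
    show "\<exists>d\<in>\<Union>n. S n. dist x d < e" if "0 < e" for x e
      using nat_approx_posE[OF that] S(2) by (meson UN_I UNIV_I less_trans)
  qed (use S in auto)
qed

lemma ex_countable_cover:
  fixes r :: "'a \<Rightarrow> real"
  assumes "\<And>x. 0 < r x"
  obtains B :: "nat \<Rightarrow> 'a set" where "\<And>i. open (B i)" "\<And>i. \<exists>x. B i \<subseteq> ball x (r x)" "(\<Union>i. B i) = UNIV"
proof -
  obtain D :: "'a set" where D: "countable D" "\<And>x e. 0 < e \<Longrightarrow> \<exists>d\<in>D. dist x d < e"
    using ex_countable_dense by blast
  define \<B> where "\<B> = {B. \<exists>d\<in>D. \<exists>q\<in>\<rat>. B = ball d q \<and> (\<exists>x. B \<subseteq> ball x (r x))}"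
  have "\<B> \<subseteq> (\<lambda>(d, q). ball d q) ` (D \<times> \<rat>)" by (auto simp: \<B>_def)
  then have "countable \<B>" using D(1) countable_rat by (meson countable_SIGMA countable_image countable_subset)
  have cov: "\<exists>B\<in>\<B>. x \<in> B" for x
  proof -
    obtain q where q: "q \<in> \<rat>" "0 < q" "q < r x / 2"
      using Rats_dense_in_real[of 0 "r x / 2"] assms[of x] by auto
    obtain d where d: "d \<in> D" "dist x d < q" using D(2) q by blast
    have "ball d q \<subseteq> ball x (r x)"
    proof
      fix z assume "z \<in> ball d q"
      then show "z \<in> ball x (r x)" using d q dist_triangle[of x z d] by auto
    qed
    with d q show ?thesis by (intro bexI[of _ "ball d q"]) (auto simp: \<B>_def dist_commute)
  qed
  then have "\<B> \<noteq> {}" by blast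
  define B where "B = from_nat_into \<B>"
  have B: "range B = \<B>"
    unfolding B_def by (rule range_from_nat_into) fact+
  then have Bi: "B i \<in> \<B>" for i by auto
  show ?thesis
  proof (rule that[of B])
    show "open (B i)" "\<exists>x. B i \<subseteq> ball x (r x)" for i
      using Bi[of i] by (auto simp: \<B>_def)
    show "(\<Union>i. B i) = UNIV" using cov B by blast
  qed
qed

text \<open>
  A curve is compact, so it meets finitely many members of a countable cover by sets on which \<open>g\<close> is
  \<open>p\<close>-integrable; on each of them \<open>g\<close> itself is an admissible weight.
\<close>

lemma Lp_loc_curve_integral_finite:
  assumes g[measurable]: "g \<in> borel_measurable borel" and "Lp_loc p M g"
  shows "ae_curve p M (\<lambda>\<gamma> l. curve_integral g \<gamma> l < \<infinity>)"
proof -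
  have "\<exists>r>0. (\<integral>\<^sup>+ y\<in>ball x r. epow (g y) p \<partial>M) < \<infinity>" for x
    using assms(2) by (simp add: Lp_loc_def)
  then obtain r where r: "\<And>x. 0 < r x" "\<And>x. (\<integral>\<^sup>+ y\<in>ball x (r x). epow (g y) p \<partial>M) < \<infinity>"
    by metis
  obtain B :: "nat \<Rightarrow> 'a set" where B: "\<And>i. open (B i)" "\<And>i. \<exists>x. B i \<subseteq> ball x (r x)" "(\<Union>i. B i) = UNIV"
    using ex_countable_cover[of r] r(1) by metis
  have Bm[measurable]: "B i \<in> sets borel" for i using B(1) by auto
  define h where "h i x = g x * indicator (B i) x" for i x
  have h[measurable]: "h i \<in> borel_measurable borel" for i unfolding h_def by measurable
  have "ae_curve p M (\<lambda>\<gamma> l. curve_integral (h i) \<gamma> l < \<infinity>)" for i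
  proof -
    obtain x where x: "B i \<subseteq> ball x (r x)" using B by blast
    have "(\<integral>\<^sup>+ y. epow (h i y) p \<partial>M) \<le> (\<integral>\<^sup>+ y\<in>ball x (r x). epow (g y) p \<partial>M)"
      using x by (intro nn_integral_mono) (auto simp: h_def split: split_indicator)
    with r(2)[of x] have "(\<integral>\<^sup>+ y. epow (h i y) p \<partial>M) < \<infinity>" by (rule order_le_less_trans[rotated])
    then show ?thesis unfolding ae_curve_iff
      by (intro bexI[of _ "h i"] conjI h) (auto simp: not_less top_unique)
  qed
  from ae_curve_all[OF this] show ?thesis
  proof (rule ae_curve_mono)
    fix \<gamma> l assume arc: "arc_length_curve UNIV \<gamma> l" and fin: "\<forall>i. curve_integral (h i) \<gamma> l < \<infinity>"
    have "compact (\<gamma> ` {0..l})"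
      using arc_length_curveD(2)[OF arc] by (intro compact_continuous_image) auto
    then obtain I where I: "finite I" "\<gamma> ` {0..l} \<subseteq> (\<Union>i\<in>I. B i)"
      using compactE_image[of "\<gamma> ` {0..l}" UNIV B] B by auto
    note [measurable] = borel_along_curve[OF arc g] borel_along_curve[OF arc h]
    have "curve_integral g \<gamma> l \<le> (\<integral>\<^sup>+ t. (\<Sum>i\<in>I. h i (clamped \<gamma> l t) * indicator {0..l} t) \<partial>lborel)"
      unfolding curve_integral_clamped
    proof (intro nn_integral_mono)
      fix t
      show "g (clamped \<gamma> l t) * indicator {0..l} t \<le> (\<Sum>i\<in>I. h i (clamped \<gamma> l t) * indicator {0..l} t)"
      proof (cases "t \<in> {0..l}")
        case True
        then have "\<gamma> t \<in> (\<Union>i\<in>I. B i)" using I(2) by blast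
        then obtain i where i: "i \<in> I" "\<gamma> t \<in> B i" by blast
        have "h i (\<gamma> t) \<le> (\<Sum>i\<in>I. h i (\<gamma> t))" using i I by (intro member_le_sum) auto
        then show ?thesis using True i by (simp add: h_def)
      qed simp
    qed
    also have "\<dots> = (\<Sum>i\<in>I. curve_integral (h i) \<gamma> l)"
      unfolding curve_integral_clamped by (rule nn_integral_sum) measurable
    also have "\<dots> < \<infinity>" using fin I(1) by (simp add: less_top)
    finally show "curve_integral g \<gamma> l < \<infinity>" .
  qed
qed

end


section \<open>Calculus of weak upper gradients\<close>

lemma controls_cong:
  assumes "\<And>t. 0 \<le> t \<Longrightarrow> t \<le> l \<Longrightarrow> f t = f' t"
  shows "controls f K l \<longleftrightarrow> controls f' K l"
  using assms unfolding controls_def by auto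

context metric_measure
begin

lemma Lp_loc_mono:
  assumes "Lp_loc p M g" "h \<in> borel_measurable M" "AE x in M. h x \<le> g x"
  shows "Lp_loc p M h"
  unfolding Lp_loc_def
proof (intro conjI ballI)
  fix x assume "x \<in> space M"
  then obtain r where r: "0 < r" "(\<integral>\<^sup>+ y\<in>ball x r. epow (g y) p \<partial>M) < \<infinity>"
    using assms(1) by (auto simp: Lp_loc_def)
  have "(\<integral>\<^sup>+ y\<in>ball x r. epow (h y) p \<partial>M) \<le> (\<integral>\<^sup>+ y\<in>ball x r. epow (g y) p \<partial>M)"
    using assms(3)
    by (intro nn_integral_mono_AE, eventually_elim) (use p in \<open>auto intro: epow_mono split: split_indicator\<close>)
  with r show "\<exists>r>0. (\<integral>\<^sup>+ y\<in>ball x r. epow (h y) p \<partial>M) < \<infinity>"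
    by (intro exI[of _ r]) (auto intro: order_le_less_trans)
qed (fact assms(2))

text \<open>
  Local integrability makes the integrals along almost every curve finite, as the passage to the
  infimum requires.
\<close>

lemma wug_INF:
  fixes g :: "nat \<Rightarrow> 'a \<Rightarrow> ennreal"
  assumes g: "\<And>i. g i \<in> borel_measurable borel"
    and wug: "\<And>i. weak_upper_gradient p M (\<lambda>x. ereal (u x)) (g i)"
    and loc: "\<And>i. Lp_loc p M (g i)"
  shows "weak_upper_gradient p M (\<lambda>x. ereal (u x)) (\<lambda>x. INF i. g i x)"
proof -
  have [measurable]: "(\<lambda>x. INF i. g i x) \<in> borel_measurable borel" using g by measurable
  have "ae_curve p M (\<lambda>\<gamma> l. (\<forall>i. controlled_along u (g i) \<gamma> l) \<and> (\<forall>i. curve_integral (g i) \<gamma> l < \<infinity>))"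
    using wug g loc
    by (intro ae_curve_conj ae_curve_all Lp_loc_curve_integral_finite) (auto simp: wug_iff_controlled)
  then have "ae_curve p M (controlled_along u (\<lambda>x. INF i. g i x))"
  proof (rule ae_curve_mono)
    fix \<gamma> l assume arc: "arc_length_curve UNIV \<gamma> l"
      and *: "(\<forall>i. controlled_along u (g i) \<gamma> l) \<and> (\<forall>i. curve_integral (g i) \<gamma> l < \<infinity>)"
    then show "controlled_along u (\<lambda>x. INF i. g i x) \<gamma> l"
      unfolding controlled_along_def curve_integral_clamped
      by (intro controls_INF borel_along_curve[OF arc g]) auto
  qed
  then show ?thesis by (simp add: wug_iff_controlled)
qed

lemma ennreal_inverse_le_imp:
  fixes a b :: ennreal
  assumes "inverse a \<le> inverse b" "0 < a" "0 < b" shows "b \<le> a"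
proof (cases a)
  case (real x)
  show ?thesis
  proof (cases b)
    case b: (real y)
    have xy: "0 < x" "0 < y" using real b assms(2,3) by auto
    then have "inverse x \<le> inverse y" using assms(1) real b by (simp add: inverse_ennreal)
    then show ?thesis using xy real b by (simp add: ennreal_leI)
  next
    case top
    then show ?thesis using assms(1) real by simp
  qed
qed simp

lemma sigma_finite_M: "sigma_finite_measure M"
proof
  fix x0 :: 'a
  have "\<Union> (range (\<lambda>n. ball x0 (real n))) = space M"
    using reals_Archimedean2 by (auto simp: dist_commute)
  then show "\<exists>A. countable A \<and> A \<subseteq> sets M \<and> \<Union> A = space M \<and> (\<forall>a\<in>A. emeasure M a \<noteq> \<infinity>)"
    using ball_finite by (intro exI[of _ "range (\<lambda>n. ball x0 (real n))"]) (auto simp: less_top)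
qed

text \<open>
  Since the minimal gradient is defined by a choice, it has no properties at all before existence
  is established. The essential infimum of all locally \<open>p\<close>-integrable weak upper gradients is attained
  by a countable infimum: take a sequence that maximizes \<open>\<integral> w / (1 + g)\<close> for a positive integrable
  weight \<open>w\<close>.
\<close>

lemma ex_minimal_wug:
  assumes g0: "weak_upper_gradient p M (\<lambda>x. ereal (u x)) g0" "Lp_loc p M g0"
  obtains g where "g \<in> borel_measurable borel" "is_minimal_wug p M (\<lambda>x. ereal (u x)) g"
proof -
  let ?u = "\<lambda>x. ereal (u x)"
  define \<G> where "\<G> = {g \<in> borel_measurable borel. weak_upper_gradient p M ?u g \<and> Lp_loc p M g}"
  have majorant: "\<exists>h'\<in>\<G>. AE x in M. h x = h' x"
    if "weak_upper_gradient p M ?u h" "Lp_loc p M h" for h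
  proof -
    have h: "h \<in> borel_measurable M" using that by (simp add: weak_upper_gradient_def)
    obtain h' where h': "h' \<in> borel_measurable borel" "\<And>x. h x \<le> h' x" "AE x in M. h x = h' x"
      using ex_borel_majorant[OF h] by blast
    have h'M: "h' \<in> borel_measurable M" using h'(1) by (rule borel_imp_measurable)
    have "AE x in M. h' x \<le> h x" using h'(3) by eventually_elim simp
    then have "Lp_loc p M h'" using Lp_loc_mono[OF that(2) h'M] by simp
    with wug_mono[OF that(1) h'M h'(2)] h' show ?thesis by (auto simp: \<G>_def)
  qed
  have ne: "\<G> \<noteq> {}" using majorant[OF g0] by auto
  interpret sigma_finite_measure M by (rule sigma_finite_M)
  obtain w where w[measurable]: "w \<in> borel_measurable M" and wfin: "integral\<^sup>N M w \<noteq> \<infinity>"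
    and wpos: "\<And>x. 0 < w x" "\<And>x. w x < \<infinity>"
    using Ex_finite_integrable_function by auto
  define \<Phi> where "\<Phi> g = (\<integral>\<^sup>+ x. w x * inverse (1 + g x) \<partial>M)" for g
  obtain y :: "nat \<Rightarrow> ennreal" where y: "range y \<subseteq> \<Phi> ` \<G>" "Sup (\<Phi> ` \<G>) = Sup (range y)"
    using ennreal_SUP_countable_SUP[OF ne, of \<Phi>] by blast
  have "\<exists>g\<in>\<G>. y i = \<Phi> g" for i using y(1) by auto
  then obtain f where f: "\<And>i. f i \<in> \<G>" "\<And>i. y i = \<Phi> (f i)" by metis
  define g where "g x = (INF i::nat. f i x)" for x
  have inv_mono: "inverse (1 + b) \<le> inverse (1 + a)" if "a \<le> b" for a b :: ennreal
  proof (rule ccontr)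
    assume "\<not> ?thesis"
    then have "inverse (1 + a) \<le> inverse (1 + b)" "inverse (1 + a) \<noteq> inverse (1 + b)" by auto
    moreover from this(1) have "1 + b \<le> 1 + a"
      by (rule ennreal_inverse_le_imp) (auto simp: add_pos_nonneg)
    ultimately show False using that by (metis add_left_mono antisym)
  qed
  have INF_in: "(\<lambda>x. INF i::nat. k i x) \<in> \<G>" if "\<And>i. k i \<in> \<G>" for k
  proof -
    have [measurable]: "k i \<in> borel_measurable borel" for i using that by (auto simp: \<G>_def)
    have km: "(\<lambda>x. INF i. k i x) \<in> borel_measurable borel" by measurable
    have "Lp_loc p M (\<lambda>x. INF i. k i x)"
    proof (rule Lp_loc_mono)
      show "Lp_loc p M (k 0)" using that[of 0] by (simp add: \<G>_def)
      have "(INF i. k i x) \<le> k 0 x" for x by (rule INF_lower) simp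
      then show "AE x in M. (INF i. k i x) \<le> k 0 x" by (rule AE_I2)
    qed (rule borel_imp_measurable[OF km])
    moreover have "weak_upper_gradient p M ?u (\<lambda>x. INF i. k i x)"
      using that by (intro wug_INF) (auto simp: \<G>_def)
    ultimately show ?thesis using km by (simp add: \<G>_def)
  qed
  have gG: "g \<in> \<G>" unfolding g_def using f(1) by (rule INF_in)
  have \<Phi>g: "Sup (\<Phi> ` \<G>) \<le> \<Phi> g"
    unfolding y(2)
  proof (rule SUP_least)
    fix i
    have "g x \<le> f i x" for x unfolding g_def by (rule INF_lower) auto
    then show "y i \<le> \<Phi> g"
      unfolding f(2) \<Phi>_def by (intro nn_integral_mono mult_left_mono inv_mono) auto
  qed
  have min: "AE x in M. g x \<le> h x" if "h \<in> \<G>" for h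
  proof -
    \<comment> \<open>The minimum of \<open>g\<close> and \<open>h\<close>, written as the infimum of the sequence \<open>g, h, h, \<dots>\<close>.\<close>
    define k where "k x = (INF i::nat. (if i = 0 then g x else h x))" for x
    have "k x \<le> (if i = 0 then g x else h x)" for x and i :: nat
      unfolding k_def by (rule INF_lower) simp
    from this[of _ 0] this[of _ 1] have k_le: "k x \<le> g x" "k x \<le> h x" for x by auto
    have "(\<lambda>x. INF i::nat. (if i = 0 then g else h) x) \<in> \<G>"
      by (rule INF_in) (use gG that in auto)
    then have kG: "k \<in> \<G>" by (simp add: k_def[abs_def] if_distribR)
    have [measurable]: "g \<in> borel_measurable M" "k \<in> borel_measurable M"
      using gG kG by (auto simp: \<G>_def intro: borel_imp_measurable)
    have "\<Phi> k \<le> Sup (\<Phi> ` \<G>)" using kG by (rule SUP_upper)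
    then have "\<Phi> k \<le> \<Phi> g" using \<Phi>g by (rule order_trans)
    have "AE x in M. w x * inverse (1 + k x) \<le> w x * inverse (1 + g x)"
    proof (rule ccontr)
      assume *: "\<not> ?thesis"
      have "\<Phi> g \<le> integral\<^sup>N M w"
        unfolding \<Phi>_def
      proof (intro nn_integral_mono)
        fix x
        have "w x * inverse (1 + g x) \<le> w x * inverse (1 + 0)"
          by (intro mult_left_mono inv_mono) auto
        then show "w x * inverse (1 + g x) \<le> w x" by simp
      qed
      then have "\<Phi> g \<noteq> \<infinity>" using wfin by (auto simp: top_unique)
      then have "\<Phi> g < \<Phi> k"
        unfolding \<Phi>_def using * k_le(1)
        by (intro nn_integral_less) (auto intro!: mult_left_mono inv_mono)
      with \<open>\<Phi> k \<le> \<Phi> g\<close> show False by simp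
    qed
    then show ?thesis
    proof eventually_elim
      case (elim x)
      have "inverse (1 + k x) \<le> inverse (1 + g x)"
        using elim wpos[of x] by (simp add: ennreal_mult_le_mult_iff less_top)
      then have "1 + g x \<le> 1 + k x"
        by (rule ennreal_inverse_le_imp) (auto simp: add_pos_nonneg)
      then have "g x \<le> k x" by (simp add: ennreal_add_left_cancel_le)
      from this k_le(2)[of x] show ?case by (rule order_trans)
    qed
  qed
  have "is_minimal_wug p M ?u g"
    unfolding is_minimal_wug_def
  proof (intro conjI allI impI)
    fix h assume h: "weak_upper_gradient p M ?u h \<and> Lp_loc p M h"
    from majorant[of h] h obtain h' where h': "h' \<in> \<G>" "AE x in M. h x = h' x" by blast
    from min[OF h'(1)] h'(2) show "AE x in M. g x \<le> h x" by eventually_elim simp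
  qed (use gG in \<open>auto simp: \<G>_def\<close>)
  with gG show ?thesis using that by (auto simp: \<G>_def)
qed

lemma is_minimal_wug_minimal_wug:
  assumes "weak_upper_gradient p M (\<lambda>x. ereal (u x)) g0" "Lp_loc p M g0"
  shows "is_minimal_wug p M (\<lambda>x. ereal (u x)) (minimal_wug p M (\<lambda>x. ereal (u x)))"
  unfolding minimal_wug_def using ex_minimal_wug[OF assms] by (metis someI)

lemma wug_restrict:
  assumes "weak_upper_gradient p M u g" "open S"
  shows "weak_upper_gradient p (restrict_space M S) u g"
proof -
  obtain \<rho> where \<rho>: "\<rho> \<in> borel_measurable borel" "(\<integral>\<^sup>+ x. epow (\<rho> x) p \<partial>M) < \<infinity>"
     "\<And>\<gamma> l. arc_length_curve UNIV \<gamma> l \<Longrightarrow>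
        \<not> e2ennreal \<bar>u (\<gamma> 0) - u (\<gamma> l)\<bar> \<le> curve_integral g \<gamma> l \<Longrightarrow> curve_integral \<rho> \<gamma> l = \<infinity>"
    using assms(1) unfolding weak_upper_gradient_def ae_curve_iff by blast
  have sp: "space (restrict_space M S) = S" by (simp add: space_restrict_space)
  have "(\<integral>\<^sup>+ x. epow (\<rho> x) p \<partial>restrict_space M S) \<le> (\<integral>\<^sup>+ x. epow (\<rho> x) p \<partial>M)"
    using assms(2) by (subst nn_integral_restrict_space) (auto intro!: nn_integral_mono split: split_indicator)
  then have "(\<integral>\<^sup>+ x. epow (\<rho> x) p \<partial>restrict_space M S) < \<infinity>" using \<rho>(2) by (rule order_le_less_trans)
  moreover have "arc_length_curve UNIV \<gamma> l" if "arc_length_curve S \<gamma> l" for \<gamma> :: "real \<Rightarrow> 'a" and l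
    using that unfolding arc_length_curve_def by blast
  moreover have "\<rho> \<in> borel_measurable (restrict_space borel S)"
    using \<rho>(1) by (rule measurable_restrict_space1)
  ultimately have "ae_curve p (restrict_space M S)
      (\<lambda>\<gamma> l. e2ennreal \<bar>u (\<gamma> 0) - u (\<gamma> l)\<bar> \<le> curve_integral g \<gamma> l)"
    unfolding ae_curve_def sp using \<rho>(3) by (intro bexI[of _ \<rho>]) auto
  with assms(1) show ?thesis
    unfolding weak_upper_gradient_def by (auto intro: measurable_restrict_space1)
qed

text \<open>
  Both the gradient and the exceptional weight are extended by zero; along a curve inside \<open>S\<close> this
  changes nothing.
\<close>

lemma wug_unrestrict:
  assumes "weak_upper_gradient p (restrict_space M S) (\<lambda>x. ereal (u x)) g" "open S"
    and fin: "(\<integral>\<^sup>+ x. epow (g x) p \<partial>restrict_space M S) < \<infinity>"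
  obtains h where "h \<in> borel_measurable borel" "(\<integral>\<^sup>+ x. epow (h x) p \<partial>M) < \<infinity>"
    "ae_curve p M (\<lambda>\<gamma> l. \<gamma> ` {0..l} \<subseteq> S \<longrightarrow> ennreal \<bar>u (\<gamma> 0) - u (\<gamma> l)\<bar> \<le> curve_integral h \<gamma> l)"
proof -
  have sp: "space (restrict_space M S) = S" by (simp add: space_restrict_space)
  have Sm: "S \<inter> space M \<in> sets M" using assms(2) by simp
  have gm: "(\<lambda>x. g x * indicator S x) \<in> borel_measurable M"
    using assms(1) borel_measurable_restrict_space_iff_ennreal[OF Sm] by (simp add: weak_upper_gradient_def)
  obtain h where h: "h \<in> borel_measurable borel" "\<And>x. g x * indicator S x \<le> h x"
      "AE x in M. g x * indicator S x = h x"
    by (rule ex_borel_majorant[OF gm]) blast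
  have "(\<integral>\<^sup>+ x. epow (h x) p \<partial>M) = (\<integral>\<^sup>+ x\<in>S. epow (g x) p \<partial>M)"
  proof (intro nn_integral_cong_AE)
    show "AE x in M. epow (h x) p = epow (g x) p * indicator S x"
      using h(3)
    proof eventually_elim
      case (elim x)
      then show ?case by (cases "x \<in> S") (simp_all flip: elim)
    qed
  qed
  also have "\<dots> < \<infinity>" using fin nn_integral_restrict_space[OF Sm] by simp
  finally have hfin: "(\<integral>\<^sup>+ x. epow (h x) p \<partial>M) < \<infinity>" .
  obtain \<rho> where \<rho>: "\<rho> \<in> borel_measurable (restrict_space borel S)"
     "(\<integral>\<^sup>+ x. epow (\<rho> x) p \<partial>restrict_space M S) < \<infinity>"
     "\<And>\<gamma> l. arc_length_curve S \<gamma> l \<Longrightarrow>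
        \<not> ennreal \<bar>u (\<gamma> 0) - u (\<gamma> l)\<bar> \<le> curve_integral g \<gamma> l \<Longrightarrow> curve_integral \<rho> \<gamma> l = \<infinity>"
    using assms(1) unfolding weak_upper_gradient_def ae_curve_def sp e2ennreal_ereal_diff by blast
  define \<rho>' where "\<rho>' x = \<rho> x * indicator S x" for x
  have \<rho>': "\<rho>' \<in> borel_measurable borel"
    using \<rho>(1) assms(2) by (subst (asm) borel_measurable_restrict_space_iff_ennreal) (auto simp: \<rho>'_def[abs_def])
  have "(\<integral>\<^sup>+ x. epow (\<rho>' x) p \<partial>M) = (\<integral>\<^sup>+ x\<in>S. epow (\<rho> x) p \<partial>M)"
    by (intro nn_integral_cong) (auto simp: \<rho>'_def split: split_indicator)
  also have "\<dots> < \<infinity>" using \<rho>(2) nn_integral_restrict_space[OF Sm] by simp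
  finally have \<rho>'fin: "(\<integral>\<^sup>+ x. epow (\<rho>' x) p \<partial>M) < \<infinity>" .
  have "ae_curve p M (\<lambda>\<gamma> l. \<gamma> ` {0..l} \<subseteq> S \<longrightarrow> ennreal \<bar>u (\<gamma> 0) - u (\<gamma> l)\<bar> \<le> curve_integral h \<gamma> l)"
    unfolding ae_curve_iff
  proof (intro bexI[of _ \<rho>'] conjI allI impI)
    fix \<gamma> l assume asm: "arc_length_curve UNIV \<gamma> l \<and>
      \<not> (\<gamma> ` {0..l} \<subseteq> S \<longrightarrow> ennreal \<bar>u (\<gamma> 0) - u (\<gamma> l)\<bar> \<le> curve_integral h \<gamma> l)"
    then have inS: "\<gamma> ` {0..l} \<subseteq> S" by blast
    then have arc: "arc_length_curve S \<gamma> l" using asm unfolding arc_length_curve_def by blast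
    have "curve_integral g \<gamma> l \<le> curve_integral h \<gamma> l"
      unfolding curve_integral_lborel
    proof (intro nn_integral_mono)
      fix t show "g (\<gamma> t) * indicator {0..l} t \<le> h (\<gamma> t) * indicator {0..l} t"
      proof (cases "t \<in> {0..l}")
        case True
        then have "\<gamma> t \<in> S" using inS by blast
        then show ?thesis using True h(2)[of "\<gamma> t"] by simp
      qed simp
    qed
    then have "\<not> ennreal \<bar>u (\<gamma> 0) - u (\<gamma> l)\<bar> \<le> curve_integral g \<gamma> l" using asm by (auto dest: order_trans)
    from \<rho>(3)[OF arc this] have "curve_integral \<rho> \<gamma> l = \<infinity>" .
    also have "curve_integral \<rho> \<gamma> l = curve_integral \<rho>' \<gamma> l"
      unfolding curve_integral_lborel
    proof (intro nn_integral_cong)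
      fix t show "\<rho> (\<gamma> t) * indicator {0..l} t = \<rho>' (\<gamma> t) * indicator {0..l} t"
      proof (cases "t \<in> {0..l}")
        case True
        then have "\<gamma> t \<in> S" using inS by blast
        then show ?thesis by (simp add: \<rho>'_def)
      qed simp
    qed
    finally show "curve_integral \<rho>' \<gamma> l = \<infinity>" .
  qed (use \<rho>' \<rho>'fin in auto)
  then show ?thesis using that h(1) hfin by blast
qed

text \<open>
  Local gradients are glued crudely: at distance \<open>d\<close> from \<open>x0\<close> take the supremum of all gradients
  that belong to balls of radius at most \<open>d + 3\<close>. A piece of curve of length less than 1 then
  sees, at each of its points, a gradient for one fixed ball that contains the piece.
\<close>

lemma ex_wug_from_balls:
  assumes "\<And>n. (\<lambda>x. ereal (u x)) \<in> N1p p (restrict_space M (ball x0 (real n)))"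
  obtains g where "g \<in> borel_measurable borel" "weak_upper_gradient p M (\<lambda>x. ereal (u x)) g"
    "\<And>n. (\<integral>\<^sup>+ x\<in>ball x0 (real n). epow (g x) p \<partial>M) < \<infinity>"
proof -
  define B where "B k = ball x0 (real k)" for k
  have "\<exists>h. h \<in> borel_measurable borel \<and> (\<integral>\<^sup>+ x. epow (h x) p \<partial>M) < \<infinity> \<and>
    ae_curve p M (\<lambda>\<gamma> l. \<gamma> ` {0..l} \<subseteq> B k \<longrightarrow> ennreal \<bar>u (\<gamma> 0) - u (\<gamma> l)\<bar> \<le> curve_integral h \<gamma> l)" for k
  proof -
    have "N1p_norm p (restrict_space M (B k)) (\<lambda>x. ereal (u x)) < \<infinity>"
      using assms[of k] by (simp add: N1p_def B_def)
    then have "(INF g\<in>{g. weak_upper_gradient p (restrict_space M (B k)) (\<lambda>x. ereal (u x)) g}.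
        \<integral>\<^sup>+ x. epow (g x) p \<partial>restrict_space M (B k)) < \<infinity>"
      by (simp add: N1p_norm_def)
    then obtain g where "weak_upper_gradient p (restrict_space M (B k)) (\<lambda>x. ereal (u x)) g"
      "(\<integral>\<^sup>+ x. epow (g x) p \<partial>restrict_space M (B k)) < \<infinity>"
      by (auto simp: INF_less_iff)
    moreover have "open (B k)" by (simp add: B_def)
    ultimately show ?thesis using wug_unrestrict[of "B k" u g] by blast
  qed
  then obtain h where *: "\<And>k. h k \<in> borel_measurable borel \<and> (\<integral>\<^sup>+ x. epow (h k x) p \<partial>M) < \<infinity> \<and>
    ae_curve p M (\<lambda>\<gamma> l. \<gamma> ` {0..l} \<subseteq> B k \<longrightarrow>
      ennreal \<bar>u (\<gamma> 0) - u (\<gamma> l)\<bar> \<le> curve_integral (h k) \<gamma> l)"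
    using choice[of "\<lambda>k h. h \<in> borel_measurable borel \<and> (\<integral>\<^sup>+ x. epow (h x) p \<partial>M) < \<infinity> \<and>
      ae_curve p M (\<lambda>\<gamma> l. \<gamma> ` {0..l} \<subseteq> B k \<longrightarrow>
        ennreal \<bar>u (\<gamma> 0) - u (\<gamma> l)\<bar> \<le> curve_integral h \<gamma> l)"] by blast
  then have h[measurable]: "\<And>k. h k \<in> borel_measurable borel"
    and hfin: "\<And>k. (\<integral>\<^sup>+ x. epow (h k x) p \<partial>M) < \<infinity>"
    and hae: "\<And>k. ae_curve p M (\<lambda>\<gamma> l. \<gamma> ` {0..l} \<subseteq> B k \<longrightarrow>
      ennreal \<bar>u (\<gamma> 0) - u (\<gamma> l)\<bar> \<le> curve_integral (h k) \<gamma> l)"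
    by auto
  define A where "A k = {x. real k \<le> dist x0 x + 3}" for k
  have "closed (A k)" for k
    unfolding A_def by (intro closed_Collect_le continuous_intros)
  then have A[measurable]: "A k \<in> sets borel" for k by auto
  define g where "g x = (SUP k. h k x * indicator (A k) x)" for x
  have g[measurable]: "g \<in> borel_measurable borel" unfolding g_def by measurable
  have hM[measurable]: "h k \<in> borel_measurable M" for k by (rule borel_imp_measurable) measurable
  have "(\<integral>\<^sup>+ x\<in>ball x0 (real n). epow (g x) p \<partial>M) < \<infinity>" for n
  proof -
    have "(\<integral>\<^sup>+ x\<in>ball x0 (real n). epow (g x) p \<partial>M) \<le> (\<integral>\<^sup>+ x. (\<Sum>k<n+3. epow (h k x) p) \<partial>M)"
    proof (intro nn_integral_mono)
      fix x
      show "epow (g x) p * indicator (ball x0 (real n)) x \<le> (\<Sum>k<n+3. epow (h k x) p)"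
      proof (cases "x \<in> ball x0 (real n)")
        case True
        have "epow (g x) p \<le> (\<Sum>k. epow (h k x * indicator (A k) x) p)"
          unfolding g_def using p by (intro epow_SUP_le) auto
        also have "\<dots> = (\<Sum>k<n+3. epow (h k x * indicator (A k) x) p)"
          using True by (intro suminf_finite) (auto simp: A_def indicator_def)
        also have "\<dots> \<le> (\<Sum>k<n+3. epow (h k x) p)"
          using p by (intro sum_mono epow_mono) (auto split: split_indicator)
        finally show ?thesis using True by simp
      qed simp
    qed
    also have "\<dots> = (\<Sum>k<n+3. \<integral>\<^sup>+ x. epow (h k x) p \<partial>M)"
      by (rule nn_integral_sum) measurable
    also have "\<dots> < \<infinity>" using hfin by (simp add: less_top)
    finally show ?thesis .
  qed
  moreover have "ae_curve p M (controlled_along u g)"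
    using ae_curve_subcurves[OF ae_curve_all[OF hae]]
  proof (rule ae_curve_mono)
    fix \<gamma> l assume arc: "arc_length_curve UNIV \<gamma> l"
      and *: "\<forall>s t. 0 \<le> s \<and> s < t \<and> t \<le> l \<longrightarrow> (\<forall>k. (\<lambda>\<tau>. \<gamma> (s + \<tau>)) ` {0..t - s} \<subseteq> B k \<longrightarrow>
        ennreal \<bar>u (\<gamma> (s + 0)) - u (\<gamma> (s + (t - s)))\<bar> \<le> curve_integral (h k) (\<lambda>\<tau>. \<gamma> (s + \<tau>)) (t - s))"
    note [measurable] = borel_along_curve[OF arc g]
    show "controlled_along u g \<gamma> l"
      unfolding controlled_along_def
    proof (rule controls_if_locally[where \<delta>=1])
      fix s t assume st: "0 \<le> s" "s \<le> t" "t \<le> l" "t - s < 1"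
      show "ennreal \<bar>u (\<gamma> s) - u (\<gamma> t)\<bar> \<le> (\<integral>\<^sup>+ \<tau>\<in>{s..t}. g (clamped \<gamma> l \<tau>) \<partial>lborel)"
      proof (cases "s = t")
        case False
        \<comment> \<open>The ball of radius \<open>k\<close> contains the whole piece, and every point of the piece has
          distance at least \<open>k - 3\<close> from \<open>x0\<close>.\<close>
        define k where "k = nat \<lceil>dist x0 (\<gamma> s)\<rceil> + 1"
        have "0 \<le> \<lceil>dist x0 (\<gamma> s)\<rceil>" by (simp add: le_ceiling_iff order_less_le_trans[of _ 0])
        then have k: "dist x0 (\<gamma> s) + 1 \<le> real k" "real k \<le> dist x0 (\<gamma> s) + 2"
          unfolding k_def using ceiling_correct[of "dist x0 (\<gamma> s)"] by simp_all
        have near: "dist (\<gamma> s) (\<gamma> \<tau>) < 1" if "\<tau> \<in> {s..t}" for \<tau>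
          using arc_length_curve_lipschitz[OF arc, of s \<tau>] that st by auto
        have inB: "\<gamma> \<tau> \<in> B k" and inA: "\<gamma> \<tau> \<in> A k" if "\<tau> \<in> {s..t}" for \<tau>
          using near[OF that] k dist_triangle[of x0 "\<gamma> \<tau>" "\<gamma> s"] dist_triangle[of x0 "\<gamma> s" "\<gamma> \<tau>"]
          by (auto simp: B_def A_def dist_commute)
        have "(\<lambda>\<tau>. \<gamma> (s + \<tau>)) ` {0..t - s} \<subseteq> B k" using inB by auto
        then have "ennreal \<bar>u (\<gamma> s) - u (\<gamma> t)\<bar> \<le> curve_integral (h k) (\<lambda>\<tau>. \<gamma> (s + \<tau>)) (t - s)"
          using *[rule_format, of s t k] st False by simp
        also have "\<dots> = (\<integral>\<^sup>+ \<tau>\<in>{s..t}. h k (clamped \<gamma> l \<tau>) \<partial>lborel)"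
          using st by (intro curve_integral_subcurve[OF arc h]) auto
        also have "\<dots> \<le> (\<integral>\<^sup>+ \<tau>\<in>{s..t}. g (clamped \<gamma> l \<tau>) \<partial>lborel)"
        proof (intro nn_integral_mono)
          fix \<tau>
          have "h k (\<gamma> \<tau>) * indicator (A k) (\<gamma> \<tau>) \<le> g (\<gamma> \<tau>)" unfolding g_def by (rule SUP_upper) auto
          then show "h k (clamped \<gamma> l \<tau>) * indicator {s..t} \<tau> \<le> g (clamped \<gamma> l \<tau>) * indicator {s..t} \<tau>"
            using inA[of \<tau>] st by (cases "\<tau> \<in> {s..t}") auto
        qed
        finally show ?thesis .
      qed simp
    qed (auto intro: borel_along_curve[OF arc g])
  qed
  ultimately show ?thesis using that[OF g] by (simp add: wug_iff_controlled[OF g])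
qed

lemma wug_off_level_set:
  assumes u: "continuous_on UNIV u" and g: "g \<in> borel_measurable borel"
    and wug: "weak_upper_gradient p M (\<lambda>x. ereal (u x)) g"
  shows "weak_upper_gradient p M (\<lambda>x. ereal (u x)) (\<lambda>x. if u x = c then 0 else g x)"
proof -
  have [measurable]: "u \<in> borel_measurable borel" using u by (rule borel_measurable_continuous_onI)
  have m: "(\<lambda>x. if u x = c then 0 else g x) \<in> borel_measurable borel" using g by measurable
  from wug g have "ae_curve p M (controlled_along u g)" by (simp add: wug_iff_controlled)
  then have "ae_curve p M (controlled_along u (\<lambda>x. if u x = c then 0 else g x))"
  proof (rule ae_curve_mono)
    fix \<gamma> l assume arc: "arc_length_curve UNIV \<gamma> l" and ctl: "controlled_along u g \<gamma> l"
    let ?f = "\<lambda>t. u (clamped \<gamma> l t)"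
    have "continuous_on {0..l} ?f"
      using continuous_on_compose2[OF u continuous_clamped[OF arc]] continuous_on_subset by auto
    moreover have "controls ?f (\<lambda>t. g (clamped \<gamma> l t)) l"
      using ctl unfolding controlled_along_def by (subst controls_cong[of l _ "\<lambda>t. u (\<gamma> t)"]) auto
    ultimately have "controls ?f (\<lambda>t. if ?f t = c then 0 else g (clamped \<gamma> l t)) l"
      using borel_along_curve[OF arc g] by (intro controls_off_level_set) auto
    then show "controlled_along u (\<lambda>x. if u x = c then 0 else g x) \<gamma> l"
      unfolding controlled_along_def by (subst controls_cong[of l _ ?f]) auto
  qed
  with m show ?thesis by (simp add: wug_iff_controlled)
qed

lemma wug_cutoff_product:
  assumes u: "continuous_on UNIV u" and g: "g \<in> borel_measurable borel"
    and wug: "weak_upper_gradient p M (\<lambda>x. ereal (u x)) g"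
    and \<eta>: "\<And>x. 0 \<le> \<eta> x \<and> \<eta> x \<le> 1" "\<And>x y. \<bar>\<eta> x - \<eta> y\<bar> \<le> L * dist x y" and L: "0 \<le> L"
  shows "weak_upper_gradient p M (\<lambda>x. ereal (\<eta> x * (u x - c))) (\<lambda>x. g x + ennreal (L * \<bar>u x - c\<bar>))"
proof -
  have um[measurable]: "u \<in> borel_measurable borel" using u by (rule borel_measurable_continuous_onI)
  have m: "(\<lambda>x. g x + ennreal (L * \<bar>u x - c\<bar>)) \<in> borel_measurable borel" using g by measurable
  from wug g have "ae_curve p M (controlled_along u g)" by (simp add: wug_iff_controlled)
  then have "ae_curve p M (controlled_along (\<lambda>x. \<eta> x * (u x - c)) (\<lambda>x. g x + ennreal (L * \<bar>u x - c\<bar>)))"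
  proof (rule ae_curve_mono)
    fix \<gamma> l assume arc: "arc_length_curve UNIV \<gamma> l" and ctl: "controlled_along u g \<gamma> l"
    let ?F = "\<lambda>t. u (clamped \<gamma> l t) - c" and ?e = "\<lambda>t. \<eta> (clamped \<gamma> l t)"
    have "continuous_on UNIV (\<lambda>t. u (clamped \<gamma> l t))"
      using continuous_on_compose2[OF u continuous_clamped[OF arc]] by auto
    then have F: "continuous_on UNIV ?F" by (intro continuous_intros)
    have ctl': "controls ?F (\<lambda>t. g (clamped \<gamma> l t)) l"
      using ctl unfolding controlled_along_def controls_def by auto
    have "controls (\<lambda>t. ?e t * ?F t) (\<lambda>t. g (clamped \<gamma> l t) + ennreal (L * \<bar>?F t\<bar>)) l"
    proof (rule controls_product[OF borel_along_curve[OF arc g] borel_measurable_continuous_onI[OF F] _ ctl' _ _ L])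
      show "continuous_on {0..l} ?F" using F continuous_on_subset by auto
      show "0 \<le> ?e t \<and> ?e t \<le> 1" for t using \<eta>(1) by auto
      show "\<bar>?e s - ?e t\<bar> \<le> L * (t - s)" if "0 \<le> s" "s \<le> t" "t \<le> l" for s t
      proof -
        have "\<bar>?e s - ?e t\<bar> \<le> L * dist (\<gamma> s) (\<gamma> t)" using that \<eta>(2)[of "\<gamma> s" "\<gamma> t"] by simp
        also have "\<dots> \<le> L * (t - s)"
          using arc_length_curve_lipschitz[OF arc that] L by (rule mult_left_mono)
        finally show ?thesis .
      qed
    qed
    then show "controlled_along (\<lambda>x. \<eta> x * (u x - c)) (\<lambda>x. g x + ennreal (L * \<bar>u x - c\<bar>)) \<gamma> l"
      unfolding controlled_along_def by (subst controls_cong[of l _ "\<lambda>t. ?e t * ?F t"]) auto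
  qed
  with m show ?thesis by (simp add: wug_iff_controlled)
qed

lemma wug_cong_increments:
  assumes "weak_upper_gradient p M (\<lambda>x. ereal (u x)) g" "\<And>x y. \<bar>v x - v y\<bar> = \<bar>u x - u y\<bar>"
  shows "weak_upper_gradient p M (\<lambda>x. ereal (v x)) g"
  using assms unfolding weak_upper_gradient_def e2ennreal_ereal_diff by simp

end


section \<open>The Caccioppoli inequality\<close>

context metric_measure
begin

lemma is_minimal_wug_le:
  assumes "is_minimal_wug p M u g" "weak_upper_gradient p M u h" "Lp_loc p M h"
  shows "AE x in M. g x \<le> h x"
  using assms unfolding is_minimal_wug_def by blast

lemma bounded_in_ball:
  fixes x x0 :: 'a
  obtains n where "ball x s \<subseteq> ball x0 (real n)"
proof -
  obtain n where "dist x0 x + s < real n" using reals_Archimedean2 by blast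
  then have "ball x s \<subseteq> ball x0 (real n)"
  proof (intro subsetI)
    fix z assume "z \<in> ball x s"
    with \<open>dist x0 x + s < real n\<close> show "z \<in> ball x0 (real n)"
      using dist_triangle[of x0 z x] by simp
  qed
  then show ?thesis using that by blast
qed

lemma set_nn_integral_mono_set:
  assumes "A \<subseteq> B" shows "(\<integral>\<^sup>+ x\<in>A. f x \<partial>M) \<le> (\<integral>\<^sup>+ x\<in>B. f x \<partial>M)"
  using assms by (intro nn_integral_mono) (auto split: split_indicator)

lemma epow_add_integral_le:
  assumes [measurable]: "f \<in> borel_measurable M" "h \<in> borel_measurable M" "A \<in> sets M"
  shows "(\<integral>\<^sup>+ x\<in>A. epow (f x + h x) p \<partial>M) \<le>
    ennreal (2 powr p) * ((\<integral>\<^sup>+ x\<in>A. epow (f x) p \<partial>M) + (\<integral>\<^sup>+ x\<in>A. epow (h x) p \<partial>M))"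
proof -
  have "(\<integral>\<^sup>+ x\<in>A. epow (f x + h x) p \<partial>M) \<le>
      (\<integral>\<^sup>+ x. ennreal (2 powr p) * (epow (f x) p * indicator A x + epow (h x) p * indicator A x) \<partial>M)"
    using p by (intro nn_integral_mono) (auto intro!: epow_add_le split: split_indicator)
  also have "\<dots> = ennreal (2 powr p) * ((\<integral>\<^sup>+ x\<in>A. epow (f x) p \<partial>M) + (\<integral>\<^sup>+ x\<in>A. epow (h x) p \<partial>M))"
    by (subst nn_integral_cmult) (auto simp: nn_integral_add)
  finally show ?thesis .
qed

lemma Lp_ball_diff_const:
  assumes "continuous_on UNIV u"
    and fin: "\<And>x s. (\<integral>\<^sup>+ y\<in>ball x s. epow (ennreal \<bar>u y\<bar>) p \<partial>M) < \<infinity>"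
  shows "(\<integral>\<^sup>+ y\<in>ball x s. epow (ennreal \<bar>u y - c\<bar>) p \<partial>M) < \<infinity>"
proof -
  have [measurable]: "u \<in> borel_measurable M"
    using assms(1) by (intro borel_imp_measurable borel_measurable_continuous_onI)
  have "(\<integral>\<^sup>+ y\<in>ball x s. epow (ennreal \<bar>u y - c\<bar>) p \<partial>M) \<le>
      (\<integral>\<^sup>+ y\<in>ball x s. epow (ennreal \<bar>u y\<bar> + ennreal \<bar>c\<bar>) p \<partial>M)"
    using p by (intro nn_integral_mono mult_right_mono epow_mono) (auto simp flip: ennreal_plus)
  also have "\<dots> \<le> ennreal (2 powr p) * ((\<integral>\<^sup>+ y\<in>ball x s. epow (ennreal \<bar>u y\<bar>) p \<partial>M) +
      (\<integral>\<^sup>+ y\<in>ball x s. epow (ennreal \<bar>c\<bar>) p \<partial>M))"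
    by (rule epow_add_integral_le) auto
  also have "\<dots> < \<infinity>"
    using fin[of x s] ball_finite[of x s]
    by (simp add: nn_integral_cmult_indicator ennreal_mult_less_top epow_ennreal)
  finally show ?thesis .
qed

text \<open>
  The hypothesis provides gradients on each bounded open set separately. Gluing makes a global one of
  them, which is \<open>p\<close>-integrable on balls, and the minimal gradient lies below it.
\<close>

lemma quasiharmonic_gradient:
  assumes qh: "quasiharmonic_with p M Q u"
  obtains g where "g \<in> borel_measurable borel" "is_minimal_wug p M (\<lambda>x. ereal (u x)) g"
    "AE x in M. minimal_wug p M (\<lambda>x. ereal (u x)) x = g x"
    "\<And>x s. (\<integral>\<^sup>+ y\<in>ball x s. epow (g y) p \<partial>M) < \<infinity>"
    "\<And>x s. (\<integral>\<^sup>+ y\<in>ball x s. epow (ennreal \<bar>u y\<bar>) p \<partial>M) < \<infinity>"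
proof -
  fix x0 :: 'a
  let ?u = "\<lambda>x. ereal (u x)"
  have N: "?u \<in> N1p p (restrict_space M (ball x0 (real n)))" for n
    using qh by (simp add: quasiharmonic_with_def quasiminimizer_with_def)
  obtain g0 where g0: "g0 \<in> borel_measurable borel" "weak_upper_gradient p M ?u g0"
    "\<And>n. (\<integral>\<^sup>+ x\<in>ball x0 (real n). epow (g0 x) p \<partial>M) < \<infinity>"
    using ex_wug_from_balls[of u x0] N by blast
  have fin0: "(\<integral>\<^sup>+ y\<in>ball x s. epow (g0 y) p \<partial>M) < \<infinity>" for x s
  proof -
    obtain n where "ball x s \<subseteq> ball x0 (real n)" by (rule bounded_in_ball)
    from set_nn_integral_mono_set[OF this] g0(3)[of n] show ?thesis by (rule order_le_less_trans)
  qed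
  have "Lp_loc p M g0"
    unfolding Lp_loc_def using borel_imp_measurable[OF g0(1)] fin0 zero_less_one by blast
  from ex_minimal_wug[OF g0(2) this] obtain g where
    g: "g \<in> borel_measurable borel" "is_minimal_wug p M ?u g" by blast
  have min: "is_minimal_wug p M ?u (minimal_wug p M ?u)"
    by (rule is_minimal_wug_minimal_wug) fact+
  have "AE x in M. minimal_wug p M ?u x \<le> g x" "AE x in M. g x \<le> minimal_wug p M ?u x"
    using g(2) min is_minimal_wug_le unfolding is_minimal_wug_def by blast+
  then have eq: "AE x in M. minimal_wug p M ?u x = g x" by eventually_elim auto
  have "AE x in M. g x \<le> g0 x"
    by (rule is_minimal_wug_le[OF g(2) g0(2)]) fact
  then have le: "(\<integral>\<^sup>+ y\<in>ball x s. epow (g y) p \<partial>M) \<le> (\<integral>\<^sup>+ y\<in>ball x s. epow (g0 y) p \<partial>M)" for x s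
    by (intro nn_integral_mono_AE, eventually_elim) (use p in \<open>auto intro: epow_mono split: split_indicator\<close>)
  have gfin: "(\<integral>\<^sup>+ y\<in>ball x s. epow (g y) p \<partial>M) < \<infinity>" for x s
    using le fin0 by (rule order_le_less_trans)
  have ufin: "(\<integral>\<^sup>+ y\<in>ball x s. epow (ennreal \<bar>u y\<bar>) p \<partial>M) < \<infinity>" for x s
  proof -
    obtain n where n: "ball x s \<subseteq> ball x0 (real n)" by (rule bounded_in_ball)
    have "N1p_norm p (restrict_space M (ball x0 (real n))) ?u < \<infinity>" using N[of n] by (simp add: N1p_def)
    then have "(\<integral>\<^sup>+ x. epow (ennreal \<bar>u x\<bar>) p \<partial>restrict_space M (ball x0 (real n))) < \<infinity>"
      by (simp add: N1p_norm_def)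
    then have "(\<integral>\<^sup>+ y\<in>ball x0 (real n). epow (ennreal \<bar>u y\<bar>) p \<partial>M) < \<infinity>"
      by (subst (asm) nn_integral_restrict_space) auto
    with set_nn_integral_mono_set[OF n] show ?thesis by (rule order_le_less_trans)
  qed
  show ?thesis using that g eq gfin ufin by blast
qed

text \<open>
  The gradient may be cut down to the set where the function does not vanish, so integrability on
  one ball suffices. The function then approximates itself in the closure that defines test functions.
\<close>

lemma compact_support_test_function:
  assumes v: "continuous_on UNIV v" and supp: "\<And>x. x \<notin> ball x0 s \<Longrightarrow> v x = 0"
    and vfin: "(\<integral>\<^sup>+ x\<in>ball x0 s. epow (ennreal \<bar>v x\<bar>) p \<partial>M) < \<infinity>"
    and h: "h \<in> borel_measurable borel" "weak_upper_gradient p M (\<lambda>x. ereal (v x)) h"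
    and hfin: "(\<integral>\<^sup>+ x\<in>ball x0 s. epow (h x) p \<partial>M) < \<infinity>"
  shows "(\<lambda>x. ereal (v x)) \<in> test_functions p M"
proof -
  have vm: "v \<in> borel_measurable M"
    using v by (intro borel_imp_measurable borel_measurable_continuous_onI)
  let ?h = "\<lambda>x. if v x = 0 then 0 else h x"
  have "(\<integral>\<^sup>+ x. epow (?h x) p \<partial>M) \<le> (\<integral>\<^sup>+ x\<in>ball x0 s. epow (h x) p \<partial>M)"
    using supp by (intro nn_integral_mono) (auto split: split_indicator)
  then have "(\<integral>\<^sup>+ x. epow (?h x) p \<partial>M) < \<infinity>" using hfin by (rule order_le_less_trans)
  moreover have "weak_upper_gradient p M (\<lambda>x. ereal (v x)) ?h"
    by (rule wug_off_level_set[OF v h])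
  ultimately have "(INF g\<in>{g. weak_upper_gradient p M (\<lambda>x. ereal (v x)) g}. \<integral>\<^sup>+ x. epow (g x) p \<partial>M) < \<infinity>"
    unfolding INF_less_iff by (intro bexI[of _ ?h] CollectI)
  moreover have "(\<integral>\<^sup>+ x. epow (ennreal \<bar>v x\<bar>) p \<partial>M) = (\<integral>\<^sup>+ x\<in>ball x0 s. epow (ennreal \<bar>v x\<bar>) p \<partial>M)"
    using supp by (intro nn_integral_cong) (auto split: split_indicator)
  ultimately have N: "(\<lambda>x. ereal (v x)) \<in> N1p p M"
    using vm vfin by (simp add: N1p_def N1p_norm_def)
  have e0: "e2ennreal 0 = 0" by (simp add: zero_ereal_def)
  then have "weak_upper_gradient p M (\<lambda>x. 0) (\<lambda>x. 0)"
    unfolding weak_upper_gradient_def ae_curve_iff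
    by (auto simp: zero_ennreal.rep_eq intro!: bexI[of _ "\<lambda>x. 0"])
  then have "(INF g\<in>{g. weak_upper_gradient p M (\<lambda>x. 0) g}. \<integral>\<^sup>+ x. epow (g x) p \<partial>M) \<le> (\<integral>\<^sup>+ x. epow 0 p \<partial>M)"
    by (intro INF_lower) simp
  then have "N1p_norm p M (\<lambda>x. 0) = 0" by (simp add: N1p_norm_def e0)
  moreover have "(\<lambda>x. ereal (v x) - ereal (v x)) = (\<lambda>x. 0)" by (simp add: zero_ereal_def)
  ultimately have "\<forall>\<epsilon>>0. N1p_norm p M (\<lambda>x. ereal (v x) - ereal (v x)) < ennreal \<epsilon>" by simp
  moreover have "\<forall>x. x \<notin> ball x0 s \<longrightarrow> ereal (v x) = 0" using supp by (simp add: zero_ereal_def)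
  ultimately show ?thesis
    unfolding test_functions_def
    by (intro CollectI conjI allI impI N bexI[OF _ N] exI[of _ "ball x0 s"] open_ball bounded_ball) auto
qed

text \<open>
  The test function is \<open>\<eta> (c - u)\<close> with a cutoff \<open>\<eta>\<close> that is 1 on \<open>B\<^sub>r\<close> and positive exactly on
  \<open>B\<^sub>2\<^sub>r\<close>. Adding it to \<open>u\<close> produces the constant \<open>c\<close> on \<open>B\<^sub>r\<close>, so that only the annulus contributes
  on the right. Inside \<open>B\<^sub>2\<^sub>r\<close> the test function vanishes exactly where \<open>u = c\<close>, and there \<open>g\<close> is zero
  almost everywhere: setting it to zero on the level set leaves a weak upper gradient, and \<open>g\<close> is minimal.
\<close>

lemma caccioppoli:
  assumes qh: "quasiharmonic_with p M Q u" and r: "0 < r"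
    and g: "g \<in> borel_measurable borel" "is_minimal_wug p M (\<lambda>x. ereal (u x)) g"
    and eq: "AE x in M. minimal_wug p M (\<lambda>x. ereal (u x)) x = g x"
    and gfin: "\<And>x s. (\<integral>\<^sup>+ y\<in>ball x s. epow (g y) p \<partial>M) < \<infinity>"
    and ufin: "\<And>x s. (\<integral>\<^sup>+ y\<in>ball x s. epow (ennreal \<bar>u y\<bar>) p \<partial>M) < \<infinity>"
  shows "(\<integral>\<^sup>+ x\<in>ball x0 (2 * r). epow (g x) p \<partial>M) \<le> ennreal (Q * 2 powr p) *
    ((\<integral>\<^sup>+ x\<in>ball x0 (2 * r) - ball x0 r. epow (g x) p \<partial>M) +
     ennreal (1 / r powr p) * (\<integral>\<^sup>+ x\<in>ball x0 (2 * r) - ball x0 r. epow (ennreal \<bar>u x - c\<bar>) p \<partial>M))"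
proof -
  let ?u = "\<lambda>x. ereal (u x)" and ?A = "ball x0 (2 * r) - ball x0 r" and ?B = "ball x0 (2 * r)"
  have u: "continuous_on UNIV u" and Q: "1 \<le> Q"
    using qh by (auto simp: quasiharmonic_with_def quasiminimizer_with_def)
  have um: "u \<in> borel_measurable borel" using u by (rule borel_measurable_continuous_onI)
  have wug: "weak_upper_gradient p M ?u g" using g(2) by (simp add: is_minimal_wug_def)
  note [measurable] = borel_imp_measurable[OF um] borel_imp_measurable[OF g(1)]
  define \<eta> where "\<eta> x = max 0 (min 1 (2 - dist x0 x / r))" for x
  have \<eta>01: "0 \<le> \<eta> x \<and> \<eta> x \<le> 1" "0 \<le> 1 - \<eta> x \<and> 1 - \<eta> x \<le> 1" for x by (auto simp: \<eta>_def)
  have \<eta>lip: "\<bar>\<eta> x - \<eta> y\<bar> \<le> 1 / r * dist x y" for x y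
  proof -
    have "\<bar>\<eta> x - \<eta> y\<bar> \<le> \<bar>dist x0 x / r - dist x0 y / r\<bar>" by (auto simp: \<eta>_def)
    also have "\<dots> = \<bar>dist x0 x - dist x0 y\<bar> / r" using r by (simp flip: diff_divide_distrib)
    also have "\<dots> \<le> dist x y / r"
      using r dist_triangle[of x0 x y] dist_triangle[of x0 y x]
      by (intro divide_right_mono) (auto simp: dist_commute)
    finally show ?thesis by simp
  qed
  have \<eta>lip': "\<bar>(1 - \<eta> x) - (1 - \<eta> y)\<bar> \<le> 1 / r * dist x y" for x y
    using \<eta>lip[of x y] by (simp add: abs_minus_commute)
  have \<eta>c: "continuous_on UNIV \<eta>" unfolding \<eta>_def using r by (intro continuous_intros) auto
  have \<eta>0: "\<eta> x = 0 \<longleftrightarrow> x \<notin> ?B" for x using r by (auto simp: \<eta>_def field_simps max_def min_def)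
  have \<eta>1: "\<eta> x = 1" if "x \<in> ball x0 r" for x
  proof -
    have "dist x0 x / r \<le> 1" using that r by simp
    then show ?thesis by (simp add: \<eta>_def)
  qed
  \<comment> \<open>A common gradient for the test function and for its sum with \<open>u\<close>.\<close>
  define g1 where "g1 x = g x + ennreal (1 / r * \<bar>u x - c\<bar>)" for x
  have g1: "g1 \<in> borel_measurable borel" unfolding g1_def using g(1) um by measurable
  have g1_le: "(\<integral>\<^sup>+ x\<in>A. epow (g1 x) p \<partial>M) \<le> ennreal (2 powr p) *
      ((\<integral>\<^sup>+ x\<in>A. epow (g x) p \<partial>M) + ennreal (1 / r powr p) * (\<integral>\<^sup>+ x\<in>A. epow (ennreal \<bar>u x - c\<bar>) p \<partial>M))"
    if [measurable]: "A \<in> sets M" for A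
  proof -
    have "epow (ennreal (1 / r * \<bar>u x - c\<bar>)) p = ennreal (1 / r powr p) * epow (ennreal \<bar>u x - c\<bar>) p" for x
      using r by (simp add: epow_ennreal powr_divide powr_mult flip: ennreal_mult)
    then have "(\<integral>\<^sup>+ x\<in>A. epow (ennreal (1 / r * \<bar>u x - c\<bar>)) p \<partial>M) =
        ennreal (1 / r powr p) * (\<integral>\<^sup>+ x\<in>A. epow (ennreal \<bar>u x - c\<bar>) p \<partial>M)"
      by (simp add: mult.assoc nn_integral_cmult)
    with epow_add_integral_le[of g "\<lambda>x. ennreal (1 / r * \<bar>u x - c\<bar>)" A] show ?thesis
      by (simp add: g1_def)
  qed
  have g1fin: "(\<integral>\<^sup>+ x\<in>ball y s. epow (g1 x) p \<partial>M) < \<infinity>" for y s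
  proof (rule order_le_less_trans[OF g1_le])
    show "ennreal (2 powr p) * ((\<integral>\<^sup>+ x\<in>ball y s. epow (g x) p \<partial>M) +
        ennreal (1 / r powr p) * (\<integral>\<^sup>+ x\<in>ball y s. epow (ennreal \<bar>u x - c\<bar>) p \<partial>M)) < \<infinity>"
      using gfin[of y s] Lp_ball_diff_const[OF u ufin, where x=y and s=s and c=c] by (simp add: ennreal_mult_less_top)
  qed simp
  define \<phi> where "\<phi> x = \<eta> x * (c - u x)" for x
  have \<phi>c: "continuous_on UNIV \<phi>" unfolding \<phi>_def by (intro continuous_intros \<eta>c u)
  have "weak_upper_gradient p M (\<lambda>x. ereal (\<eta> x * (u x - c))) g1"
    unfolding g1_def using r by (intro wug_cutoff_product[OF u g(1) wug \<eta>01(1) \<eta>lip]) auto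
  then have \<phi>wug: "weak_upper_gradient p M (\<lambda>x. ereal (\<phi> x)) g1"
    by (rule wug_cong_increments) (simp add: \<phi>_def algebra_simps abs_minus_commute)
  have "\<phi> x = 0" if "x \<notin> ?B" for x using that \<eta>0 by (simp add: \<phi>_def)
  moreover have "(\<integral>\<^sup>+ x\<in>?B. epow (ennreal \<bar>\<phi> x\<bar>) p \<partial>M) < \<infinity>"
  proof (rule order_le_less_trans[OF _ Lp_ball_diff_const[OF u ufin, where x=x0 and s="2 * r" and c=c]])
    have "\<bar>\<phi> x\<bar> \<le> 1 * \<bar>u x - c\<bar>" for x
      unfolding \<phi>_def abs_mult using \<eta>01(1)[of x] by (intro mult_mono) auto
    then show "(\<integral>\<^sup>+ x\<in>?B. epow (ennreal \<bar>\<phi> x\<bar>) p \<partial>M) \<le> (\<integral>\<^sup>+ x\<in>?B. epow (ennreal \<bar>u x - c\<bar>) p \<partial>M)"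
      using p by (intro nn_integral_mono mult_right_mono epow_mono ennreal_leI) auto
  qed
  ultimately have \<phi>test: "(\<lambda>x. ereal (\<phi> x)) \<in> test_functions p M"
    using compact_support_test_function[OF \<phi>c _ _ g1 \<phi>wug] g1fin by blast
  define w where "w x = u x + \<phi> x" for x
  have w_eq: "w x = (1 - \<eta> x) * (u x - c) + c" for x by (simp add: w_def \<phi>_def algebra_simps)
  have wc: "continuous_on UNIV w" unfolding w_def by (intro continuous_intros u \<phi>c)
  have "weak_upper_gradient p M (\<lambda>x. ereal ((1 - \<eta> x) * (u x - c))) g1"
    unfolding g1_def using r by (intro wug_cutoff_product[OF u g(1) wug \<eta>01(2) \<eta>lip']) auto
  then have "weak_upper_gradient p M (\<lambda>x. ereal (w x)) g1"
    by (rule wug_cong_increments) (simp add: w_eq)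
  then have wwug: "weak_upper_gradient p M (\<lambda>x. ereal (w x)) (\<lambda>x. if w x = c then 0 else g1 x)" 
    (is "weak_upper_gradient _ _ _ ?h")
    by (rule wug_off_level_set[OF wc g1])
  have "Lp_loc p M g1"
    unfolding Lp_loc_def using borel_imp_measurable[OF g1] g1fin zero_less_one by blast
  then have hloc: "Lp_loc p M ?h"
    by (rule Lp_loc_mono) (use wwug in \<open>auto simp: weak_upper_gradient_def\<close>)
  have "AE x in M. minimal_wug p M (\<lambda>x. ereal (w x)) x \<le> ?h x"
    by (rule is_minimal_wug_le[OF is_minimal_wug_minimal_wug[OF wwug hloc] wwug hloc])
  then have "(\<integral>\<^sup>+ x\<in>{x. \<phi> x \<noteq> 0}. epow (minimal_wug p M (\<lambda>x. ereal (w x)) x) p \<partial>M) \<le>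
      (\<integral>\<^sup>+ x\<in>?A. epow (g1 x) p \<partial>M)"
  proof (intro nn_integral_mono_AE, eventually_elim)
    case (elim x)
    have "epow (minimal_wug p M (\<lambda>x. ereal (w x)) x) p \<le> epow (?h x) p"
      using elim p by (intro epow_mono) auto
    moreover have "x \<in> ?A" if "\<phi> x \<noteq> 0" "w x \<noteq> c"
    proof -
      have "x \<in> ?B" using that(1) \<eta>0[of x] by (auto simp: \<phi>_def)
      moreover have "x \<notin> ball x0 r" using that(2) \<eta>1[of x] by (auto simp: w_eq)
      ultimately show ?thesis by blast
    qed
    ultimately show ?case by (cases "\<phi> x \<noteq> 0 \<and> w x \<noteq> c") (auto split: split_indicator)
  qed
  note rhs = order_trans[OF this g1_le]
  have "Lp_loc p M (\<lambda>x. if u x = c then 0 else g x)"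
  proof (rule Lp_loc_mono[of g])
    show "Lp_loc p M g" using g(2) unfolding is_minimal_wug_def by blast
  qed auto
  then have g_off: "AE x in M. g x \<le> (if u x = c then 0 else g x)"
    by (rule is_minimal_wug_le[OF g(2) wug_off_level_set[OF u g(1) wug]])
  have "AE x in M. epow (g x) p * indicator ?B x \<le> epow (minimal_wug p M ?u x) p * indicator {x. \<phi> x \<noteq> 0} x"
    using eq g_off
  proof eventually_elim
    case (elim x)
    show ?case
    proof (cases "x \<in> ?B \<and> u x \<noteq> c")
      case True
      then have "\<phi> x \<noteq> 0" using \<eta>0[of x] by (simp add: \<phi>_def)
      then show ?thesis using elim(1) by (auto split: split_indicator)
    qed (use elim(2) in \<open>auto split: split_indicator\<close>)
  qed
  then have "(\<integral>\<^sup>+ x\<in>?B. epow (g x) p \<partial>M) \<le>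
      (\<integral>\<^sup>+ x\<in>{x. \<phi> x \<noteq> 0}. epow (minimal_wug p M ?u x) p \<partial>M)"
    by (rule nn_integral_mono_AE)
  also have "\<dots> \<le> ennreal Q * (\<integral>\<^sup>+ x\<in>{x. \<phi> x \<noteq> 0}. epow (minimal_wug p M (\<lambda>x. ereal (w x)) x) p \<partial>M)"
  proof -
    have "{x. ereal (\<phi> x) \<noteq> 0} = {x. \<phi> x \<noteq> 0}" by (simp add: zero_ereal_def)
    moreover have "(\<lambda>y. ereal (u y) + ereal (\<phi> y)) = (\<lambda>x. ereal (w x))" by (simp add: w_def)
    moreover have "\<forall>\<phi>\<in>test_functions p M.
        (\<integral>\<^sup>+ x\<in>{x. \<phi> x \<noteq> 0}. epow (minimal_wug p M ?u x) p \<partial>M)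
          \<le> ennreal Q * (\<integral>\<^sup>+ x\<in>{x. \<phi> x \<noteq> 0}. epow (minimal_wug p M (\<lambda>y. ?u y + \<phi> y) x) p \<partial>M)"
      using qh by (simp add: quasiharmonic_with_def quasiminimizer_with_def)
    from bspec[OF this \<phi>test] show ?thesis unfolding calculation .
  qed
  also have "\<dots> \<le> ennreal Q * (ennreal (2 powr p) * ((\<integral>\<^sup>+ x\<in>?A. epow (g x) p \<partial>M) +
      ennreal (1 / r powr p) * (\<integral>\<^sup>+ x\<in>?A. epow (ennreal \<bar>u x - c\<bar>) p \<partial>M)))"
    by (intro mult_left_mono rhs) auto
  also have "\<dots> = ennreal (Q * 2 powr p) * ((\<integral>\<^sup>+ x\<in>?A. epow (g x) p \<partial>M) +
      ennreal (1 / r powr p) * (\<integral>\<^sup>+ x\<in>?A. epow (ennreal \<bar>u x - c\<bar>) p \<partial>M))"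
    using Q by (simp add: ennreal_mult mult.assoc)
  finally show ?thesis .
qed

end


section \<open>The Poincare inequality on annuli\<close>

text \<open>
  Adding \<open>t\<close> to a partition of \<open>[t', b]\<close> that starts at \<open>t'\<close> adds the distance of the two points to its
  length.
\<close>

lemma curve_length_cut_le:
  assumes "t \<le> t'" "t' \<le> b" "curve_length \<gamma> t b \<le> ennreal (dist (\<gamma> t) (\<gamma> t') + q)" "0 \<le> q"
  shows "curve_length \<gamma> t' b \<le> ennreal q"
  unfolding curve_length_def
proof (rule SUP_least)
  fix ts :: "real list" assume ts: "ts \<in> {ts. sorted ts \<and> set ts \<subseteq> {t'..b}}"
  let ?\<Sigma> = "\<lambda>ts. \<Sum>i<length ts - 1. ennreal (dist (\<gamma> (ts ! i)) (\<gamma> (ts ! Suc i)))"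
  have "?\<Sigma> ts \<le> ?\<Sigma> (t' # ts)"
    by (cases ts) (simp_all add: sum.lessThan_Suc_shift del: sum.lessThan_Suc)
  then have "ennreal (dist (\<gamma> t) (\<gamma> t')) + ?\<Sigma> ts \<le> ?\<Sigma> (t # t' # ts)"
    by (simp add: sum.lessThan_Suc_shift add_left_mono del: sum.lessThan_Suc)
  also have "\<dots> \<le> curve_length \<gamma> t b"
    unfolding curve_length_def using ts assms(1,2) by (intro SUP_upper) (auto intro: order_trans)
  also have "\<dots> \<le> ennreal (dist (\<gamma> t) (\<gamma> t')) + ennreal q"
    using assms(3,4) by simp
  finally show "?\<Sigma> ts \<le> ennreal q" by (simp add: ennreal_add_left_cancel_le)
qed

text \<open>
  A curve of length at most \<open>n s\<close> can be divided into \<open>n + 1\<close> arcs with endpoints at distance at most \<open>s\<close>: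
  the intermediate value theorem cuts off an initial arc whose endpoints have distance exactly \<open>s\<close>, and
  this arc uses up at least \<open>s\<close> of the length. The number of steps depends on the length only, not on
  the modulus of continuity.
\<close>

lemma chain_along_curve:
  fixes \<gamma> :: "real \<Rightarrow> 'a::metric_space" and U :: "'a \<Rightarrow> real"
  assumes \<gamma>: "continuous_on {0..1} \<gamma>" "\<gamma> ` {0..1} \<subseteq> S" and s: "0 < s"
    and step: "\<And>x y. x \<in> S \<Longrightarrow> y \<in> S \<Longrightarrow> dist x y \<le> s \<Longrightarrow> \<bar>U x - U y\<bar> \<le> d"
    and t: "0 \<le> t" "t \<le> 1" and len: "curve_length \<gamma> t 1 \<le> ennreal (real n * s)"
  shows "\<bar>U (\<gamma> t) - U (\<gamma> 1)\<bar> \<le> (real n + 1) * d"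
  using t len
proof (induction n arbitrary: t)
  case 0
  have "ennreal (dist (\<gamma> t) (\<gamma> 1)) \<le> curve_length \<gamma> t 1"
    unfolding curve_length_def using 0 by (intro SUP_upper2[of "[t, 1]"]) auto
  then have "dist (\<gamma> t) (\<gamma> 1) \<le> s" using 0 s by (auto dest: order_trans)
  moreover have "\<gamma> t \<in> S" "\<gamma> 1 \<in> S" using \<gamma>(2) 0 by auto
  ultimately show ?case using step by simp
next
  case (Suc n)
  have inS: "\<gamma> \<tau> \<in> S" if "0 \<le> \<tau>" "\<tau> \<le> 1" for \<tau> using \<gamma>(2) that by auto
  have "\<bar>U (\<gamma> t) - U (\<gamma> t)\<bar> \<le> d" using Suc.prems s by (intro step inS) auto
  then have d: "0 \<le> d" by simp
  show ?case
  proof (cases "dist (\<gamma> t) (\<gamma> 1) \<le> s")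
    case True
    then have "\<bar>U (\<gamma> t) - U (\<gamma> 1)\<bar> \<le> d" using Suc.prems by (intro step inS) auto
    also have "\<dots> \<le> (real (Suc n) + 1) * d" using d by (simp add: algebra_simps)
    finally show ?thesis .
  next
    case False
    have "continuous_on {t..1} (\<lambda>\<tau>. dist (\<gamma> t) (\<gamma> \<tau>))"
      using \<gamma>(1) Suc.prems by (intro continuous_intros) (auto intro: continuous_on_subset)
    then obtain t' where t': "t \<le> t'" "t' \<le> 1" "dist (\<gamma> t) (\<gamma> t') = s"
      using IVT'[of "\<lambda>\<tau>. dist (\<gamma> t) (\<gamma> \<tau>)" t s 1] False s Suc.prems by auto
    have "curve_length \<gamma> t' 1 \<le> ennreal (real n * s)"
      using t' Suc.prems s by (intro curve_length_cut_le[of t t']) (auto simp: algebra_simps)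
    then have "\<bar>U (\<gamma> t') - U (\<gamma> 1)\<bar> \<le> (real n + 1) * d"
      using t' Suc.prems by (intro Suc.IH) auto
    moreover have "\<bar>U (\<gamma> t) - U (\<gamma> t')\<bar> \<le> d" using t' Suc.prems by (intro step inS) auto
    ultimately show ?thesis by (simp add: algebra_simps)
  qed
qed

context metric_measure
begin

definition average :: "('a \<Rightarrow> real) \<Rightarrow> 'a \<Rightarrow> real \<Rightarrow> real" where
  "average u x s = (LINT y:ball x s|M. u y) / measure M (ball x s)"

definition energy :: "('a \<Rightarrow> ennreal) \<Rightarrow> 'a set \<Rightarrow> real" where
  "energy g A = enn2real (\<integral>\<^sup>+ y\<in>A. epow (g y) p \<partial>M)"

lemma ball_fmeasurable [simp]: "ball x s \<in> fmeasurable M"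
  using ball_finite[of x s] by (auto intro: fmeasurableI)

lemma emeasure_ball: "emeasure M (ball x s) = ennreal (measure M (ball x s))"
  using ball_finite[of x s] by (intro emeasure_eq_ennreal_measure) auto

lemma measure_ball_pos: "0 < s \<Longrightarrow> 0 < measure M (ball x s)"
  using ball_pos[of s x] by (simp add: emeasure_ball)

lemma measure_ball_mono: "ball x s \<subseteq> ball y t \<Longrightarrow> measure M (ball x s) \<le> measure M (ball y t)"
  by (intro measure_mono_fmeasurable) auto

text \<open>
  By separability this open set is a countable union of products of balls, with centres in a countable
  dense set and one of the radii rational.
\<close>

lemma dist_less_sets_pair:
  "{z \<in> space (M \<Otimes>\<^sub>M M). dist (fst z) (snd z) < s} \<in> sets (M \<Otimes>\<^sub>M M)"
proof -
  obtain D :: "'a set" where D: "countable D" "\<And>x e. 0 < e \<Longrightarrow> \<exists>d\<in>D. dist x d < e"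
    using ex_countable_dense by blast
  have "{z \<in> space (M \<Otimes>\<^sub>M M). dist (fst z) (snd z) < s} = (\<Union>d\<in>D. \<Union>q\<in>\<rat>. ball d q \<times> ball d (s - q))"
  proof (intro equalityI subsetI)
    fix z assume "z \<in> {z \<in> space (M \<Otimes>\<^sub>M M). dist (fst z) (snd z) < s}"
    then have lt: "dist (fst z) (snd z) < s" by simp
    obtain q where q: "q \<in> \<rat>" "0 < q" "q < (s - dist (fst z) (snd z)) / 2"
      using Rats_dense_in_real[of 0 "(s - dist (fst z) (snd z)) / 2"] lt by auto
    obtain d where d: "d \<in> D" "dist (fst z) d < q" using D(2) q by blast
    have "dist d (snd z) < s - q"
      using q d dist_triangle[of d "snd z" "fst z"] by (simp add: dist_commute field_simps)
    with q d show "z \<in> (\<Union>d\<in>D. \<Union>q\<in>\<rat>. ball d q \<times> ball d (s - q))"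
      by (cases z) (auto simp: dist_commute)
  next
    fix z assume "z \<in> (\<Union>d\<in>D. \<Union>q\<in>\<rat>. ball d q \<times> ball d (s - q))"
    then obtain d q where "fst z \<in> ball d q" "snd z \<in> ball d (s - q)" by auto
    then have "dist (fst z) (snd z) < s"
      using dist_triangle[of "fst z" "snd z" d] by (auto simp: dist_commute)
    then show "z \<in> {z \<in> space (M \<Otimes>\<^sub>M M). dist (fst z) (snd z) < s}" by (simp add: space_pair_measure)
  qed
  also have "\<dots> \<in> sets (M \<Otimes>\<^sub>M M)"
    using D(1) countable_rat by (intro sets.countable_UN'' pair_measureI) auto
  finally show ?thesis .
qed

lemma ball_integral_measurable:
  assumes [measurable]: "f \<in> borel_measurable M"
  shows "(\<lambda>x. \<integral>\<^sup>+ y\<in>ball x s. f y \<partial>M) \<in> borel_measurable M"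
proof -
  interpret sigma_finite_measure M by (rule sigma_finite_M)
  note [measurable] = dist_less_sets_pair[of s]
  let ?Z = "{z \<in> space (M \<Otimes>\<^sub>M M). dist (fst z) (snd z) < s}"
  have "(\<lambda>(x, y). f y * indicator ?Z (x, y)) \<in> borel_measurable (M \<Otimes>\<^sub>M M)" by measurable
  then have "(\<lambda>x. \<integral>\<^sup>+ y. f y * indicator ?Z (x, y) \<partial>M) \<in> borel_measurable M"
    by (rule borel_measurable_nn_integral)
  also have "(\<lambda>x. \<integral>\<^sup>+ y. f y * indicator ?Z (x, y) \<partial>M) = (\<lambda>x. \<integral>\<^sup>+ y\<in>ball x s. f y \<partial>M)"
    by (intro ext nn_integral_cong) (auto simp: space_pair_measure split: split_indicator)
  finally show ?thesis .
qed

lemma ball_measure_measurable: "(\<lambda>x. emeasure M (ball x s)) \<in> borel_measurable M"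
proof -
  have "(\<lambda>x. \<integral>\<^sup>+ y\<in>ball x s. 1 \<partial>M) \<in> borel_measurable M"
    by (rule ball_integral_measurable) simp
  then show ?thesis by simp
qed

text \<open>
  Averaging over balls of a fixed radius is bounded on \<open>L\<^sup>1\<close>: exchange the integrals and compare
  \<open>\<mu>(B(x,s))\<close> with \<open>\<mu>(B(y,s))\<close> for \<open>y \<in> B(x,s)\<close> by doubling.
\<close>

lemma integral_ball_average_le:
  assumes D: "0 \<le> D" "\<And>x. measure M (ball x (2 * s)) \<le> D * measure M (ball x s)" and s: "0 < s"
    and f[measurable]: "f \<in> borel_measurable M" and A[measurable]: "A \<in> sets M" "A' \<in> sets M"
    and sub: "\<And>x. x \<in> A \<Longrightarrow> ball x s \<subseteq> A'"
  shows "(\<integral>\<^sup>+ x\<in>A. ((\<integral>\<^sup>+ y\<in>ball x s. f y \<partial>M) / emeasure M (ball x s)) \<partial>M) \<le>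
    ennreal D * (\<integral>\<^sup>+ y\<in>A'. f y \<partial>M)"
proof -
  interpret pair_sigma_finite M M
    using sigma_finite_M by (simp add: pair_sigma_finite_def)
  note [measurable] = dist_less_sets_pair[of s] ball_measure_measurable[of s]
  let ?Z = "{z \<in> space (M \<Otimes>\<^sub>M M). dist (fst z) (snd z) < s}"
  let ?k = "\<lambda>x y. indicator A x * (1 / emeasure M (ball x s)) * (f y * indicator ?Z (x, y)) :: ennreal"
  have Z: "indicator ?Z (x, y) = (indicator (ball x s) y :: ennreal)" for x y
    by (auto simp: space_pair_measure split: split_indicator)
  have Z': "indicator ?Z (x, y) = (indicator (ball y s) x :: ennreal)" for x y
    by (auto simp: space_pair_measure dist_commute split: split_indicator)
  have [measurable]: "(\<lambda>(x, y). ?k x y) \<in> borel_measurable (M \<Otimes>\<^sub>M M)"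
    unfolding divide_ennreal_def by measurable
  have "(\<integral>\<^sup>+ x\<in>A. ((\<integral>\<^sup>+ y\<in>ball x s. f y \<partial>M) / emeasure M (ball x s)) \<partial>M) =
      (\<integral>\<^sup>+ x. \<integral>\<^sup>+ y. ?k x y \<partial>M \<partial>M)"
    unfolding Z by (intro nn_integral_cong, subst nn_integral_cmult)
      (auto simp: divide_ennreal_def mult_ac)
  also have "\<dots> = (\<integral>\<^sup>+ y. \<integral>\<^sup>+ x. ?k x y \<partial>M \<partial>M)"
    by (rule Fubini') measurable
  also have "\<dots> \<le> (\<integral>\<^sup>+ y. ennreal D * (f y * indicator A' y) \<partial>M)"
  proof (rule nn_integral_mono)
    fix y
    let ?m = "emeasure M (ball y s)"
    have m: "?m \<noteq> 0" "?m \<noteq> top" using ball_pos[OF s, of y] ball_finite[of y s] by auto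
    have "?k x y \<le> f y * indicator A' y * (ennreal D / ?m) * indicator (ball y s) x" for x
    proof (cases "x \<in> A \<and> dist x y < s")
      case True
      then have "y \<in> A'" using sub[of x] by auto
      have "ball y s \<subseteq> ball x (2 * s)"
      proof
        fix z assume "z \<in> ball y s"
        then show "z \<in> ball x (2 * s)" using True dist_triangle[of x z y] by simp
      qed
      then have "measure M (ball y s) \<le> D * measure M (ball x s)"
        using D(2)[of x] measure_ball_mono order_trans by blast
      then have "1 / measure M (ball x s) \<le> D / measure M (ball y s)"
        using measure_ball_pos[OF s, of x] measure_ball_pos[OF s, of y] by (simp add: field_simps)
      then have "1 / emeasure M (ball x s) \<le> ennreal D / ?m"
        using measure_ball_pos[OF s, of x] measure_ball_pos[OF s, of y] D(1)
        by (simp add: emeasure_ball divide_ennreal ennreal_leI flip: ennreal_1)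
      then show ?thesis using True \<open>y \<in> A'\<close>
        by (simp add: Z' dist_commute mult.commute mult_left_mono)
    next
      case False
      then show ?thesis unfolding Z' by (auto simp: dist_commute split: split_indicator)
    qed
    then have "(\<integral>\<^sup>+ x. ?k x y \<partial>M) \<le>
        (\<integral>\<^sup>+ x. f y * indicator A' y * (ennreal D / ?m) * indicator (ball y s) x \<partial>M)"
      by (intro nn_integral_mono)
    also have "\<dots> = f y * indicator A' y * (ennreal D / ?m) * ?m"
      by (simp add: nn_integral_cmult_indicator)
    also have "\<dots> = (ennreal D / ?m * ?m) * (f y * indicator A' y)"
      by (simp add: mult_ac)
    also have "ennreal D / ?m * ?m = ennreal D"
      using ennreal_mult_divide_eq[OF m, of "ennreal D"] ennreal_times_divide[of ?m "ennreal D" ?m]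
      by (simp only: mult.commute)
    finally show "(\<integral>\<^sup>+ x. ?k x y \<partial>M) \<le> ennreal D * (f y * indicator A' y)" .
  qed
  also have "\<dots> = ennreal D * (\<integral>\<^sup>+ y\<in>A'. f y \<partial>M)"
    by (rule nn_integral_cmult) measurable
  finally show ?thesis .
qed

end


text \<open>
  The number \<open>2 powr (1 / p - 1)\<close> is the ratio of the geometric series that bounds the telescoping sum.
\<close>

definition tele_const :: "real \<Rightarrow> real \<Rightarrow> real \<Rightarrow> real" where
  "tele_const p D C = (D * C / (1 - 2 powr (1 / p - 1))) powr p"

text \<open>
  With \<open>\<epsilon> = 1/(4 \<Lambda> L)\<close>, balls of radius \<open>2 \<Lambda> \<epsilon> r\<close> about points at distance at least \<open>r/L\<close> from \<open>x0\<close> stay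
  away from \<open>x0\<close>. A connecting curve needs about \<open>4 L / \<epsilon>\<close> steps of size \<open>\<epsilon> r\<close>, and \<open>2\<^sup>j \<epsilon> \<ge> L + 2\<close> for the
  exponent \<open>j\<close> below.
\<close>

definition annulus_const :: "real \<Rightarrow> real \<Rightarrow> real \<Rightarrow> real \<Rightarrow> real \<Rightarrow> real" where
  "annulus_const p D C \<Lambda> L =
     (let \<epsilon> = 1 / (4 * \<Lambda> * L); n = nat \<lceil>4 * L / \<epsilon>\<rceil>; j = nat \<lceil>(L + 2) / \<epsilon>\<rceil> in
      2 powr p * (tele_const p D C * \<epsilon> powr p * (2 * D) +
        ((real n + 1) * (4 * D\<^sup>2 * C * \<epsilon>)) powr p * D ^ j))"

text \<open>
  The Poincare inequality for one fixed pair of a continuous function and a gradient, in terms of real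
  numbers. The constants \<open>D\<close>, \<open>C\<close> and \<open>\<Lambda>\<close> come from the space; keeping them apart from \<open>u\<close> and \<open>g\<close> shows that
  the final constants do not depend on \<open>u\<close>.
\<close>

locale poincare_pair = metric_measure M p
  for M :: "'a::metric_space measure" and p :: real +
  fixes D C \<Lambda> :: real and u :: "'a \<Rightarrow> real" and g :: "'a \<Rightarrow> ennreal"
  assumes D: "1 \<le> D" "\<And>x s. 0 < s \<Longrightarrow> measure M (ball x (2 * s)) \<le> D * measure M (ball x s)"
    and C: "0 < C" and \<Lambda>: "1 \<le> \<Lambda>"
    and u: "continuous_on UNIV u" "\<And>x s. set_integrable M (ball x s) u"
    and g: "g \<in> borel_measurable borel" "\<And>x s. (\<integral>\<^sup>+ y\<in>ball x s. epow (g y) p \<partial>M) < \<infinity>"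
    and poincare: "\<And>x s. 0 < s \<Longrightarrow> (LINT y:ball x s|M. \<bar>u y - average u x s\<bar>) \<le>
      measure M (ball x s) *
        (C * s * (energy g (ball x (\<Lambda> * s)) / measure M (ball x (\<Lambda> * s))) powr (1 / p))"
begin

definition mean_energy :: "'a \<Rightarrow> real \<Rightarrow> real" where
  "mean_energy x s = energy g (ball x s) / measure M (ball x s)"

lemma energy_nonneg: "0 \<le> energy g A"
  by (simp add: energy_def)

lemma mean_energy_nonneg: "0 \<le> mean_energy x s"
  by (simp add: mean_energy_def energy_nonneg)

lemma energy_mono:
  assumes "A \<subseteq> B" "B \<subseteq> ball x s" shows "energy g A \<le> energy g B"
  unfolding energy_def
proof (rule enn2real_mono)
  show "(\<integral>\<^sup>+ y\<in>A. epow (g y) p \<partial>M) \<le> (\<integral>\<^sup>+ y\<in>B. epow (g y) p \<partial>M)"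
    by (rule set_nn_integral_mono_set) fact
  show "(\<integral>\<^sup>+ y\<in>B. epow (g y) p \<partial>M) < top"
    using order_le_less_trans[OF set_nn_integral_mono_set[OF assms(2)] g(2)] by simp
qed

lemma ennreal_energy:
  assumes "B \<subseteq> ball x s" shows "ennreal (energy g B) = (\<integral>\<^sup>+ y\<in>B. epow (g y) p \<partial>M)"
  unfolding energy_def
  using order_le_less_trans[OF set_nn_integral_mono_set[OF assms] g(2)] by simp

lemma doubling_power: "0 < s \<Longrightarrow> measure M (ball x (2 ^ j * s)) \<le> D ^ j * measure M (ball x s)"
proof (induction j)
  case (Suc j)
  have "measure M (ball x (2 ^ Suc j * s)) \<le> D * measure M (ball x (2 ^ j * s))"
    using D(2)[of "2 ^ j * s" x] Suc.prems by (simp add: mult.assoc)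
  also have "\<dots> \<le> D * (D ^ j * measure M (ball x s))"
    using Suc D(1) by (intro mult_left_mono) auto
  finally show ?case by (simp add: mult_ac)
qed simp

lemma set_integrable_const: "set_integrable M (ball x s) (\<lambda>y. c :: real)"
  unfolding set_integrable_def using ball_finite[of x s] by simp

lemma average_diff:
  assumes "0 < s" shows "average u x s - c = (LINT y:ball x s|M. u y - c) / measure M (ball x s)"
proof -
  have "(LINT y:ball x s|M. c) = c * measure M (ball x s)"
    unfolding set_lebesgue_integral_def by simp
  then show ?thesis
    using measure_ball_pos[OF assms, of x]
    by (simp add: average_def set_integral_diff[OF u(2) set_integrable_const] field_simps)
qed

lemma average_diff_le:
  assumes "0 < s"
  shows "\<bar>average u x s - c\<bar> \<le> (LINT y:ball x s|M. \<bar>u y - c\<bar>) / measure M (ball x s)"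
proof -
  have "\<bar>LINT y:ball x s|M. u y - c\<bar> \<le> (LINT y:ball x s|M. \<bar>u y - c\<bar>)"
    unfolding set_lebesgue_integral_def
    by (rule order_trans[OF integral_abs_bound]) (simp add: abs_mult)
  then show ?thesis
    unfolding average_diff[OF assms] using measure_ball_pos[OF assms, of x]
    by (simp add: divide_right_mono)
qed

text \<open>
  On the smaller ball the mean oscillation about the average over the larger one grows at most by the
  ratio \<open>k\<close> of the measures.
\<close>

lemma average_subball:
  assumes "0 < s" "0 < t" "ball y t \<subseteq> ball x s" "measure M (ball x s) \<le> k * measure M (ball y t)"
  shows "\<bar>average u y t - average u x s\<bar> \<le> k * (C * s * mean_energy x (\<Lambda> * s) powr (1 / p))"
proof -
  let ?c = "average u x s" and ?R = "C * s * mean_energy x (\<Lambda> * s) powr (1 / p)"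
  have int: "set_integrable M (ball x s) (\<lambda>y. \<bar>u y - ?c\<bar>)"
    by (intro set_integrable_abs set_integral_diff u set_integrable_const)
  have R: "0 \<le> ?R" using C assms by simp
  have m: "0 < measure M (ball y t)" using assms by (simp add: measure_ball_pos)
  have "(LINT z:ball y t|M. \<bar>u z - ?c\<bar>) \<le> (LINT z:ball x s|M. \<bar>u z - ?c\<bar>)"
    unfolding set_lebesgue_integral_def
    using int set_integrable_subset[OF int _ assms(3)] assms(3)
    by (intro integral_mono) (auto simp: set_integrable_def split: split_indicator)
  also have "\<dots> \<le> measure M (ball x s) * ?R"
    using poincare[OF assms(1)] by (simp add: mean_energy_def)
  also have "\<dots> \<le> (k * measure M (ball y t)) * ?R"
    using R assms(4) by (intro mult_right_mono)
  finally have "(LINT z:ball y t|M. \<bar>u z - ?c\<bar>) / measure M (ball y t) \<le> k * ?R"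
    using m by (simp add: divide_le_eq mult_ac)
  with average_diff_le[OF assms(2)] show ?thesis by (rule order_trans)
qed

lemma average_tendsto:
  assumes "0 < s" shows "(\<lambda>i. average u x (s / 2 ^ i)) \<longlonglongrightarrow> u x"
proof (rule LIMSEQ_I)
  fix e :: real assume "0 < e"
  then obtain d where d: "0 < d" "\<And>y. dist y x < d \<Longrightarrow> dist (u y) (u x) < e / 2"
    using u(1) unfolding continuous_on_iff by (metis UNIV_I half_gt_zero)
  have "(\<lambda>i. s * (1 / 2) ^ i) \<longlonglongrightarrow> s * 0"
    by (intro tendsto_mult tendsto_const LIMSEQ_realpow_zero) auto
  then have "(\<lambda>i. s / 2 ^ i) \<longlonglongrightarrow> 0" by (simp add: power_one_over)
  from LIMSEQ_D[OF this d(1)] obtain N where "\<forall>i\<ge>N. norm (s / 2 ^ i - 0) < d" by blast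
  then have N: "\<And>i. N \<le> i \<Longrightarrow> s / 2 ^ i < d" using assms by auto
  have "\<bar>average u x (s / 2 ^ i) - u x\<bar> < e" if "N \<le> i" for i
  proof -
    let ?t = "s / 2 ^ i"
    have t: "0 < ?t" using assms by simp
    note m = measure_ball_pos[OF t, of x]
    have "\<bar>u y - u x\<bar> \<le> e / 2" if "y \<in> ball x ?t" for y
      using d(2)[of y] N[OF \<open>N \<le> i\<close>] that by (auto simp: dist_commute dist_real_def abs_minus_commute)
    then have "(LINT y:ball x ?t|M. \<bar>u y - u x\<bar>) \<le> (LINT y:ball x ?t|M. e / 2)"
      by (intro set_integral_mono set_integrable_abs set_integral_diff u set_integrable_const)
    also have "\<dots> = e / 2 * measure M (ball x ?t)"
      unfolding set_lebesgue_integral_def by simp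
    finally have "(LINT y:ball x ?t|M. \<bar>u y - u x\<bar>) / measure M (ball x ?t) \<le> e / 2"
      using m by (simp add: divide_le_eq)
    with average_diff_le[OF t, of x "u x"] \<open>0 < e\<close> show ?thesis by linarith
  qed
  then show "\<exists>N. \<forall>n\<ge>N. norm (average u x (s / 2 ^ n) - u x) < e" by auto
qed

text \<open>
  Telescoping over the balls \<open>B(x, 2\<^sup>-\<^sup>i s)\<close>. The factor \<open>2\<^sup>-\<^sup>i\<close> gained from the radius beats the loss
  \<open>2\<^sup>i\<^sup>/\<^sup>p\<close> from bounding every single mean energy by the weighted sum, because \<open>p > 1\<close>. The result
  is linear in the mean energies and may therefore be integrated over \<open>x\<close> term by term.
\<close>

lemma telescope:
  assumes s: "0 < s"
  shows "epow (ennreal \<bar>u x - average u x s\<bar>) p \<le>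
    ennreal (tele_const p D C * s powr p) * (\<Sum>i. ennreal ((1/2) ^ i) * ennreal (mean_energy x (\<Lambda> * (s / 2 ^ i))))"
    (is "_ \<le> _ * ?S")
proof (cases "?S")
  case (real \<sigma>)
  define \<theta> where "\<theta> = 2 powr (1 / p - 1)"
  define a where "a i = average u x (s / 2 ^ i)" for i
  have \<theta>: "0 < \<theta>" "\<theta> < 1" using p by (auto simp: \<theta>_def powr_less_one)
  have F: "mean_energy x (\<Lambda> * (s / 2 ^ i)) \<le> 2 ^ i * \<sigma>" for i
  proof -
    have "ennreal ((1/2) ^ i) * ennreal (mean_energy x (\<Lambda> * (s / 2 ^ i))) \<le> ennreal \<sigma>"
      unfolding real(2)[symmetric]
      using sum_le_suminf[of "\<lambda>i. ennreal ((1/2) ^ i) * ennreal (mean_energy x (\<Lambda> * (s / 2 ^ i)))" "{i}"]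
      by simp
    then have "(1/2) ^ i * mean_energy x (\<Lambda> * (s / 2 ^ i)) \<le> \<sigma>"
      using real(1) mean_energy_nonneg by (simp flip: ennreal_mult)
    then show ?thesis by (simp add: power_one_over field_simps)
  qed
  let ?q = "D * C * s * \<sigma> powr (1 / p)"
  have q: "0 \<le> ?q" using D C s by simp
  have step: "\<bar>a (Suc i) - a i\<bar> \<le> ?q * \<theta> ^ i" for i
  proof -
    have t: "0 < s / 2 ^ i" "0 < s / 2 ^ Suc i" using s by auto
    have "\<bar>a (Suc i) - a i\<bar> \<le> D * (C * (s / 2 ^ i) * mean_energy x (\<Lambda> * (s / 2 ^ i)) powr (1 / p))"
      unfolding a_def using t D(2)[of "s / 2 ^ Suc i" x]
      by (intro average_subball) (auto intro!: subset_ball)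
    also have "\<dots> \<le> D * (C * (s / 2 ^ i) * (2 ^ i * \<sigma>) powr (1 / p))"
      using F[of i] D C s p mean_energy_nonneg
      by (intro mult_left_mono powr_mono2) auto
    also have "(2 ^ i * \<sigma>) powr (1 / p) = 2 powr (real i / p) * \<sigma> powr (1 / p)"
      using real(1) by (simp add: powr_mult powr_realpow[symmetric] powr_powr)
    also have "D * (C * (s / 2 ^ i) * (2 powr (real i / p) * \<sigma> powr (1 / p))) =
        ?q * (2 powr (real i / p) / 2 ^ i)" by simp
    also have "2 powr (real i / p) / 2 ^ i = \<theta> ^ i"
    proof -
      have "\<theta> ^ i = 2 powr ((1 / p - 1) * real i)"
        using \<theta>(1) by (simp add: \<theta>_def powr_realpow[symmetric] powr_powr)
      also have "(1 / p - 1) * real i = real i / p - real i" by (simp add: algebra_simps)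
      finally show ?thesis by (simp add: powr_diff powr_realpow)
    qed
    finally show ?thesis .
  qed
  have partial: "\<bar>a n - a 0\<bar> \<le> ?q / (1 - \<theta>)" for n
  proof -
    have "\<bar>a n - a 0\<bar> \<le> (\<Sum>i<n. \<bar>a (Suc i) - a i\<bar>)"
      by (simp add: sum_lessThan_telescope[symmetric])
    also have "\<dots> \<le> (\<Sum>i<n. ?q * \<theta> ^ i)" by (intro sum_mono step)
    also have "\<dots> = ?q * ((1 - \<theta> ^ n) / (1 - \<theta>))"
      using \<theta> by (simp add: sum_distrib_left[symmetric] sum_gp_strict)
    also have "\<dots> \<le> ?q * (1 / (1 - \<theta>))"
      using \<theta> q by (intro mult_left_mono divide_right_mono) auto
    finally show ?thesis by simp
  qed
  have "(\<lambda>n. \<bar>a n - a 0\<bar>) \<longlonglongrightarrow> \<bar>u x - a 0\<bar>"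
    unfolding a_def by (intro tendsto_intros average_tendsto s)
  then have "\<bar>u x - a 0\<bar> \<le> ?q / (1 - \<theta>)"
    by (rule LIMSEQ_le_const2) (use partial in blast)
  then have "\<bar>u x - average u x s\<bar> powr p \<le> (?q / (1 - \<theta>)) powr p"
    using p by (intro powr_mono2) (auto simp: a_def)
  also have "?q / (1 - \<theta>) = (D * C / (1 - \<theta>)) * (s * \<sigma> powr (1 / p))" by simp
  also have "\<dots> powr p = tele_const p D C * s powr p * \<sigma>"
    unfolding tele_const_def \<theta>_def[symmetric] using D(1) C s \<theta> real(1) p
    by (subst powr_mult) (auto simp: powr_mult powr_powr)
  finally have "\<bar>u x - average u x s\<bar> powr p \<le> tele_const p D C * s powr p * \<sigma>" .
  then show ?thesis
    using real by (simp add: epow_ennreal tele_const_def ennreal_leI flip: ennreal_mult)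
next
  case top
  have "2 powr (1 / p - 1) < 1" using p by (simp add: powr_less_one)
  then have "0 < D * C / (1 - 2 powr (1 / p - 1))"
    using D(1) C by (intro divide_pos_pos mult_pos_pos) auto
  then have "0 < tele_const p D C * s powr p" using s unfolding tele_const_def by (simp del: divide_eq_0_iff)
  then have "ennreal (tele_const p D C * s powr p) \<noteq> 0" by (simp only: ennreal_eq_0_iff not_le)
  then show ?thesis unfolding top by (simp only: ennreal_mult_top if_False top_greatest)
qed

lemma ennreal_mean_energy:
  assumes "0 < t"
  shows "ennreal (mean_energy x t) = (\<integral>\<^sup>+ y\<in>ball x t. epow (g y) p \<partial>M) / emeasure M (ball x t)"
  using measure_ball_pos[OF assms, of x] energy_nonneg
  by (simp add: mean_energy_def emeasure_ball divide_ennreal flip: ennreal_energy[OF order_refl])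

lemma epow_gradient_measurable: "(\<lambda>y. epow (g y) p) \<in> borel_measurable M"
  using borel_imp_measurable[OF g(1)] by measurable

lemma mean_energy_measurable:
  assumes "0 < t" shows "(\<lambda>x. ennreal (mean_energy x t)) \<in> borel_measurable M"
  unfolding ennreal_mean_energy[OF assms] divide_ennreal_def
  by (intro borel_measurable_times_ennreal borel_measurable_inverse_ennreal
      ball_integral_measurable ball_measure_measurable epow_gradient_measurable)

lemma mean_energy_sum_integral_le:
  assumes s: "0 < s" and [measurable]: "A \<in> sets M" "A' \<in> sets M"
    and sub: "\<And>x. x \<in> A \<Longrightarrow> ball x (\<Lambda> * s) \<subseteq> A'"
  shows "(\<integral>\<^sup>+ x\<in>A. (\<Sum>i. ennreal ((1/2) ^ i) * ennreal (mean_energy x (\<Lambda> * (s / 2 ^ i)))) \<partial>M) \<le>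
    ennreal (2 * D) * (\<integral>\<^sup>+ y\<in>A'. epow (g y) p \<partial>M)"
proof -
  have t: "0 < \<Lambda> * (s / 2 ^ i)" for i using s \<Lambda> by simp
  define F where "F i x = ennreal (mean_energy x (\<Lambda> * (s / 2 ^ i)))" for i x
  have [measurable]: "F i \<in> borel_measurable M" for i
    unfolding F_def by (rule mean_energy_measurable[OF t])
  have "(\<integral>\<^sup>+ x\<in>A. (\<Sum>i. ennreal ((1/2) ^ i) * F i x) \<partial>M) =
      (\<integral>\<^sup>+ x. (\<Sum>i. ennreal ((1/2) ^ i) * (F i x * indicator A x)) \<partial>M)"
    by (simp add: ennreal_suminf_multc[symmetric] mult.assoc)
  also have "\<dots> = (\<Sum>i. ennreal ((1/2) ^ i) * (\<integral>\<^sup>+ x\<in>A. F i x \<partial>M))"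
    by (subst nn_integral_suminf) (auto simp: nn_integral_cmult)
  also have "\<dots> \<le> (\<Sum>i. ennreal ((1/2) ^ i) * (ennreal D * (\<integral>\<^sup>+ y\<in>A'. epow (g y) p \<partial>M)))"
  proof (intro suminf_le mult_left_mono)
    fix i
    have "\<Lambda> * (s / 2 ^ i) \<le> \<Lambda> * s"
      using s \<Lambda> by (intro mult_left_mono) (auto simp: divide_le_eq)
    then have "ball x (\<Lambda> * (s / 2 ^ i)) \<subseteq> ball x (\<Lambda> * s)" for x by (rule subset_ball)
    then show "(\<integral>\<^sup>+ x\<in>A. F i x \<partial>M) \<le> ennreal D * (\<integral>\<^sup>+ y\<in>A'. epow (g y) p \<partial>M)"
      unfolding F_def ennreal_mean_energy[OF t] using D(1) D(2)[OF t] sub t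
      by (intro integral_ball_average_le epow_gradient_measurable) (simp_all, blast)
  qed auto
  also have "\<dots> = ennreal (\<Sum>i. (1/2) ^ i) * (ennreal D * (\<integral>\<^sup>+ y\<in>A'. epow (g y) p \<partial>M))"
    by (subst ennreal_suminf_multc) (auto simp: suminf_ennreal2 summable_geometric)
  also have "(\<Sum>i. (1/2::real) ^ i) = 2" by (simp add: suminf_geometric)
  also have "ennreal 2 * (ennreal D * (\<integral>\<^sup>+ y\<in>A'. epow (g y) p \<partial>M)) =
      ennreal (2 * D) * (\<integral>\<^sup>+ y\<in>A'. epow (g y) p \<partial>M)"
    using D(1) by (simp add: ennreal_mult' mult.assoc)
  finally show ?thesis by (simp only: F_def)
qed


text \<open>
  Every point of the annulus is compared with the average over the small ball about it by
  telescoping, and averages over different small balls are compared along the connecting curves.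
\<close>

lemma annulus_poincare:
  assumes L: "2 \<le> L" and r: "0 < r"
    and conn: "\<And>x y. x \<in> ball x0 (2 * r) - ball x0 r \<Longrightarrow> y \<in> ball x0 (2 * r) - ball x0 r \<Longrightarrow>
      \<exists>\<gamma>. path \<gamma> \<and> pathstart \<gamma> = x \<and> pathfinish \<gamma> = y \<and>
        path_image \<gamma> \<subseteq> ball x0 (L * r) - ball x0 (r / L) \<and> curve_length \<gamma> 0 1 \<le> ennreal (L * dist x y)"
  obtains c where "(\<integral>\<^sup>+ x\<in>ball x0 (2 * r) - ball x0 r. epow (ennreal \<bar>u x - c\<bar>) p \<partial>M) \<le>
    ennreal (annulus_const p D C \<Lambda> L * r powr p) *
      (\<integral>\<^sup>+ x\<in>ball x0 ((L + 1) * r) - ball x0 (r / (2 * L)). epow (g x) p \<partial>M)"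
proof (cases "ball x0 (2 * r) - ball x0 r = {}")
  case True
  show ?thesis using that[of 0] unfolding True by simp
next
  case False
  let ?A = "ball x0 (2 * r) - ball x0 r" and ?S = "ball x0 (L * r) - ball x0 (r / L)"
  let ?A' = "ball x0 ((L + 1) * r) - ball x0 (r / (2 * L))"
  obtain z where z: "z \<in> ?A" using False by blast
  define \<epsilon> where "\<epsilon> = 1 / (4 * \<Lambda> * L)"
  define n where "n = nat \<lceil>4 * L / \<epsilon>\<rceil>"
  define j where "j = nat \<lceil>(L + 2) / \<epsilon>\<rceil>"
  define s where "s = \<epsilon> * r"
  define c where "c = average u z s"
  have \<epsilon>: "0 < \<epsilon>" using \<Lambda> L by (simp add: \<epsilon>_def)
  have s: "0 < s" using \<epsilon> r by (simp add: s_def)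
  have \<Lambda>s: "\<Lambda> * (2 * s) = r / (2 * L)" using \<Lambda> L by (simp add: s_def \<epsilon>_def)
  have n: "4 * L * r \<le> real n * s"
  proof -
    have "4 * L / \<epsilon> \<le> real n" unfolding n_def by linarith
    then show ?thesis using \<epsilon> r by (simp add: s_def field_simps)
  qed
  have j: "(L + 2) * r \<le> 2 ^ j * s"
  proof -
    have "(L + 2) / \<epsilon> \<le> real j" unfolding j_def by linarith
    also have "real j \<le> 2 ^ j" using less_exp[of j] by (metis of_nat_le_iff of_nat_numeral of_nat_power less_imp_le)
    finally have "L + 2 \<le> 2 ^ j * \<epsilon>" using \<epsilon> by (simp add: field_simps)
    then have "(L + 2) * r \<le> (2 ^ j * \<epsilon>) * r" using r by (intro mult_right_mono) auto
    then show ?thesis by (simp add: s_def mult.assoc)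
  qed
  have rL: "r / L \<le> r" "2 * r \<le> L * r" using L r by (auto simp: field_simps)
  have AS: "?A \<subseteq> ?S"
  proof
    fix x assume "x \<in> ?A"
    then have "r \<le> dist x0 x" "dist x0 x < 2 * r" by auto
    then have "r / L \<le> dist x0 x" "dist x0 x < L * r" using rL by linarith+
    then show "x \<in> ?S" by simp
  qed
  have big: "ball x (\<Lambda> * (2 * s)) \<subseteq> ?A'" if "x \<in> ?S" for x
  proof
    fix y assume "y \<in> ball x (\<Lambda> * (2 * s))"
    then have y: "dist x y < r / (2 * L)" by (simp add: \<Lambda>s)
    have "r / L = r / (2 * L) + r / (2 * L)" using L by (simp add: field_simps)
    moreover have "r / (2 * L) \<le> r" using L r by (simp add: field_simps)
    ultimately show "y \<in> ?A'"
      using that y dist_triangle[of x0 x y] dist_triangle[of x0 y x]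
      by (auto simp: dist_commute algebra_simps)
  qed
  have A'ball: "?A' \<subseteq> ball x0 ((L + 1) * r)" by blast
  define m0 where "m0 = measure M (ball x0 (2 * r))"
  have m0: "0 < m0" using r by (simp add: m0_def measure_ball_pos)
  have small: "mean_energy x (\<Lambda> * (2 * s)) \<le> energy g ?A' * D ^ j / m0" if "x \<in> ?S" for x
  proof -
    have "ball x0 (2 * r) \<subseteq> ball x (2 ^ j * s)"
    proof
      fix y assume "y \<in> ball x0 (2 * r)"
      then show "y \<in> ball x (2 ^ j * s)"
        using that j dist_triangle[of x y x0] by (auto simp: dist_commute algebra_simps)
    qed
    then have "m0 \<le> D ^ j * measure M (ball x s)"
      unfolding m0_def using measure_ball_mono doubling_power[OF s] order_trans by blast
    also have "\<dots> \<le> D ^ j * measure M (ball x (\<Lambda> * (2 * s)))"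
    proof (intro mult_left_mono measure_ball_mono subset_ball)
      have "1 * s \<le> \<Lambda> * (2 * s)" using \<Lambda> s by (intro mult_mono) auto
      then show "s \<le> \<Lambda> * (2 * s)" by simp
    qed (use D in auto)
    finally have m: "m0 \<le> D ^ j * measure M (ball x (\<Lambda> * (2 * s)))" .
    have pos: "0 < measure M (ball x (\<Lambda> * (2 * s)))" using \<Lambda> s by (intro measure_ball_pos) simp
    have "mean_energy x (\<Lambda> * (2 * s)) \<le> energy g ?A' / measure M (ball x (\<Lambda> * (2 * s)))"
      unfolding mean_energy_def using energy_mono[OF big[OF that] A'ball] pos by (simp add: divide_right_mono)
    also have "\<dots> \<le> energy g ?A' * (D ^ j / m0)"
      unfolding divide_inverse using m pos m0 energy_nonneg
      by (intro mult_left_mono) (auto simp: field_simps)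
    finally show ?thesis by simp
  qed
  define d where "d = 4 * D\<^sup>2 * C * s * (energy g ?A' * D ^ j / m0) powr (1 / p)"
  have step: "\<bar>average u x s - average u y s\<bar> \<le> d" if "x \<in> ?S" "y \<in> ?S" "dist x y \<le> s" for x y
  proof -
    let ?R = "C * (2 * s) * mean_energy x (\<Lambda> * (2 * s)) powr (1 / p)"
    have xs: "\<bar>average u x s - average u x (2 * s)\<bar> \<le> D * ?R"
      using s D(2)[OF s] by (intro average_subball subset_ball) auto
    have sub: "ball y s \<subseteq> ball x (2 * s)" "ball x (2 * s) \<subseteq> ball y (2 * (2 * s))"
    proof safe
      fix w assume "w \<in> ball y s"
      then show "w \<in> ball x (2 * s)" using that(3) dist_triangle[of x w y] by simp
    next
      fix w assume "w \<in> ball x (2 * s)"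
      then show "w \<in> ball y (2 * (2 * s))" using that(3) s dist_triangle[of y w x] by (simp add: dist_commute)
    qed
    have "measure M (ball x (2 * s)) \<le> D\<^sup>2 * measure M (ball y s)"
      using measure_ball_mono[OF sub(2)] doubling_power[OF s, of y 2] by (simp add: mult.assoc)
    then have ys: "\<bar>average u y s - average u x (2 * s)\<bar> \<le> D\<^sup>2 * ?R"
      using s sub(1) by (intro average_subball) auto
    have R: "0 \<le> ?R" using C s by simp
    have "D \<le> D\<^sup>2" using D(1) by (simp add: power2_eq_square)
    then have "D * ?R \<le> D\<^sup>2 * ?R" using R by (rule mult_right_mono)
    then have "\<bar>average u x s - average u y s\<bar> \<le> 2 * D\<^sup>2 * ?R" using xs ys by linarith
    also have "\<dots> \<le> 2 * D\<^sup>2 * (C * (2 * s) * (energy g ?A' * D ^ j / m0) powr (1 / p))"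
      using small[OF that(1)] mean_energy_nonneg C s p D
      by (intro mult_left_mono powr_mono2) auto
    finally show ?thesis by (simp add: d_def mult_ac)
  qed
  have chain: "\<bar>average u x s - c\<bar> \<le> (real n + 1) * d" if x: "x \<in> ?A" for x
  proof -
    obtain \<gamma> where \<gamma>: "path \<gamma>" "pathstart \<gamma> = x" "pathfinish \<gamma> = z" "path_image \<gamma> \<subseteq> ?S"
      "curve_length \<gamma> 0 1 \<le> ennreal (L * dist x z)"
      using conn[OF x z] by blast
    have "dist x z \<le> 4 * r" using x z dist_triangle[of x z x0] by (auto simp: dist_commute)
    then have "L * dist x z \<le> L * (4 * r)" using L by (intro mult_left_mono) auto
    also have "\<dots> \<le> real n * s" using n by (simp add: mult_ac)
    finally have "L * dist x z \<le> real n * s" .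
    then have "curve_length \<gamma> 0 1 \<le> ennreal (real n * s)"
      using \<gamma>(5) by (meson ennreal_leI order_trans)
    then have "\<bar>average u (\<gamma> 0) s - average u (\<gamma> 1) s\<bar> \<le> (real n + 1) * d"
      using \<gamma>(1,4) s step
      by (intro chain_along_curve[where S="?S" and s=s and U="\<lambda>x. average u x s"])
        (auto simp: path_def path_image_def)
    then show ?thesis using \<gamma>(2,3) by (simp add: c_def pathstart_def pathfinish_def)
  qed
  define T where "T x = (\<Sum>i. ennreal ((1/2) ^ i) * ennreal (mean_energy x (\<Lambda> * (s / 2 ^ i))))" for x
  have T: "(\<integral>\<^sup>+ x\<in>?A. T x \<partial>M) \<le> ennreal (2 * D) * (\<integral>\<^sup>+ y\<in>?A'. epow (g y) p \<partial>M)"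
    unfolding T_def
  proof (rule mean_energy_sum_integral_le[OF s])
    fix x assume "x \<in> ?A"
    have "\<Lambda> * s \<le> \<Lambda> * (2 * s)" using \<Lambda> s by simp
    then have "ball x (\<Lambda> * s) \<subseteq> ball x (\<Lambda> * (2 * s))" by (rule subset_ball)
    also have "\<dots> \<subseteq> ?A'" using AS \<open>x \<in> ?A\<close> by (intro big) blast
    finally show "ball x (\<Lambda> * s) \<subseteq> ?A'" .
  qed auto
  let ?k1 = "tele_const p D C * s powr p" and ?k2 = "((real n + 1) * d) powr p"
  have [measurable]: "(\<lambda>x. ennreal (mean_energy x (\<Lambda> * (s / 2 ^ i)))) \<in> borel_measurable M" for i
    using \<Lambda> s by (intro mean_energy_measurable) simp
  have [measurable]: "T \<in> borel_measurable M"
    unfolding T_def by measurable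
  have k1: "0 \<le> ?k1" by (simp add: tele_const_def)
  have "(\<integral>\<^sup>+ x\<in>?A. epow (ennreal \<bar>u x - c\<bar>) p \<partial>M) \<le>
      (\<integral>\<^sup>+ x. ennreal (2 powr p) * (ennreal ?k1 * (T x * indicator ?A x) + ennreal ?k2 * indicator ?A x) \<partial>M)"
  proof (rule nn_integral_mono)
    fix x
    show "epow (ennreal \<bar>u x - c\<bar>) p * indicator ?A x \<le>
        ennreal (2 powr p) * (ennreal ?k1 * (T x * indicator ?A x) + ennreal ?k2 * indicator ?A x)"
    proof (cases "x \<in> ?A")
      case True
      have "epow (ennreal \<bar>u x - c\<bar>) p \<le>
          epow (ennreal \<bar>u x - average u x s\<bar> + ennreal \<bar>average u x s - c\<bar>) p"
        using p by (intro epow_mono ennreal_abs_triangle) simp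
      also have "\<dots> \<le> ennreal (2 powr p) *
          (epow (ennreal \<bar>u x - average u x s\<bar>) p + epow (ennreal \<bar>average u x s - c\<bar>) p)"
        using p by (intro epow_add_le) simp
      also have "\<dots> \<le> ennreal (2 powr p) * (ennreal ?k1 * T x + ennreal ?k2)"
        using telescope[OF s, of x] chain[OF True] p
        by (intro mult_left_mono add_mono) (auto simp: T_def epow_ennreal intro!: ennreal_leI powr_mono2)
      finally show ?thesis using True by simp
    qed simp
  qed
  also have "\<dots> = ennreal (2 powr p) * (ennreal ?k1 * (\<integral>\<^sup>+ x\<in>?A. T x \<partial>M) + ennreal ?k2 * emeasure M ?A)"
    by (simp add: nn_integral_cmult nn_integral_add nn_integral_cmult_indicator)
  also have "\<dots> \<le> ennreal (2 powr p) * (ennreal ?k1 * (ennreal (2 * D) * ennreal (energy g ?A')) + ennreal ?k2 * ennreal m0)"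
  proof (intro mult_left_mono add_mono)
    show "(\<integral>\<^sup>+ x\<in>?A. T x \<partial>M) \<le> ennreal (2 * D) * ennreal (energy g ?A')"
      using T by (simp add: ennreal_energy[OF A'ball])
    show "emeasure M ?A \<le> ennreal m0"
      unfolding m0_def emeasure_ball[symmetric] by (intro emeasure_mono) auto
  qed auto
  also have "\<dots> = ennreal (2 powr p * (?k1 * (2 * D * energy g ?A') + ?k2 * m0))"
    using k1 D(1) m0 energy_nonneg[of ?A'] by (simp flip: ennreal_mult ennreal_plus)
  also have "2 powr p * (?k1 * (2 * D * energy g ?A') + ?k2 * m0) =
      annulus_const p D C \<Lambda> L * r powr p * energy g ?A'"
  proof -
    have "(real n + 1) * d = ((real n + 1) * (4 * D\<^sup>2 * C * \<epsilon>)) * r * (energy g ?A' * D ^ j / m0) powr (1 / p)"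
      by (simp add: d_def s_def)
    then have "?k2 = ((real n + 1) * (4 * D\<^sup>2 * C * \<epsilon>)) powr p * r powr p * (energy g ?A' * D ^ j / m0)"
      using D(1) C \<epsilon> r p m0 energy_nonneg[of ?A'] by (simp add: powr_mult powr_powr)
    then show ?thesis
      unfolding annulus_const_def Let_def \<epsilon>_def[symmetric] n_def[symmetric] j_def[symmetric]
      using m0 \<epsilon> r by (simp add: s_def powr_mult field_simps)
  qed
  finally show ?thesis
    using that[of c] k1 energy_nonneg
    by (simp add: ennreal_mult'' ennreal_energy[OF A'ball])
qed

end


section \<open>Hole filling and iteration\<close>

text \<open>
  Iterating \<open>I \<rho> \<le> \<theta> I (\<sigma> \<rho>)\<close> as long as \<open>\<sigma>\<^sup>k r \<le> R\<close> gives the power \<open>\<beta> = - log\<^sub>\<sigma> \<theta>\<close>; the last,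
  incomplete step costs the factor \<open>1 / \<theta>\<close>.
\<close>

lemma power_decay_of_geometric_decay:
  fixes I :: "real \<Rightarrow> real"
  assumes mono: "\<And>\<rho> \<rho>'. \<rho> \<le> \<rho>' \<Longrightarrow> I \<rho> \<le> I \<rho>'" and nonneg: "\<And>\<rho>. 0 \<le> I \<rho>"
    and \<theta>: "0 < \<theta>" and \<sigma>: "1 < \<sigma>"
    and decay: "\<And>\<rho>. 0 < \<rho> \<Longrightarrow> I \<rho> \<le> \<theta> * I (\<sigma> * \<rho>)"
    and r: "0 < r" "r < R" and \<theta>1: "\<theta> < 1"
  shows "I r \<le> 1 / \<theta> * (r / R) powr (- log \<sigma> \<theta>) * I R"
proof -
  define k where "k = nat \<lfloor>log \<sigma> (R / r)\<rfloor>"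
  have "0 \<le> log \<sigma> (R / r)" using r \<sigma> by (simp add: zero_le_log_cancel_iff)
  then have k: "real k \<le> log \<sigma> (R / r)" "log \<sigma> (R / r) < real k + 1"
    unfolding k_def by linarith+
  have iter: "I r \<le> \<theta> ^ i * I (\<sigma> ^ i * r)" for i
  proof (induction i)
    case (Suc i)
    have "I (\<sigma> ^ i * r) \<le> \<theta> * I (\<sigma> * (\<sigma> ^ i * r))"
      using r \<sigma> by (intro decay) simp
    then have "\<theta> ^ i * I (\<sigma> ^ i * r) \<le> \<theta> ^ i * (\<theta> * I (\<sigma> * (\<sigma> ^ i * r)))"
      using \<theta> by (intro mult_left_mono) auto
    with Suc show ?case by (simp add: mult_ac)
  qed simp
  have "\<sigma> ^ k = \<sigma> powr real k" using \<sigma> by (simp add: powr_realpow)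
  also have "\<dots> \<le> \<sigma> powr log \<sigma> (R / r)" using k \<sigma> by (intro powr_mono) auto
  also have "\<dots> = R / r" using r \<sigma> by simp
  finally have "\<sigma> ^ k * r \<le> R" using r by (simp add: field_simps)
  then have "I (\<sigma> ^ k * r) \<le> I R" by (rule mono)
  then have "I r \<le> \<theta> ^ k * I R"
    using iter[of k] \<theta> by (meson mult_left_mono order_trans zero_le_power less_imp_le)
  also have "\<theta> ^ k \<le> 1 / \<theta> * (r / R) powr (- log \<sigma> \<theta>)"
  proof -
    have "\<theta> ^ k * \<theta> = \<theta> powr (real k + 1)" using \<theta> by (simp add: powr_add powr_realpow)
    also have "\<dots> \<le> \<theta> powr log \<sigma> (R / r)" using k \<theta> \<theta>1 by (intro powr_mono') auto
    also have "\<dots> = (R / r) powr log \<sigma> \<theta>"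
      using \<theta> r by (simp add: powr_def log_def)
    also have "\<dots> = (r / R) powr (- log \<sigma> \<theta>)"
      using r by (simp add: powr_def ln_div field_simps)
    finally show ?thesis using \<theta> by (simp add: field_simps)
  qed
  finally show ?thesis using nonneg[of R] by (simp add: mult_right_mono)
qed

context metric_measure
begin

text \<open>Local \<open>L\<^sup>p\<close> integrability implies local integrability because \<open>t \<le> 1 + t\<^sup>p\<close>.\<close>

lemma set_integrable_of_Lp:
  assumes "continuous_on UNIV u" "(\<integral>\<^sup>+ y\<in>ball x s. epow (ennreal \<bar>u y\<bar>) p \<partial>M) < \<infinity>"
  shows "(\<integral>\<^sup>+ y\<in>ball x s. ennreal \<bar>u y\<bar> \<partial>M) < \<infinity>" "set_integrable M (ball x s) u"
proof -
  have [measurable]: "u \<in> borel_measurable M"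
    using assms(1) by (intro borel_imp_measurable borel_measurable_continuous_onI)
  have "\<bar>t\<bar> \<le> 1 + \<bar>t\<bar> powr p" for t :: real
  proof (cases "1 \<le> \<bar>t\<bar>")
    case True
    then have "\<bar>t\<bar> powr 1 \<le> \<bar>t\<bar> powr p" using p by (intro powr_mono) auto
    then show ?thesis using True by simp
  next
    case False
    then show ?thesis using powr_ge_zero[of "\<bar>t\<bar>" p] by linarith
  qed
  then have "ennreal \<bar>t\<bar> \<le> 1 + epow (ennreal \<bar>t\<bar>) p" for t :: real
    by (simp add: epow_ennreal ennreal_leI flip: ennreal_plus ennreal_1)
  then have "(\<integral>\<^sup>+ y\<in>ball x s. ennreal \<bar>u y\<bar> \<partial>M) \<le> (\<integral>\<^sup>+ y\<in>ball x s. (1 + epow (ennreal \<bar>u y\<bar>) p) \<partial>M)"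
    by (intro nn_integral_mono mult_right_mono) auto
  also have "\<dots> = emeasure M (ball x s) + (\<integral>\<^sup>+ y\<in>ball x s. epow (ennreal \<bar>u y\<bar>) p \<partial>M)"
    by (subst nn_set_integral_add) auto
  also have "\<dots> < \<infinity>" using assms(2) ball_finite[of x s] by simp
  finally show fin: "(\<integral>\<^sup>+ y\<in>ball x s. ennreal \<bar>u y\<bar> \<partial>M) < \<infinity>" .
  show "set_integrable M (ball x s) u"
    unfolding set_integrable_def integrable_iff_bounded
  proof (intro conjI)
    have "(\<integral>\<^sup>+ y. ennreal (norm (indicat_real (ball x s) y *\<^sub>R u y)) \<partial>M) = (\<integral>\<^sup>+ y\<in>ball x s. ennreal \<bar>u y\<bar> \<partial>M)"
      by (intro nn_integral_cong) (auto split: split_indicator)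
    then show "(\<integral>\<^sup>+ y. ennreal (norm (indicat_real (ball x s) y *\<^sub>R u y)) \<partial>M) < \<infinity>"
      using fin by simp
  qed measurable
qed

text \<open>
  Restricting a gradient to the enlarged ball removes curves only, so a gradient on the whole space is
  admissible in the local inequality.
\<close>

lemma poincare_pairI:
  assumes D: "1 \<le> D" "\<And>x s. 0 < s \<Longrightarrow> emeasure M (ball x (2 * s)) \<le> ennreal D * emeasure M (ball x s)"
    and C: "0 < C" "1 \<le> \<Lambda>"
    and PI: "\<And>x s u g. 0 < s \<Longrightarrow> u \<in> borel_measurable (restrict_space M (ball x (\<Lambda> * s))) \<Longrightarrow>
      (\<integral>\<^sup>+ y\<in>ball x (\<Lambda> * s). e2ennreal \<bar>u y\<bar> \<partial>M) < \<infinity> \<Longrightarrow>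
      weak_upper_gradient p (restrict_space M (ball x (\<Lambda> * s))) u g \<Longrightarrow>
      (\<integral>\<^sup>+ y\<in>ball x s. e2ennreal \<bar>u y - ereal ((LINT y:ball x s|M. real_of_ereal (u y)) / measure M (ball x s))\<bar> \<partial>M) /
        emeasure M (ball x s) \<le> ennreal (C * s) *
          epow ((\<integral>\<^sup>+ y\<in>ball x (\<Lambda> * s). epow (g y) p \<partial>M) / emeasure M (ball x (\<Lambda> * s))) (1 / p)"
    and u: "continuous_on UNIV u" "\<And>x s. (\<integral>\<^sup>+ y\<in>ball x s. epow (ennreal \<bar>u y\<bar>) p \<partial>M) < \<infinity>"
    and g: "g \<in> borel_measurable borel" "weak_upper_gradient p M (\<lambda>x. ereal (u x)) g"
      "\<And>x s. (\<integral>\<^sup>+ y\<in>ball x s. epow (g y) p \<partial>M) < \<infinity>"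
  shows "poincare_pair M p D C \<Lambda> u g"
proof unfold_locales
  show "measure M (ball x (2 * s)) \<le> D * measure M (ball x s)" if "0 < s" for x s
    using D(2)[OF that, of x] D(1) by (simp add: emeasure_ball flip: ennreal_mult)
  show "set_integrable M (ball x s) u" for x s
    by (rule set_integrable_of_Lp(2)[OF u])
  fix x :: 'a and s :: real assume s: "0 < s"
  have um: "u \<in> borel_measurable M"
    using u(1) by (intro borel_imp_measurable borel_measurable_continuous_onI)
  have ms: "0 < measure M (ball x s)" "0 < measure M (ball x (\<Lambda> * s))"
    using s C by (auto intro!: measure_ball_pos)
  have gf: "(\<integral>\<^sup>+ y\<in>ball x (\<Lambda> * s). epow (g y) p \<partial>M) = ennreal (energy g (ball x (\<Lambda> * s)))"
    unfolding energy_def using g(3)[of x "\<Lambda> * s"] by simp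
  have "(\<lambda>y. ereal (u y)) \<in> borel_measurable (restrict_space M (ball x (\<Lambda> * s)))"
    using um by (intro measurable_restrict_space1) measurable
  from PI[OF s this _ wug_restrict[OF g(2)]] set_integrable_of_Lp(1)[OF u, of x "\<Lambda> * s"]
  have "(\<integral>\<^sup>+ y\<in>ball x s. ennreal \<bar>u y - average u x s\<bar> \<partial>M) / emeasure M (ball x s) \<le>
      ennreal (C * s) * epow (ennreal (energy g (ball x (\<Lambda> * s))) / emeasure M (ball x (\<Lambda> * s))) (1 / p)"
    by (simp add: average_def gf)
  also have "(\<integral>\<^sup>+ y\<in>ball x s. ennreal \<bar>u y - average u x s\<bar> \<partial>M) =
      ennreal (LINT y:ball x s|M. \<bar>u y - average u x s\<bar>)"
  proof -
    have c: "set_integrable M (ball x s) (\<lambda>y. average u x s)"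
      unfolding set_integrable_def using ball_finite[of x s] by simp
    have int: "integrable M (\<lambda>y. indicat_real (ball x s) y *\<^sub>R \<bar>u y - average u x s\<bar>)"
      using set_integrable_abs[OF set_integral_diff(1)[OF set_integrable_of_Lp(2)[OF u] c]]
      by (simp add: set_integrable_def)
    have "(\<integral>\<^sup>+ y\<in>ball x s. ennreal \<bar>u y - average u x s\<bar> \<partial>M) =
        (\<integral>\<^sup>+ y. ennreal (indicat_real (ball x s) y *\<^sub>R \<bar>u y - average u x s\<bar>) \<partial>M)"
      by (intro nn_integral_cong) (auto split: split_indicator)
    also have "\<dots> = ennreal (LINT y:ball x s|M. \<bar>u y - average u x s\<bar>)"
      unfolding set_lebesgue_integral_def by (rule nn_integral_eq_integral[OF int]) auto
    finally show ?thesis .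
  qed
  finally have "ennreal ((LINT y:ball x s|M. \<bar>u y - average u x s\<bar>) / measure M (ball x s)) \<le>
      ennreal (C * s * (energy g (ball x (\<Lambda> * s)) / measure M (ball x (\<Lambda> * s))) powr (1 / p))"
    using ms C s by (simp add: emeasure_ball divide_ennreal set_lebesgue_integral_def energy_def
      epow_ennreal flip: ennreal_mult)
  then have "(LINT y:ball x s|M. \<bar>u y - average u x s\<bar>) / measure M (ball x s) \<le>
      C * s * (energy g (ball x (\<Lambda> * s)) / measure M (ball x (\<Lambda> * s))) powr (1 / p)"
    using C s by (subst (asm) ennreal_le_iff) auto
  then show "(LINT y:ball x s|M. \<bar>u y - average u x s\<bar>) \<le> measure M (ball x s) *
      (C * s * (energy g (ball x (\<Lambda> * s)) / measure M (ball x (\<Lambda> * s))) powr (1 / p))"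
    using ms by (simp add: divide_le_eq mult_ac)
qed (use D C g u in auto)

end

text \<open>
  The annulus on the right of the Caccioppoli inequality, enlarged by the Poincare inequality, is a
  difference of two balls. Moving the inner ball to the left fills the hole.
\<close>

lemma (in poincare_pair) energy_decay:
  assumes qh: "quasiharmonic_with p M Q u" and L: "2 \<le> L" and r: "0 < r"
    and gmin: "is_minimal_wug p M (\<lambda>x. ereal (u x)) g"
      "AE x in M. minimal_wug p M (\<lambda>x. ereal (u x)) x = g x"
    and ufin: "\<And>x s. (\<integral>\<^sup>+ y\<in>ball x s. epow (ennreal \<bar>u y\<bar>) p \<partial>M) < \<infinity>"
    and conn: "\<And>x y. x \<in> ball x0 (2 * r) - ball x0 r \<Longrightarrow> y \<in> ball x0 (2 * r) - ball x0 r \<Longrightarrow>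
      \<exists>\<gamma>. path \<gamma> \<and> pathstart \<gamma> = x \<and> pathfinish \<gamma> = y \<and>
        path_image \<gamma> \<subseteq> ball x0 (L * r) - ball x0 (r / L) \<and> curve_length \<gamma> 0 1 \<le> ennreal (L * dist x y)"
    and K: "K = Q * 2 powr p * (1 + annulus_const p D C \<Lambda> L)"
  shows "energy g (ball x0 (r / (2 * L))) \<le> K / (1 + K) * energy g (ball x0 ((L + 1) * r))"
proof -
  let ?A = "ball x0 (2 * r) - ball x0 r" and ?A' = "ball x0 ((L + 1) * r) - ball x0 (r / (2 * L))"
  let ?k = "annulus_const p D C \<Lambda> L" and ?G = "\<lambda>A. \<integral>\<^sup>+ x\<in>A. epow (g x) p \<partial>M"
  have Q: "1 \<le> Q" using qh by (simp add: quasiharmonic_with_def quasiminimizer_with_def)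
  have k: "0 \<le> ?k" using D(1) C by (simp add: annulus_const_def Let_def tele_const_def)
  have K0: "0 < K" unfolding K using Q k by (intro mult_pos_pos) auto
  obtain c where c: "(\<integral>\<^sup>+ x\<in>?A. epow (ennreal \<bar>u x - c\<bar>) p \<partial>M) \<le> ennreal (?k * r powr p) * ?G ?A'"
    using annulus_poincare[OF L r conn] by blast
  have "r / (2 * L) \<le> r" "2 * r \<le> (L + 1) * r" using L r by (auto simp: field_simps)
  then have AA': "?A \<subseteq> ?A'"
    by (intro Diff_mono subset_ball)
  have "ennreal (1 / r powr p) * (\<integral>\<^sup>+ x\<in>?A. epow (ennreal \<bar>u x - c\<bar>) p \<partial>M) \<le>
      ennreal (1 / r powr p) * (ennreal (?k * r powr p) * ?G ?A')"
    by (intro mult_left_mono c) auto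
  also have "\<dots> = ennreal ?k * ?G ?A'"
    using r k by (simp flip: ennreal_mult mult.assoc)
  finally have "?G (ball x0 (2 * r)) \<le> ennreal (Q * 2 powr p) * (?G ?A' + ennreal ?k * ?G ?A')"
    using set_nn_integral_mono_set[OF AA', of "\<lambda>x. epow (g x) p"]
    by (intro order_trans[OF caccioppoli[OF qh r g(1) gmin g(2) ufin, of x0 c]] mult_left_mono add_mono) auto
  moreover have A'ball: "?A' \<subseteq> ball x0 ((L + 1) * r)" by blast
  ultimately have "ennreal (energy g (ball x0 (2 * r))) \<le>
      ennreal (Q * 2 powr p) * (ennreal (energy g ?A') + ennreal ?k * ennreal (energy g ?A'))"
    by (simp add: ennreal_energy[OF A'ball] ennreal_energy[OF order_refl])
  also have "\<dots> = ennreal (K * energy g ?A')"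
    using Q k energy_nonneg[of ?A'] unfolding K
    by (simp add: distrib_left distrib_right mult.assoc flip: ennreal_mult ennreal_plus)
  finally have outer: "energy g (ball x0 (2 * r)) \<le> K * energy g ?A'"
    using K0 energy_nonneg by (simp add: ennreal_le_iff)
  have [measurable]: "(\<lambda>x. epow (g x) p) \<in> borel_measurable M" by (rule epow_gradient_measurable)
  have sub: "ball x0 (r / (2 * L)) \<subseteq> ball x0 ((L + 1) * r)"
  proof (rule subset_ball)
    have "r / (2 * L) \<le> 1 * r" using L r by (auto simp: field_simps)
    also have "\<dots> \<le> (L + 1) * r" using L r by (intro mult_right_mono) auto
    finally show "r / (2 * L) \<le> (L + 1) * r" .
  qed
  have "?G (ball x0 ((L + 1) * r)) = ?G (ball x0 (r / (2 * L))) + ?G ?A'"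
    using sub by (subst nn_integral_add[symmetric]) (auto intro!: nn_integral_cong split: split_indicator)
  then have split: "energy g (ball x0 ((L + 1) * r)) = energy g (ball x0 (r / (2 * L))) + energy g ?A'"
    using energy_nonneg
    by (simp flip: ennreal_energy[OF A'ball] ennreal_energy[OF order_refl] ennreal_plus)
  have "ball x0 (r / (2 * L)) \<subseteq> ball x0 (2 * r)"
    using L r by (intro subset_ball) (auto simp: field_simps)
  then have "energy g (ball x0 (r / (2 * L))) \<le> energy g (ball x0 (2 * r))"
    by (rule energy_mono) (rule order_refl)
  with outer have "energy g (ball x0 (r / (2 * L))) \<le>
      K * (energy g (ball x0 ((L + 1) * r)) - energy g (ball x0 (r / (2 * L))))"
    by (simp add: split)
  then show ?thesis using K0 by (simp add: field_simps)
qed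

theorem corollary5p7:
  fixes p :: real and M :: "'a::metric_space measure" and x0 :: 'a and Q :: real
  assumes "1 < p"
    and "metric_measure_space M"
    and "\<not> bounded (UNIV :: 'a set)"
    and "globally_doubling M"
    and "poincare_inequality p M"
    and "annularly_quasiconvex_around x0"
  shows "\<exists>\<beta>>0. \<exists>C>0. \<forall>u. quasiharmonic_with p M Q u \<longrightarrow>
    (\<forall>r R. 0 < r \<and> r < R \<longrightarrow>
      (\<integral>\<^sup>+ x\<in>ball x0 r. epow (minimal_wug p M (\<lambda>x. ereal (u x)) x) p \<partial>M)
        \<le> ennreal (C * (r / R) powr \<beta>) *
          (\<integral>\<^sup>+ x\<in>ball x0 R. epow (minimal_wug p M (\<lambda>x. ereal (u x)) x) p \<partial>M))"
proof -
  interpret metric_measure M p by (rule metric_measure.intro) fact+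
  obtain D0 where D0: "0 < D0" "\<And>x s. 0 < s \<Longrightarrow> emeasure M (ball x (2 * s)) \<le> ennreal D0 * emeasure M (ball x s)"
    using assms(4) unfolding globally_doubling_def by blast
  define D where "D = max 1 D0"
  have D: "emeasure M (ball x (2 * s)) \<le> ennreal D * emeasure M (ball x s)" if "0 < s" for x s
  proof -
    have "ennreal D0 * emeasure M (ball x s) \<le> ennreal D * emeasure M (ball x s)"
      by (intro mult_right_mono ennreal_leI) (auto simp: D_def)
    with D0(2)[OF that] show ?thesis by (rule order_trans)
  qed
  have D1: "1 \<le> D" by (simp add: D_def)
  obtain C \<Lambda> where C: "0 < C" "1 \<le> \<Lambda>" and
    PI: "\<And>x s u g. 0 < s \<Longrightarrow> u \<in> borel_measurable (restrict_space M (ball x (\<Lambda> * s))) \<Longrightarrow>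
      (\<integral>\<^sup>+ y\<in>ball x (\<Lambda> * s). e2ennreal \<bar>u y\<bar> \<partial>M) < \<infinity> \<Longrightarrow>
      weak_upper_gradient p (restrict_space M (ball x (\<Lambda> * s))) u g \<Longrightarrow>
      (\<integral>\<^sup>+ y\<in>ball x s. e2ennreal \<bar>u y - ereal ((LINT y:ball x s|M. real_of_ereal (u y)) / measure M (ball x s))\<bar> \<partial>M) /
        emeasure M (ball x s) \<le> ennreal (C * s) *
          epow ((\<integral>\<^sup>+ y\<in>ball x (\<Lambda> * s). epow (g y) p \<partial>M) / emeasure M (ball x (\<Lambda> * s))) (1 / p)"
    using assms(5) unfolding poincare_inequality_def Let_def by blast
  obtain L where L: "2 \<le> L" and conn: "\<And>r x y. 0 < r \<Longrightarrow> x \<in> ball x0 (2 * r) - ball x0 r \<Longrightarrow>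
      y \<in> ball x0 (2 * r) - ball x0 r \<Longrightarrow>
      \<exists>\<gamma>. path \<gamma> \<and> pathstart \<gamma> = x \<and> pathfinish \<gamma> = y \<and>
        path_image \<gamma> \<subseteq> ball x0 (L * r) - ball x0 (r / L) \<and> curve_length \<gamma> 0 1 \<le> ennreal (L * dist x y)"
  proof -
    obtain L where "2 \<le> L" "\<forall>r>0. \<forall>x \<in> ball x0 (2 * r) - ball x0 r. \<forall>y \<in> ball x0 (2 * r) - ball x0 r.
        \<exists>\<gamma>. path \<gamma> \<and> pathstart \<gamma> = x \<and> pathfinish \<gamma> = y \<and>
          path_image \<gamma> \<subseteq> ball x0 (L * r) - ball x0 (r / L) \<and> curve_length \<gamma> 0 1 \<le> ennreal (L * dist x y)"
      using assms(6) unfolding annularly_quasiconvex_around_def by blast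
    then show ?thesis by (intro that[of L]) (simp, meson)
  qed
  \<comment> \<open>For \<open>Q < 1\<close> there are no quasiharmonic functions, but the constants must still be positive.\<close>
  define K where "K = max 1 Q * 2 powr p * (1 + annulus_const p D C \<Lambda> L)"
  define \<theta> where "\<theta> = K / (1 + K)"
  define \<sigma> where "\<sigma> = 2 * L * (L + 1)"
  have "0 \<le> annulus_const p D C \<Lambda> L" using D1 C by (simp add: annulus_const_def Let_def tele_const_def)
  then have K: "0 < K" unfolding K_def by (intro mult_pos_pos) auto
  then have \<theta>: "0 < \<theta>" "\<theta> < 1" by (auto simp: \<theta>_def)
  have "2 * 2 * (0 + 1) \<le> \<sigma>" unfolding \<sigma>_def using L by (intro mult_mono) auto
  then have \<sigma>: "1 < \<sigma>" by simp
  have \<beta>: "0 < - log \<sigma> \<theta>" using \<sigma> \<theta> by simp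
  show ?thesis
  proof (rule exI[of _ "- log \<sigma> \<theta>"], rule conjI[OF \<beta>], rule exI[of _ "1 / \<theta>"], intro conjI allI impI)
    fix u :: "'a \<Rightarrow> real" and r R :: real
    assume qh: "quasiharmonic_with p M Q u" and r: "0 < r \<and> r < R"
    have Q: "max 1 Q = Q" using qh by (simp add: quasiharmonic_with_def quasiminimizer_with_def)
    obtain g where grad: "g \<in> borel_measurable borel" "is_minimal_wug p M (\<lambda>x. ereal (u x)) g"
      "AE x in M. minimal_wug p M (\<lambda>x. ereal (u x)) x = g x"
      "\<And>x s. (\<integral>\<^sup>+ y\<in>ball x s. epow (g y) p \<partial>M) < \<infinity>"
      "\<And>x s. (\<integral>\<^sup>+ y\<in>ball x s. epow (ennreal \<bar>u y\<bar>) p \<partial>M) < \<infinity>"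
      by (rule quasiharmonic_gradient[OF qh]) blast
    have u: "continuous_on UNIV u" using qh by (simp add: quasiharmonic_with_def)
    have wug: "weak_upper_gradient p M (\<lambda>x. ereal (u x)) g" using grad(2) unfolding is_minimal_wug_def by blast
    interpret poincare_pair M p D C \<Lambda> u g
      by (rule poincare_pairI[OF D1 D C PI u grad(5) grad(1) wug grad(4)])
    let ?I = "\<lambda>\<rho>. energy g (ball x0 \<rho>)"
    have "?I r \<le> 1 / \<theta> * (r / R) powr (- log \<sigma> \<theta>) * ?I R"
    proof (rule power_decay_of_geometric_decay)
      fix \<rho> :: real assume \<rho>: "0 < \<rho>"
      \<comment> \<open>This makes \<open>\<rho>\<close> the inner radius \<open>t / (2 * L)\<close> of the enlarged annulus.\<close>
      define t where "t = 2 * L * \<rho>"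
      have t: "0 < t" "t / (2 * L) = \<rho>" "(L + 1) * t = \<sigma> * \<rho>"
        using \<rho> L by (auto simp: t_def \<sigma>_def)
      show "?I \<rho> \<le> \<theta> * ?I (\<sigma> * \<rho>)"
        using energy_decay[OF qh L t(1) grad(2,3,5) conn[OF t(1)] K_def[unfolded Q]]
        unfolding t \<theta>_def .
    qed (use r \<theta> \<sigma> energy_nonneg in \<open>auto intro!: energy_mono subset_ball\<close>)
    then have "ennreal (?I r) \<le> ennreal (1 / \<theta> * (r / R) powr (- log \<sigma> \<theta>)) * ennreal (?I R)"
      using \<theta> energy_nonneg by (simp add: ennreal_leI flip: ennreal_mult)
    moreover have "(\<integral>\<^sup>+ x\<in>ball x0 \<rho>. epow (minimal_wug p M (\<lambda>x. ereal (u x)) x) p \<partial>M) = ennreal (?I \<rho>)" for \<rho>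
      unfolding ennreal_energy[OF order_refl]
      using grad(3) by (intro nn_integral_cong_AE, eventually_elim) simp
    ultimately show "(\<integral>\<^sup>+ x\<in>ball x0 r. epow (minimal_wug p M (\<lambda>x. ereal (u x)) x) p \<partial>M) \<le>
        ennreal (1 / \<theta> * (r / R) powr (- log \<sigma> \<theta>)) *
          (\<integral>\<^sup>+ x\<in>ball x0 R. epow (minimal_wug p M (\<lambda>x. ereal (u x)) x) p \<partial>M)"
      by simp
  qed (use \<theta> in simp)
qed

end
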